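(* Let $(H,S,\alpha)$ be a finite-dimensional Hom-Hopf algebra with $\alpha$ bijective. Then $(H^{op}\bowtie H^*,\ \alpha\otimes(\alpha^{-1})^* )$, i.e. the vector space $H\otimes H^*$ with unit $1\otimes\varepsilon$, counit $h\otimes f\mapsto\varepsilon(h)f(1)$, the tensor comultiplication $$\Delta(h\otimes f)=h_1\otimes f_1\otimes h_2\otimes f_2$$ and the multiplication $$(h\otimes f)(k\otimes g)=\alpha^{-2}(k_{21})h\otimes\big[\alpha^{-3}(k_{22})\rightharpoonup\big((\alpha^* )^2(f)\leftharpoonup S\alpha^{-3}(k_1)\big)\big]g,\qquad h,k\in H,\ f,g\in H^*,$$ is a Hom-Hopf algebra (the Drinfel'd double of $H$).
   Context: Everything is over a fixed field $k$. Sweedler notation $\Delta(c)=c_1\otimes c_2$, $\Delta(c_2)=c_{21}\otimes c_{22}$ etc. (summation omitted). A (unital) Hom-associative algebra is $(A,\mu,\alpha)$ with $\mu(a\otimes b)=ab$, $1_A\in A$, such that $\alpha(ab)=\alpha(a)\alpha(b)$, $\alpha(1_A)=1_A$, $1_Aa=\alpha(a)=a1_A$, $\alpha(a)(bc)=(ab)\alpha(c)$. A (counital) Hom-coassociative coalgebra is $(C,\Delta,\varepsilon,\alpha)$ with $\varepsilon\circ\alpha=\varepsilon$, $(\alpha\otimes\alpha)\Delta=\Delta\alpha$, $(\varepsilon\otimes id)\Delta=\alpha=(id\otimes\varepsilon)\Delta$, $(\Delta\otimes\alpha)\Delta=(\alpha\otimes\Delta)\Delta$. A Hom-bialgebra is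 both, with the same $\alpha$, such that $\Delta$ and $\varepsilon$ are unital and multiplicative. A Hom-Hopf algebra is a Hom-bialgebra with a linear map $S$ such that $S\alpha=\alpha S$ and $S(h_1)h_2=h_1S(h_2)=\varepsilon(h)1$. In the displayed formula, $\alpha^{-2}(k_{21})h$ is the product of $H$. The dual $H^*$ is the Hom-Hopf algebra with structure map $(\alpha^{-1})^*$ ($f\mapsto f\circ\alpha^{-1}$), product $(f\bullet g)(h)=f(\alpha^{-2}(h_1))g(\alpha^{-2}(h_2))$ (written $fg$), unit $\varepsilon$, coproduct $\Delta(f)=f_1\otimes f_2$ determined by $f_1(h)f_2(k)=f(\alpha^{-2}(hk))$, counit $f\mapsto f(1)$, antipode $S^*$. Also $\alpha^*(f)=f\circ\alpha$, and for $h,k\in H$, $f\in H^*$: $\langle f\leftharpoonup h,k\rangle=\langle f,h\alpha^{-2}(k)\rangle$ and $\langle h\rightharpoonup f,k\rangle=\langle f,\alpha^{-2}(k)h\rangle$. *)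

theory Defs
  imports Complex_Main "HOL-Library.Function_Algebras"
begin

section \<open>Vector spaces with an explicit carrier\<close>

text \<open>The ground field is the type \<open>'k\<close>. A vector space is a subspace \<open>vcarrier V\<close> of an ambient
  type \<open>'a\<close> on which \<open>smult V\<close> is a vector space structure; carriers are needed because
  dual spaces and tensor products are not types of their own.\<close>

record ('k, 'a) vspace =
  vcarrier :: "'a set"
  smult :: "'k \<Rightarrow> 'a \<Rightarrow> 'a"

definition is_vspace :: "('k::field, 'a::ab_group_add, 'm) vspace_scheme \<Rightarrow> bool" where
  "is_vspace V \<longleftrightarrow> vector_space (smult V) \<and> module.subspace (smult V) (vcarrier V)"

definition finite_dim :: "('k::field, 'a::ab_group_add, 'm) vspace_scheme \<Rightarrow> bool" where
  "finite_dim V \<longleftrightarrow> (\<exists>B. finite B \<and> module.span (smult V) B = vcarrier V)"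

definition linear_map ::
  "('k, 'a::plus, 'm) vspace_scheme \<Rightarrow> ('k, 'b::plus, 'n) vspace_scheme \<Rightarrow> ('a \<Rightarrow> 'b) \<Rightarrow> bool" where
  "linear_map V W f \<longleftrightarrow>
     (\<forall>x\<in>vcarrier V. f x \<in> vcarrier W) \<and>
     (\<forall>x\<in>vcarrier V. \<forall>y\<in>vcarrier V. f (x + y) = f x + f y) \<and>
     (\<forall>c. \<forall>x\<in>vcarrier V. f (smult V c x) = smult W c (f x))"

definition bilinear_map ::
  "('k, 'a::plus, 'm) vspace_scheme \<Rightarrow> ('k, 'b::plus, 'n) vspace_scheme \<Rightarrow>
   ('k, 'c::plus, 'p) vspace_scheme \<Rightarrow> ('a \<Rightarrow> 'b \<Rightarrow> 'c) \<Rightarrow> bool" where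
  "bilinear_map V W U b \<longleftrightarrow>
     (\<forall>v\<in>vcarrier V. linear_map W U (\<lambda>w. b v w)) \<and>
     (\<forall>w\<in>vcarrier W. linear_map V U (\<lambda>v. b v w))"

definition fscale :: "'k::times \<Rightarrow> ('x \<Rightarrow> 'k) \<Rightarrow> 'x \<Rightarrow> 'k" where
  "fscale c f = (\<lambda>x. c * f x)"

definition ground :: "('k::field, 'k) vspace" where
  "ground = \<lparr>vcarrier = UNIV, smult = (*)\<rparr>"

definition restr :: "('k, 'a, 'm) vspace_scheme \<Rightarrow> ('a \<Rightarrow> 'k::zero) \<Rightarrow> 'a \<Rightarrow> 'k" where
  "restr V f = (\<lambda>x. if x \<in> vcarrier V then f x else 0)"

text \<open>Functionals are normalised to be 0 outside the carrier, so that equality of functionals on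
  \<open>V\<close> is equality of functions.\<close>

definition dual_space :: "('k::field, 'a::ab_group_add, 'm) vspace_scheme \<Rightarrow> ('k, 'a \<Rightarrow> 'k) vspace" where
  "dual_space V = \<lparr>vcarrier = {f. linear_map V ground f \<and> restr V f = f}, smult = fscale\<rparr>"


section \<open>Tensor products\<close>

text \<open>\<open>V \<otimes> W\<close> is realised inside the dual of the space of bilinear forms on \<open>V \<times> W\<close>: the pure
  tensor \<open>v \<otimes> w\<close> is evaluation at \<open>(v, w)\<close>, and \<open>V \<otimes> W\<close> is the span of the pure tensors (finite
  sums only, so this is the algebraic tensor product in any dimension). The
  universal property is proved below (\<open>tensor_universal\<close>, \<open>tensor_lift_unique\<close>).\<close>

type_synonym ('k, 'a, 'b) tens = "('a \<Rightarrow> 'b \<Rightarrow> 'k) \<Rightarrow> 'k"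

definition pure_tensor ::
  "('k::field, 'a::ab_group_add, 'm) vspace_scheme \<Rightarrow> ('k, 'b::ab_group_add, 'n) vspace_scheme \<Rightarrow>
   'a \<Rightarrow> 'b \<Rightarrow> ('k, 'a, 'b) tens" where
  "pure_tensor V W v w = (\<lambda>\<beta>. if bilinear_map V W ground \<beta> then \<beta> v w else 0)"

definition tensor ::
  "('k::field, 'a::ab_group_add, 'm) vspace_scheme \<Rightarrow> ('k, 'b::ab_group_add, 'n) vspace_scheme \<Rightarrow>
   ('k, ('k, 'a, 'b) tens) vspace" where
  "tensor V W =
     \<lparr>vcarrier = module.span fscale {pure_tensor V W v w |v w. v \<in> vcarrier V \<and> w \<in> vcarrier W},
      smult = fscale\<rparr>"

text \<open>\<open>tensor_lift V W U b\<close> is the linear map \<open>V \<otimes> W \<rightarrow> U\<close> induced by a bilinear \<open>b\<close>, unique on the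
  carrier of \<open>V \<otimes> W\<close>. Sweedler notation is an instance: for \<open>\<Delta>(c) = c\<^sub>1 \<otimes> c\<^sub>2\<close>, the sum
  \<open>b(c\<^sub>1, c\<^sub>2)\<close> is \<open>tensor_lift C C U (\<lambda>c1 c2. b c1 c2) (\<Delta> c)\<close>.\<close>

definition tensor_lift ::
  "('k::field, 'a::ab_group_add, 'm) vspace_scheme \<Rightarrow> ('k, 'b::ab_group_add, 'n) vspace_scheme \<Rightarrow>
   ('k, 'c::ab_group_add, 'p) vspace_scheme \<Rightarrow> ('a \<Rightarrow> 'b \<Rightarrow> 'c) \<Rightarrow> ('k, 'a, 'b) tens \<Rightarrow> 'c" where
  "tensor_lift V W U b =
     (SOME L. linear_map (tensor V W) U L \<and>
       (\<forall>v\<in>vcarrier V. \<forall>w\<in>vcarrier W. L (pure_tensor V W v w) = b v w))"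

lemma vector_space_fscale: "vector_space (fscale :: 'k::field \<Rightarrow> ('x \<Rightarrow> 'k) \<Rightarrow> 'x \<Rightarrow> 'k)"
  by unfold_locales (auto simp: fscale_def fun_eq_iff algebra_simps)

lemma vector_space_times: "vector_space ((*) :: 'k::field \<Rightarrow> 'k \<Rightarrow> 'k)"
  by unfold_locales (auto simp: algebra_simps)

lemma is_vspace_ground: "is_vspace ground"
proof -
  interpret vector_space "(*) :: 'k::field \<Rightarrow> 'k \<Rightarrow> 'k" by (rule vector_space_times)
  show ?thesis by (simp add: is_vspace_def ground_def vector_space_axioms)
qed

lemma is_vspace_tensor:
  fixes V :: "('k::field, 'a::ab_group_add, 'm) vspace_scheme"
    and W :: "('k, 'b::ab_group_add, 'n) vspace_scheme"
  shows "is_vspace (tensor V W)"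
proof -
  interpret vector_space "fscale :: 'k \<Rightarrow> ('k, 'a, 'b) tens \<Rightarrow> _"
    by (rule vector_space_fscale)
  show ?thesis by (simp add: is_vspace_def tensor_def vector_space_fscale subspace_span)
qed

lemma pure_tensor_mem:
  fixes V :: "('k::field, 'a::ab_group_add, 'm) vspace_scheme"
    and W :: "('k, 'b::ab_group_add, 'n) vspace_scheme"
  assumes "v \<in> vcarrier V" "w \<in> vcarrier W"
  shows "pure_tensor V W v w \<in> vcarrier (tensor V W)"
proof -
  interpret vector_space "fscale :: 'k \<Rightarrow> ('k, 'a, 'b) tens \<Rightarrow> _"
    by (rule vector_space_fscale)
  show ?thesis unfolding tensor_def using assms by (auto intro!: span_base)
qed

lemma bilinear_map_pure_tensor:
  assumes "is_vspace V" "is_vspace W"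
  shows "bilinear_map V W (tensor V W) (pure_tensor V W)"
  using pure_tensor_mem[of _ V _ W]
  by (auto simp: bilinear_map_def linear_map_def pure_tensor_def tensor_def fscale_def ground_def
      fun_eq_iff)

lemma tensor_universal:
  fixes V :: "('k::field, 'a::ab_group_add, 'm) vspace_scheme"
    and W :: "('k, 'b::ab_group_add, 'n) vspace_scheme"
    and U :: "('k, 'c::ab_group_add, 'p) vspace_scheme"
  assumes U: "is_vspace U" and b: "bilinear_map V W U b"
  shows "\<exists>L. linear_map (tensor V W) U L \<and>
    (\<forall>v\<in>vcarrier V. \<forall>w\<in>vcarrier W. L (pure_tensor V W v w) = b v w)"
proof -
  interpret p: vector_space_pair "fscale :: 'k \<Rightarrow> ('k, 'a, 'b) tens \<Rightarrow> _" "smult U"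
    using vector_space_fscale U by (auto simp: is_vspace_def vector_space_pair_def)
  interpret q: vector_space_pair "smult U" "(*) :: 'k \<Rightarrow> _"
    using vector_space_times U by (auto simp: is_vspace_def vector_space_pair_def)
  interpret r: vector_space_pair "fscale :: 'k \<Rightarrow> ('k, 'a, 'b) tens \<Rightarrow> _" "(*) :: 'k \<Rightarrow> _"
    using vector_space_times vector_space_fscale by (auto simp: vector_space_pair_def)
  have subU: "p.vs2.subspace (vcarrier U)" using U by (simp add: is_vspace_def)
  define S where "S = {pure_tensor V W v w |v w. v \<in> vcarrier V \<and> w \<in> vcarrier W}"
  obtain B where B: "B \<subseteq> S" "p.vs1.independent B" "S \<subseteq> p.vs1.span B"
    using p.vs1.maximal_independent_subset by blast
  have spanB: "p.vs1.span B = vcarrier (tensor V W)"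
    unfolding tensor_def S_def[symmetric]
    using B by (simp add: p.vs1.span_mono p.vs1.span_minimal p.vs1.subspace_span subset_antisym)
  have "\<forall>t\<in>B. \<exists>v w. v \<in> vcarrier V \<and> w \<in> vcarrier W \<and> t = pure_tensor V W v w"
    using B(1) unfolding S_def by blast
  then obtain f g where fg: "\<And>t. t \<in> B \<Longrightarrow> f t \<in> vcarrier V \<and> g t \<in> vcarrier W \<and>
      t = pure_tensor V W (f t) (g t)"
    by metis
  obtain L where L: "Vector_Spaces.linear fscale (smult U) L" "\<forall>t\<in>B. L t = b (f t) (g t)"
      "range L = p.vs2.span ((\<lambda>t. b (f t) (g t)) ` B)"
    using p.linear_independent_extend_subspace[OF B(2), of "\<lambda>t. b (f t) (g t)"] by blast
  interpret L: Vector_Spaces.linear fscale "smult U" L by (rule L(1))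
  have bU: "b v w \<in> vcarrier U" if "v \<in> vcarrier V" "w \<in> vcarrier W" for v w
    using b that by (auto simp: bilinear_map_def linear_map_def)
  have "p.vs2.span ((\<lambda>t. b (f t) (g t)) ` B) \<subseteq> vcarrier U"
    by (rule p.vs2.span_minimal[OF _ subU]) (use fg bU in blast)
  then have LU: "L t \<in> vcarrier U" for t
    using L(3) by auto
  have main: "L (pure_tensor V W v w) = b v w" if v: "v \<in> vcarrier V" and w: "w \<in> vcarrier W" for v w
  proof (rule ccontr)
    assume "L (pure_tensor V W v w) \<noteq> b v w"
    then have "L (pure_tensor V W v w) - b v w \<noteq> 0" by simp
    then have "p.vs2.independent {L (pure_tensor V W v w) - b v w}"
      by simp
    from q.linear_independent_extend[OF this, of "\<lambda>_. 1"] obtain \<phi>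
      where \<phi>: "Vector_Spaces.linear (smult U) (*) \<phi>" "\<phi> (L (pure_tensor V W v w) - b v w) = 1"
      by auto
    interpret \<phi>: Vector_Spaces.linear "smult U" "(*)" \<phi> by (rule \<phi>(1))
    define \<beta> where "\<beta> = (\<lambda>x y. \<phi> (b x y))"
    have \<beta>: "bilinear_map V W ground \<beta>"
      using b by (auto simp: bilinear_map_def linear_map_def \<beta>_def ground_def \<phi>.add \<phi>.scale)
    have l1: "Vector_Spaces.linear fscale (*) (\<lambda>t. \<phi> (L t))"
      using Vector_Spaces.linear_compose[OF L(1) \<phi>(1)] by (simp add: o_def)
    have l2: "Vector_Spaces.linear fscale (*) (\<lambda>t::('k, 'a, 'b) tens. t \<beta>)"
      by (auto simp: Vector_Spaces.linear_iff vector_space_fscale vector_space_times fscale_def)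
    have "\<phi> (L (pure_tensor V W v w)) = pure_tensor V W v w \<beta>"
    proof (rule r.linear_eq_on[OF l1 l2])
      show "pure_tensor V W v w \<in> p.vs1.span B" using B(3) v w by (auto simp: S_def)
      show "\<phi> (L t) = t \<beta>" if "t \<in> B" for t
      proof -
        have "t \<beta> = \<beta> (f t) (g t)"
          using fg[OF that] \<beta> by (metis pure_tensor_def)
        then show ?thesis using L(2) that by (simp add: \<beta>_def)
      qed
    qed
    also have "\<dots> = \<phi> (b v w)" using \<beta> by (simp add: pure_tensor_def) (simp add: \<beta>_def)
    finally show False using \<phi>(2) by (simp add: \<phi>.diff)
  qed
  have "linear_map (tensor V W) U L"
    using LU by (auto simp: linear_map_def tensor_def L.add L.scale)
  with main show ?thesis by blast
qed

lemma tensor_lift: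
  assumes "is_vspace U" "bilinear_map V W U b"
  shows tensor_lift_linear: "linear_map (tensor V W) U (tensor_lift V W U b)"
    and tensor_lift_pure: "\<And>v w. v \<in> vcarrier V \<Longrightarrow> w \<in> vcarrier W \<Longrightarrow>
      tensor_lift V W U b (pure_tensor V W v w) = b v w"
  using someI_ex[OF tensor_universal[OF assms]] unfolding tensor_lift_def by blast+

lemma tensor_lift_unique:
  fixes V :: "('k::field, 'a::ab_group_add, 'm) vspace_scheme"
    and W :: "('k, 'b::ab_group_add, 'n) vspace_scheme"
  assumes U: "is_vspace U"
    and L: "linear_map (tensor V W) U L" and M: "linear_map (tensor V W) U M"
    and eq: "\<And>v w. v \<in> vcarrier V \<Longrightarrow> w \<in> vcarrier W \<Longrightarrow>
      L (pure_tensor V W v w) = M (pure_tensor V W v w)"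
    and t: "t \<in> vcarrier (tensor V W)"
  shows "L t = M t"
proof -
  interpret T: vector_space "fscale :: 'k \<Rightarrow> ('k, 'a, 'b) tens \<Rightarrow> _" by (rule vector_space_fscale)
  interpret U: vector_space "smult U" using U by (simp add: is_vspace_def)
  have sm: "smult (tensor V W) = fscale" by (simp add: tensor_def)
  have sub: "T.subspace (vcarrier (tensor V W))" by (simp add: tensor_def T.subspace_span)
  have z: "N 0 = 0" if "linear_map (tensor V W) U N" for N
  proof -
    have "N (fscale 0 0) = smult U 0 (N 0)"
      using that T.subspace_0[OF sub] unfolding linear_map_def sm by blast
    then show ?thesis by simp
  qed
  have sub2: "T.subspace {x \<in> vcarrier (tensor V W). L x = M x}"
    using sub L M z[OF L] z[OF M] unfolding T.subspace_def linear_map_def sm by auto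
  have "vcarrier (tensor V W) \<subseteq> {x \<in> vcarrier (tensor V W). L x = M x}"
    apply (subst tensor_def, simp)
    apply (rule T.span_minimal[OF _ sub2])
    using eq pure_tensor_mem[of _ V _ W] by auto
  with t show ?thesis by blast
qed

definition tensor_map ::
  "('k::field, 'a::ab_group_add, 'm) vspace_scheme \<Rightarrow> ('k, 'b::ab_group_add, 'n) vspace_scheme \<Rightarrow>
   ('k, 'c::ab_group_add, 'p) vspace_scheme \<Rightarrow> ('k, 'd::ab_group_add, 'q) vspace_scheme \<Rightarrow>
   ('a \<Rightarrow> 'c) \<Rightarrow> ('b \<Rightarrow> 'd) \<Rightarrow> ('k, 'a, 'b) tens \<Rightarrow> ('k, 'c, 'd) tens" where
  "tensor_map V W V' W' f g =
     tensor_lift V W (tensor V' W') (\<lambda>v w. pure_tensor V' W' (f v) (g w))"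

text \<open>The canonical map \<open>(V \<otimes> W) \<otimes> X \<rightarrow> V \<otimes> (W \<otimes> X)\<close>.\<close>

definition tensor_assoc ::
  "('k::field, 'a::ab_group_add, 'm) vspace_scheme \<Rightarrow> ('k, 'b::ab_group_add, 'n) vspace_scheme \<Rightarrow>
   ('k, 'c::ab_group_add, 'p) vspace_scheme \<Rightarrow>
   ('k, ('k, 'a, 'b) tens, 'c) tens \<Rightarrow> ('k, 'a, ('k, 'b, 'c) tens) tens" where
  "tensor_assoc V W X =
     tensor_lift (tensor V W) X (tensor V (tensor W X))
       (\<lambda>t x. tensor_lift V W (tensor V (tensor W X))
          (\<lambda>v w. pure_tensor V (tensor W X) v (pure_tensor W X w x)) t)"


section \<open>Hom-Hopf algebras\<close>

record ('k, 'a) hom_struct = "('k, 'a) vspace" +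
  mul :: "'a \<Rightarrow> 'a \<Rightarrow> 'a"
  unt :: "'a"
  comul :: "'a \<Rightarrow> ('k, 'a, 'a) tens"
  counit :: "'a \<Rightarrow> 'k"
  twist :: "'a \<Rightarrow> 'a"

definition hom_algebra :: "('k::field, 'a::ab_group_add, 'm) hom_struct_scheme \<Rightarrow> bool" where
  "hom_algebra A \<longleftrightarrow>
     is_vspace A \<and> bilinear_map A A A (mul A) \<and> linear_map A A (twist A) \<and>
     unt A \<in> vcarrier A \<and> twist A (unt A) = unt A \<and>
     (\<forall>a\<in>vcarrier A. \<forall>b\<in>vcarrier A. twist A (mul A a b) = mul A (twist A a) (twist A b)) \<and>
     (\<forall>a\<in>vcarrier A. mul A (unt A) a = twist A a \<and> mul A a (unt A) = twist A a) \<and>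
     (\<forall>a\<in>vcarrier A. \<forall>b\<in>vcarrier A. \<forall>c\<in>vcarrier A.
        mul A (twist A a) (mul A b c) = mul A (mul A a b) (twist A c))"

definition hom_coalgebra :: "('k::field, 'a::ab_group_add, 'm) hom_struct_scheme \<Rightarrow> bool" where
  "hom_coalgebra C \<longleftrightarrow>
     is_vspace C \<and> linear_map C (tensor C C) (comul C) \<and> linear_map C ground (counit C) \<and>
     linear_map C C (twist C) \<and>
     (\<forall>c\<in>vcarrier C. counit C (twist C c) = counit C c) \<and>
     (\<forall>c\<in>vcarrier C. tensor_map C C C C (twist C) (twist C) (comul C c) = comul C (twist C c)) \<and>
     (\<forall>c\<in>vcarrier C. tensor_lift C C C (\<lambda>x y. smult C (counit C x) y) (comul C c) = twist C c) \<and>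
     (\<forall>c\<in>vcarrier C. tensor_lift C C C (\<lambda>x y. smult C (counit C y) x) (comul C c) = twist C c) \<and>
     (\<forall>c\<in>vcarrier C.
        tensor_assoc C C C (tensor_map C C (tensor C C) C (comul C) (twist C) (comul C c)) =
        tensor_map C C C (tensor C C) (twist C) (comul C) (comul C c))"

text \<open>The product \<open>(a \<otimes> b)(c \<otimes> d) = ac \<otimes> bd\<close> of \<open>A \<otimes> A\<close>.\<close>

definition tensor_mul ::
  "('k::field, 'a::ab_group_add, 'm) hom_struct_scheme \<Rightarrow>
   ('k, 'a, 'a) tens \<Rightarrow> ('k, 'a, 'a) tens \<Rightarrow> ('k, 'a, 'a) tens" where
  "tensor_mul A t u =
     tensor_lift A A (tensor A A) (\<lambda>a b.
       tensor_lift A A (tensor A A) (\<lambda>c d. pure_tensor A A (mul A a c) (mul A b d)) u) t"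

definition hom_bialgebra :: "('k::field, 'a::ab_group_add, 'm) hom_struct_scheme \<Rightarrow> bool" where
  "hom_bialgebra H \<longleftrightarrow>
     hom_algebra H \<and> hom_coalgebra H \<and>
     comul H (unt H) = pure_tensor H H (unt H) (unt H) \<and>
     (\<forall>a\<in>vcarrier H. \<forall>b\<in>vcarrier H.
        comul H (mul H a b) = tensor_mul H (comul H a) (comul H b)) \<and>
     counit H (unt H) = 1 \<and>
     (\<forall>a\<in>vcarrier H. \<forall>b\<in>vcarrier H. counit H (mul H a b) = counit H a * counit H b)"

definition hom_hopf_algebra ::
  "('k::field, 'a::ab_group_add, 'm) hom_struct_scheme \<Rightarrow> ('a \<Rightarrow> 'a) \<Rightarrow> bool" where
  "hom_hopf_algebra H S \<longleftrightarrow>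
     hom_bialgebra H \<and> linear_map H H S \<and>
     (\<forall>h\<in>vcarrier H. S (twist H h) = twist H (S h)) \<and>
     (\<forall>h\<in>vcarrier H.
        tensor_lift H H H (\<lambda>h1 h2. mul H (S h1) h2) (comul H h) = smult H (counit H h) (unt H) \<and>
        tensor_lift H H H (\<lambda>h1 h2. mul H h1 (S h2)) (comul H h) = smult H (counit H h) (unt H))"

text \<open>The inverse twist; only used when \<open>\<alpha>\<close> is a bijection of the carrier.\<close>

definition inv_twist :: "('k, 'a, 'm) hom_struct_scheme \<Rightarrow> 'a \<Rightarrow> 'a" where
  "inv_twist H = inv_into (vcarrier H) (twist H)"


section \<open>The dual Hom-Hopf algebra\<close>

definition dual_hom ::
  "('k::field, 'a::ab_group_add, 'm) hom_struct_scheme \<Rightarrow> ('k, 'a \<Rightarrow> 'k) hom_struct" where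
  "dual_hom H =
     \<lparr>vcarrier = vcarrier (dual_space H), smult = smult (dual_space H),
      mul = (\<lambda>f g. restr H (\<lambda>h. tensor_lift H H ground
        (\<lambda>h1 h2. f ((inv_twist H ^^ 2) h1) * g ((inv_twist H ^^ 2) h2)) (comul H h))),
      unt = restr H (counit H),
      comul = (\<lambda>f. THE t. t \<in> vcarrier (tensor (dual_space H) (dual_space H)) \<and>
        (\<forall>h\<in>vcarrier H. \<forall>k\<in>vcarrier H.
           tensor_lift (dual_space H) (dual_space H) ground (\<lambda>f1 f2. f1 h * f2 k) t =
           f ((inv_twist H ^^ 2) (mul H h k)))),
      counit = (\<lambda>f. f (unt H)),
      twist = (\<lambda>f. restr H (\<lambda>h. f (inv_twist H h)))\<rparr>"

definition alpha_star :: "('k::zero, 'a, 'm) hom_struct_scheme \<Rightarrow> ('a \<Rightarrow> 'k) \<Rightarrow> 'a \<Rightarrow> 'k" where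
  "alpha_star H f = restr H (\<lambda>h. f (twist H h))"

text \<open>\<open>act_right H f h\<close> is \<open>f \<leftharpoonup> h\<close> and \<open>act_left H h f\<close> is \<open>h \<rightharpoonup> f\<close>.\<close>

definition act_right :: "('k::zero, 'a, 'm) hom_struct_scheme \<Rightarrow> ('a \<Rightarrow> 'k) \<Rightarrow> 'a \<Rightarrow> 'a \<Rightarrow> 'k" where
  "act_right H f h = restr H (\<lambda>k. f (mul H h ((inv_twist H ^^ 2) k)))"

definition act_left :: "('k::zero, 'a, 'm) hom_struct_scheme \<Rightarrow> 'a \<Rightarrow> ('a \<Rightarrow> 'k) \<Rightarrow> 'a \<Rightarrow> 'k" where
  "act_left H h f = restr H (\<lambda>k. f (mul H ((inv_twist H ^^ 2) k) h))"


section \<open>The Drinfel'd double\<close>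

type_synonym ('k, 'a) double = "('k, 'a, 'a \<Rightarrow> 'k) tens"

text \<open>The product \<open>(h \<otimes> f)(k \<otimes> g)\<close> of pure tensors.\<close>

definition double_mul_pure ::
  "('k::field, 'a::ab_group_add, 'm) hom_struct_scheme \<Rightarrow> ('a \<Rightarrow> 'a) \<Rightarrow>
   'a \<Rightarrow> ('a \<Rightarrow> 'k) \<Rightarrow> 'a \<Rightarrow> ('a \<Rightarrow> 'k) \<Rightarrow> ('k, 'a) double" where
  "double_mul_pure H S h f k g =
     tensor_lift H H (tensor H (dual_hom H)) (\<lambda>k1 k2.
       tensor_lift H H (tensor H (dual_hom H)) (\<lambda>k21 k22.
         pure_tensor H (dual_hom H)
           (mul H ((inv_twist H ^^ 2) k21) h)
           (mul (dual_hom H)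
             (act_left H ((inv_twist H ^^ 3) k22)
               (act_right H ((alpha_star H ^^ 2) f) (S ((inv_twist H ^^ 3) k1))))
             g))
         (comul H k2))
       (comul H k)"

text \<open>The coproduct \<open>h\<^sub>1 \<otimes> f\<^sub>1 \<otimes> h\<^sub>2 \<otimes> f\<^sub>2\<close> of \<open>h \<otimes> f\<close>.\<close>

definition double_comul_pure ::
  "('k::field, 'a::ab_group_add, 'm) hom_struct_scheme \<Rightarrow>
   'a \<Rightarrow> ('a \<Rightarrow> 'k) \<Rightarrow> ('k, ('k, 'a) double, ('k, 'a) double) tens" where
  "double_comul_pure H h f =
     (let D = tensor H (dual_hom H) in
      tensor_lift H H (tensor D D) (\<lambda>h1 h2.
        tensor_lift (dual_hom H) (dual_hom H) (tensor D D) (\<lambda>f1 f2.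
          pure_tensor D D (pure_tensor H (dual_hom H) h1 f1) (pure_tensor H (dual_hom H) h2 f2))
          (comul (dual_hom H) f))
        (comul H h))"

definition drinfeld_double ::
  "('k::field, 'a::ab_group_add, 'm) hom_struct_scheme \<Rightarrow> ('a \<Rightarrow> 'a) \<Rightarrow>
   ('k, ('k, 'a) double) hom_struct" where
  "drinfeld_double H S =
     (let H' = dual_hom H; D = tensor H H' in
      \<lparr>vcarrier = vcarrier D, smult = smult D,
       mul = (\<lambda>t u. tensor_lift H H' D (\<lambda>h f.
                tensor_lift H H' D (\<lambda>k g. double_mul_pure H S h f k g) u) t),
       unt = pure_tensor H H' (unt H) (unt H'),
       comul = tensor_lift H H' (tensor D D) (double_comul_pure H),
       counit = tensor_lift H H' ground (\<lambda>h f. counit H h * f (unt H)),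
       twist = tensor_map H H' H H' (twist H) (twist H')\<rparr>)"

end

theory Submission
  imports Defs
begin

text \<open>Since \<open>\<alpha>\<close> is bijective, \<open>H\<close> is the twist by \<open>\<alpha>\<close> of the ordinary Hopf algebra with product
  \<open>\<alpha>\<inverse>(hk)\<close> and coproduct \<open>\<Delta>(\<alpha>\<inverse>(h))\<close>, and the double of \<open>H\<close> is the twist by \<open>\<alpha> \<otimes> (\<alpha>\<inverse>)\<^sup>*\<close> of an ordinary
  Drinfel'd double in which \<open>H\<close> acts on \<open>H\<^sup>*\<close> through \<open>\<alpha>\<close>: the product of \<open>h \<otimes> f\<close> and \<open>k \<otimes> g\<close> is
  \<open>k\<^sub>2h \<otimes> f(S(\<alpha>k\<^sub>1) _ \<alpha>k\<^sub>3)g\<close>.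
  The axioms for this product hold because \<open>\<alpha>\<close> is a Hopf endomorphism. The antipode needs \<open>S\<inverse>\<close> on
  \<open>H\<^sup>o\<^sup>p\<close>. To see that \<open>S\<close> is bijective, take an even \<open>N\<close> with \<open>S\<^sup>N\<close> injective on its image (Fitting)
  and let \<open>E\<close> be the projection onto that image with \<open>S\<^sup>N E = S\<^sup>N\<close>. As \<open>S\<^sup>n\<close> and \<open>S\<^sup>n\<^sup>+\<^sup>1\<close> are mutually
  inverse for a convolution product, \<open>S\<^sup>n\<^sup>+\<^sup>1 = S\<^sup>n\<^sup>+\<^sup>1 E\<close> implies \<open>S\<^sup>n = S\<^sup>n E\<close>, so descent from \<open>N\<close> gives
  \<open>E = id\<close>.

  Tensors are functionals on bilinear forms, so every identity is tested on scalar-valued forms and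
  Sweedler sums become the scalar operator \<open>sw\<close>; with coefficients in a fixed frame it is linear
  by construction, and coassociativity holds for arbitrary, not necessarily multilinear, integrands.\<close>

section \<open>Linear algebra on carriers\<close>

text \<open>The exponents in the displayed formula are tuned: once the product of \<open>H\<close>
  is written as \<open>al (a \<cdot> b)\<close> and its coproduct through the untwisted one, the
  powers of \<alpha> cancel except for a single \<open>al\<close> on the two legs that act on the
  dual. This leftover is harmless: the pairing of \<open>h\<close> with \<open>f\<close> given by
  \<open>f (al h)\<close> is again compatible with products, coproducts, units and antipodes, which
  is what a double needs of its pairing. Bijectivity of \<open>S\<close> is the substantial input,
  since it is not assumed. \<open>S\<close> reverses products and coproducts, so it is the even
  powers that respect both; and the Fitting projection \<open>E\<close> is not known to respect
  either, so the descent leans on injectivity on the image of an even power. Finite dimension enters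
  three times: for the frame that turns coproducts into coefficients, for the tensor over the dual
  that represents \<open>f\<close> composed with the product, and for Fitting.
  \<open>tensor_lift\<close> is picked by choice and says something only about bilinear integrands,
  so multilinearity is settled before each passage from tensors to Sweedler sums.\<close>

abbreviation functional :: "('k::field, 'a::ab_group_add, 'm) vspace_scheme \<Rightarrow> ('a \<Rightarrow> 'k) \<Rightarrow> bool" where
  "functional V \<equiv> linear_map V ground"

abbreviation bilinear_form where
  "bilinear_form V W \<equiv> bilinear_map V W ground"

lemma ground_simps [simp]: "vcarrier ground = UNIV" "smult ground = (*)"
  by (simp_all add: ground_def)

context
  fixes V :: "('k::field, 'a::ab_group_add, 'm) vspace_scheme"
  assumes V: "is_vspace V"
begin

interpretation vector_space "smult V" using V by (simp add: is_vspace_def)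

lemma vspace_vector_space: "vector_space (smult V)"
  by unfold_locales

lemma vspace_subspace: "module.subspace (smult V) (vcarrier V)"
  using V by (simp add: is_vspace_def)

lemma vspace_zero: "0 \<in> vcarrier V"
  and vspace_add: "x \<in> vcarrier V \<Longrightarrow> y \<in> vcarrier V \<Longrightarrow> x + y \<in> vcarrier V"
  and vspace_smult: "x \<in> vcarrier V \<Longrightarrow> smult V c x \<in> vcarrier V"
  and vspace_diff: "x \<in> vcarrier V \<Longrightarrow> y \<in> vcarrier V \<Longrightarrow> x - y \<in> vcarrier V"
  and vspace_sum: "(\<And>i. i \<in> A \<Longrightarrow> f i \<in> vcarrier V) \<Longrightarrow> sum f A \<in> vcarrier V"
  using subspace_0 subspace_add subspace_scale subspace_diff subspace_sum vspace_subspace by blast+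

end

lemma linear_map_mem: "linear_map V W f \<Longrightarrow> x \<in> vcarrier V \<Longrightarrow> f x \<in> vcarrier W"
  and linear_map_add: "linear_map V W f \<Longrightarrow> x \<in> vcarrier V \<Longrightarrow> y \<in> vcarrier V \<Longrightarrow> f (x + y) = f x + f y"
  and linear_map_smult: "linear_map V W f \<Longrightarrow> x \<in> vcarrier V \<Longrightarrow> f (smult V c x) = smult W c (f x)"
  by (auto simp: linear_map_def)

lemma linear_map_zero:
  fixes V :: "('k::field, 'a::ab_group_add, 'm) vspace_scheme"
    and W :: "('k, 'b::ab_group_add, 'n) vspace_scheme"
  assumes "is_vspace V" "is_vspace W" "linear_map V W f"
  shows "f 0 = 0"
proof -
  interpret v: vector_space "smult V" using assms by (simp add: is_vspace_def)
  interpret w: vector_space "smult W" using assms by (simp add: is_vspace_def)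
  show ?thesis using linear_map_smult[OF assms(3) vspace_zero[OF assms(1)], of 0] by simp
qed

lemma linear_map_sum:
  fixes V :: "('k::field, 'a::ab_group_add, 'm) vspace_scheme"
    and W :: "('k, 'b::ab_group_add, 'n) vspace_scheme"
  assumes "is_vspace V" "is_vspace W" "linear_map V W f" "\<And>i. i \<in> A \<Longrightarrow> g i \<in> vcarrier V"
  shows "f (\<Sum>i\<in>A. g i) = (\<Sum>i\<in>A. f (g i))"
  using assms(4)
proof (induction A rule: infinite_finite_induct)
  case (insert x F)
  then show ?case
    by (simp add: linear_map_add[OF assms(3)] vspace_sum[OF assms(1)])
qed (use linear_map_zero[OF assms(1-3)] in auto)

lemma linear_map_sum_smult:
  fixes V :: "('k::field, 'a::ab_group_add, 'm) vspace_scheme"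
    and W :: "('k, 'b::ab_group_add, 'n) vspace_scheme"
  assumes "is_vspace V" "is_vspace W" "linear_map V W f" "\<And>i. i \<in> A \<Longrightarrow> g i \<in> vcarrier V"
  shows "f (\<Sum>i\<in>A. smult V (c i) (g i)) = (\<Sum>i\<in>A. smult W (c i) (f (g i)))"
  using assms by (subst linear_map_sum[OF assms(1-3)]) (auto simp: vspace_smult linear_map_smult)

lemma linear_map_id: "linear_map V V (\<lambda>x. x)"
  by (simp add: linear_map_def)

lemma linear_map_comp:
  "linear_map V W f \<Longrightarrow> linear_map W U g \<Longrightarrow> linear_map V U (\<lambda>x. g (f x))"
  by (auto simp: linear_map_def)

lemma linear_map_cong:
  "(\<And>x. x \<in> vcarrier V \<Longrightarrow> f x = g x) \<Longrightarrow> is_vspace V \<Longrightarrow> linear_map V W f = linear_map V W g"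
  unfolding linear_map_def by (auto simp: vspace_add vspace_smult)

lemma bilinear_left: "bilinear_map V W U b \<Longrightarrow> linear_map X V f \<Longrightarrow> w \<in> vcarrier W \<Longrightarrow> linear_map X U (\<lambda>x. b (f x) w)"
  and bilinear_right: "bilinear_map V W U b \<Longrightarrow> linear_map X W g \<Longrightarrow> v \<in> vcarrier V \<Longrightarrow> linear_map X U (\<lambda>x. b v (g x))"
  and bilinear_mem: "bilinear_map V W U b \<Longrightarrow> v \<in> vcarrier V \<Longrightarrow> w \<in> vcarrier W \<Longrightarrow> b v w \<in> vcarrier U"
  by (auto simp: bilinear_map_def linear_map_def)

lemma bilinear_mapI:
  "(\<And>v. v \<in> vcarrier V \<Longrightarrow> linear_map W U (\<lambda>w. b v w)) \<Longrightarrow>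
   (\<And>w. w \<in> vcarrier W \<Longrightarrow> linear_map V U (\<lambda>v. b v w)) \<Longrightarrow> bilinear_map V W U b"
  by (simp add: bilinear_map_def)

lemma bilinear_map_comp:
  "bilinear_map V W U b \<Longrightarrow> linear_map U X \<theta> \<Longrightarrow> bilinear_map V W X (\<lambda>v w. \<theta> (b v w))"
  by (auto simp: bilinear_map_def linear_map_def)

lemma functional_mult:
  "functional V f \<Longrightarrow> functional V (\<lambda>x. c * f x)"
  "functional V f \<Longrightarrow> functional V (\<lambda>x. f x * c)"
  by (simp_all add: linear_map_def algebra_simps)

lemma functional_sum:
  "(\<And>i. i \<in> A \<Longrightarrow> functional V (f i)) \<Longrightarrow> functional V (\<lambda>x. \<Sum>i\<in>A. f i x)"
  by (auto simp: linear_map_def sum.distrib sum_distrib_left)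

lemma bilinear_form_prod:
  "functional V f \<Longrightarrow> functional W g \<Longrightarrow> bilinear_form V W (\<lambda>v w. f v * g w)"
  by (simp add: bilinear_map_def functional_mult)

section \<open>Tensors as functionals on bilinear forms\<close>

lemma smult_tensor [simp]: "smult (tensor V W) = fscale"
  by (simp add: tensor_def)

lemma linear_map_eval: "functional (tensor V W) (\<lambda>t. t \<beta>)"
  by (simp add: linear_map_def fscale_def)

lemma pure_tensor_apply: "bilinear_form V W \<beta> \<Longrightarrow> pure_tensor V W v w \<beta> = \<beta> v w"
  by (simp add: pure_tensor_def)

text \<open>A functional composed with the lift is linear on the tensor product and known on pure
  tensors, so uniqueness identifies it with evaluation at the composed form. Lifts are computed
  through this instead of through the underlying choice.\<close>

lemma tensor_lift_apply:
  assumes "is_vspace U" "bilinear_map V W U b" "functional U \<theta>" "t \<in> vcarrier (tensor V W)"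
  shows "\<theta> (tensor_lift V W U b t) = t (\<lambda>v w. \<theta> (b v w))"
proof (rule tensor_lift_unique[OF is_vspace_ground, where L = "\<lambda>t. \<theta> (tensor_lift V W U b t)"])
  show "functional (tensor V W) (\<lambda>t. \<theta> (tensor_lift V W U b t))"
    by (rule linear_map_comp[OF tensor_lift_linear[OF assms(1,2)] assms(3)])
  show "\<theta> (tensor_lift V W U b (pure_tensor V W v w)) = pure_tensor V W v w (\<lambda>v w. \<theta> (b v w))"
    if "v \<in> vcarrier V" "w \<in> vcarrier W" for v w
    using that by (simp only: tensor_lift_pure[OF assms(1,2)] pure_tensor_apply[OF bilinear_map_comp[OF assms(2,3)]])
qed (rule linear_map_eval, fact)

lemma tensor_apply_functional:
  assumes "is_vspace V" "is_vspace W" "functional (tensor V W) \<theta>" "t \<in> vcarrier (tensor V W)"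
  shows "\<theta> t = t (\<lambda>v w. \<theta> (pure_tensor V W v w))"
proof (rule tensor_lift_unique[OF is_vspace_ground assms(3) _ _ assms(4)])
  show "\<theta> (pure_tensor V W v w) = pure_tensor V W v w (\<lambda>v w. \<theta> (pure_tensor V W v w))" for v w
    by (simp only: pure_tensor_apply[OF bilinear_map_comp[OF bilinear_map_pure_tensor[OF assms(1,2)] assms(3)]])
qed (rule linear_map_eval)

lemma tensor_lift_eval:
  assumes "bilinear_map V W (tensor X Y) b" "t \<in> vcarrier (tensor V W)"
  shows "tensor_lift V W (tensor X Y) b t \<beta> = t (\<lambda>v w. b v w \<beta>)"
  using tensor_lift_apply[OF is_vspace_tensor assms(1) linear_map_eval assms(2)] .

lemma tensor_lift_ground:
  assumes "bilinear_form V W b" "t \<in> vcarrier (tensor V W)"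
  shows "tensor_lift V W ground b t = t b"
  using tensor_lift_apply[OF is_vspace_ground assms(1) linear_map_id[of ground] assms(2)] .

text \<open>A tensor is a function on all binary functions, bilinear or not. Off the bilinear forms
  the generators vanish, hence so does every element of their span, and agreement on forms is
  equality.\<close>

lemma tensor_ext:
  fixes V :: "('k::field, 'a::ab_group_add, 'm) vspace_scheme"
    and W :: "('k, 'b::ab_group_add, 'n) vspace_scheme"
  assumes t: "t \<in> vcarrier (tensor V W)" and u: "u \<in> vcarrier (tensor V W)"
    and eq: "\<And>\<beta>. bilinear_form V W \<beta> \<Longrightarrow> t \<beta> = u \<beta>"
  shows "t = u"
proof
  interpret vector_space "fscale :: 'k \<Rightarrow> ('k, 'a, 'b) tens \<Rightarrow> _" by (rule vector_space_fscale)
  fix \<beta>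
  have "s \<beta> = 0" if "\<not> bilinear_form V W \<beta>" "s \<in> vcarrier (tensor V W)" for s
  proof -
    have "s \<in> span {pure_tensor V W v w |v w. v \<in> vcarrier V \<and> w \<in> vcarrier W}"
      using that(2) by (simp add: tensor_def)
    then show ?thesis
      by (induction rule: span_induct_alt) (use that(1) in \<open>auto simp: pure_tensor_def fscale_def\<close>)
  qed
  then show "t \<beta> = u \<beta>" using t u eq by metis
qed

lemma tensor_sum_form:
  assumes "\<And>i. i \<in> A \<Longrightarrow> bilinear_form V W (\<beta> i)" "t \<in> vcarrier (tensor V W)"
  shows "t (\<lambda>v w. \<Sum>i\<in>A. \<beta> i v w) = (\<Sum>i\<in>A. t (\<beta> i))"
proof (rule tensor_lift_unique[OF is_vspace_ground _ _ _ assms(2)])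
  have "bilinear_form V W (\<lambda>v w. \<Sum>i\<in>A. \<beta> i v w)"
    using assms(1) by (auto simp: bilinear_map_def intro!: functional_sum)
  then show "pure_tensor V W v w (\<lambda>v w. \<Sum>i\<in>A. \<beta> i v w) = (\<Sum>i\<in>A. pure_tensor V W v w (\<beta> i))" for v w
    using assms(1) by (simp add: pure_tensor_apply)
  show "functional (tensor V W) (\<lambda>t. \<Sum>i\<in>A. t (\<beta> i))"
    by (intro functional_sum linear_map_eval)
qed (rule linear_map_eval)

text \<open>Forms are functions on whole types and may be rewritten only on carriers. Since
  \<open>bilinear_map\<close> inspects carrier values alone, \<open>\<beta>'\<close> is bilinear
  too, and both evaluations are linear in \<open>t\<close> and agree on pure tensors.\<close>

lemma tensor_form_cong:
  fixes V :: "('k::field, 'a::ab_group_add, 'm) vspace_scheme"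
    and W :: "('k, 'b::ab_group_add, 'n) vspace_scheme"
  assumes "is_vspace V" "is_vspace W" "bilinear_form V W \<beta>" "t \<in> vcarrier (tensor V W)"
    and eq: "\<And>v w. v \<in> vcarrier V \<Longrightarrow> w \<in> vcarrier W \<Longrightarrow> \<beta> v w = \<beta>' v w"
  shows "t \<beta> = t \<beta>'"
proof -
  have 1: "linear_map W ground (\<beta> v) = linear_map W ground (\<beta>' v)" if "v \<in> vcarrier V" for v
    by (rule linear_map_cong) (use assms that in auto)
  have 2: "linear_map V ground (\<lambda>v. \<beta> v w) = linear_map V ground (\<lambda>v. \<beta>' v w)" if "w \<in> vcarrier W" for w
    by (rule linear_map_cong) (use assms that in auto)
  have "bilinear_form V W \<beta>'" using assms(3) 1 2 by (simp add: bilinear_map_def)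
  with assms show ?thesis
    by (intro tensor_lift_unique[OF is_vspace_ground linear_map_eval linear_map_eval _ assms(4)])
       (simp add: pure_tensor_apply)
qed

text \<open>The lift for each \<open>x\<close> is an independent choice, so linearity in
  \<open>x\<close> is not automatic. It follows from uniqueness: the lift for a sum and the sum of
  the lifts agree on pure tensors.\<close>

lemma linear_map_tensor_lift_param:
  assumes U: "is_vspace U" and X: "is_vspace X"
    and b: "\<And>x. x \<in> vcarrier X \<Longrightarrow> bilinear_map V W U (b x)"
    and l: "\<And>v w. v \<in> vcarrier V \<Longrightarrow> w \<in> vcarrier W \<Longrightarrow> linear_map X U (\<lambda>x. b x v w)"
    and t: "t \<in> vcarrier (tensor V W)"
  shows "linear_map X U (\<lambda>x. tensor_lift V W U (b x) t)"
proof -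
  interpret U: vector_space "smult U" using U by (rule vspace_vector_space)
  note L = tensor_lift_linear[OF U b] and P = tensor_lift_pure[OF U b]
  have add: "linear_map (tensor V W) U (\<lambda>t. f t + g t)"
    if "linear_map (tensor V W) U f" "linear_map (tensor V W) U g" for f g
    using that by (auto simp: linear_map_def vspace_add[OF U] U.scale_right_distrib)
  have sc: "linear_map (tensor V W) U (\<lambda>t. smult U c (f t))" if "linear_map (tensor V W) U f" for f c
    using that by (auto simp: linear_map_def vspace_smult[OF U] U.scale_right_distrib)
  show ?thesis unfolding linear_map_def
  proof (intro conjI ballI allI)
    fix x y c assume x: "x \<in> vcarrier X" and y: "y \<in> vcarrier X"
    show "tensor_lift V W U (b x) t \<in> vcarrier U" using L[OF x] t by (rule linear_map_mem)
    show "tensor_lift V W U (b (x + y)) t = tensor_lift V W U (b x) t + tensor_lift V W U (b y) t"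
      by (rule tensor_lift_unique[OF U L add[OF L L] _ t])
         (use x y X in \<open>auto simp: vspace_add P linear_map_add[OF l]\<close>)
    show "tensor_lift V W U (b (smult X c x)) t = smult U c (tensor_lift V W U (b x) t)"
      by (rule tensor_lift_unique[OF U L sc[OF L] _ t])
         (use x X in \<open>auto simp: vspace_smult P linear_map_smult[OF l]\<close>)
  qed
qed

section \<open>Separating families of functionals\<close>

text \<open>A family is used instead of the whole dual: point evaluations suffice on a space of
  functionals, and products of members suffice on a tensor product.\<close>

definition separating :: "('k::field, 'a::ab_group_add, 'm) vspace_scheme \<Rightarrow> ('a \<Rightarrow> 'k) set \<Rightarrow> bool" where
  "separating V \<Phi> \<longleftrightarrow> (\<forall>\<phi>\<in>\<Phi>. functional V \<phi>) \<and>
     (\<forall>v\<in>vcarrier V. (\<forall>\<phi>\<in>\<Phi>. \<phi> v = 0) \<longrightarrow> v = 0)"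

lemma separating_eqI:
  fixes V :: "('k::field, 'a::ab_group_add, 'm) vspace_scheme"
  assumes V: "is_vspace V" and "separating V \<Phi>" "v \<in> vcarrier V" "w \<in> vcarrier V"
    and "\<And>\<phi>. \<phi> \<in> \<Phi> \<Longrightarrow> \<phi> v = \<phi> w"
  shows "v = w"
proof -
  interpret vector_space "smult V" using V by (rule vspace_vector_space)
  have "\<phi> (v - w) = 0" if "\<phi> \<in> \<Phi>" for \<phi>
  proof -
    have f: "functional V \<phi>" using assms(2) that by (simp add: separating_def)
    have "\<phi> (v - w + w) = \<phi> (v - w) + \<phi> w"
      using assms by (intro linear_map_add[OF f]) (auto simp: vspace_diff)
    then show ?thesis using assms(5)[OF that] by simp
  qed
  then have "v - w = 0" using assms(2) vspace_diff[OF V assms(3,4)] unfolding separating_def by blast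
  then show ?thesis by simp
qed

lemma separating_functionals:
  fixes V :: "('k::field, 'a::ab_group_add, 'm) vspace_scheme"
  assumes "is_vspace V"
  shows "separating V {\<phi>. functional V \<phi>}"
proof -
  interpret p: vector_space_pair "smult V" "(*) :: 'k \<Rightarrow> _"
    using vspace_vector_space[OF assms] vector_space_times by (simp add: vector_space_pair_def)
  have "\<exists>\<phi>. functional V \<phi> \<and> \<phi> v \<noteq> 0" if "v \<noteq> 0" for v
  proof -
    have "p.vs1.independent {v}" using that by simp
    from p.linear_independent_extend[OF this, of "\<lambda>_. 1"] obtain g
      where g: "Vector_Spaces.linear (smult V) (*) g" "g v = 1" by auto
    then show ?thesis
      by (intro exI[of _ g]) (auto simp: linear_map_def p.linear_add p.linear_scale)
  qed
  then show ?thesis unfolding separating_def by blast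
qed

text \<open>Even if \<open>V\<close> has infinite dimension, one tensor is a finite sum of pure
  tensors and so involves finitely many basis vectors in its first factors. Expanding over these
  shows every form to \<open>t\<close> as a finite sum of products.\<close>

lemma tensor_finite_expansion:
  fixes V :: "('k::field, 'a::ab_group_add, 'm) vspace_scheme"
    and W :: "('k, 'b::ab_group_add, 'n) vspace_scheme"
  assumes V: "is_vspace V" and t: "t \<in> vcarrier (tensor V W)"
  obtains F c where "finite F" "F \<subseteq> vcarrier V" "\<And>x. x \<in> F \<Longrightarrow> functional V (c x)"
    "\<And>\<beta>. bilinear_form V W \<beta> \<Longrightarrow> t \<beta> = t (\<lambda>v w. \<Sum>x\<in>F. c x v * \<beta> x w)"
proof -
  interpret V: vector_space "smult V" using V by (rule vspace_vector_space)
  interpret T: vector_space "fscale :: 'k \<Rightarrow> ('k, 'a, 'b) tens \<Rightarrow> _" by (rule vector_space_fscale)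
  obtain B where B: "B \<subseteq> vcarrier V" "V.independent B" "vcarrier V \<subseteq> V.span B"
    using V.maximal_independent_subset by blast
  define c where "c x v = V.representation B v x" for x v
  have cl: "functional V (c x)" for x
    using B by (auto simp: linear_map_def c_def V.representation_add V.representation_scale subset_iff)
  have bil: "bilinear_form V W (\<lambda>v w. \<Sum>x\<in>F. c x v * \<beta> x w)"
    if "F \<subseteq> B" "bilinear_form V W \<beta>" for F \<beta>
    unfolding bilinear_map_def
    using that B cl by (auto intro!: functional_sum functional_mult simp: bilinear_map_def subset_iff)
  have ts: "t \<in> T.span {pure_tensor V W v w |v w. v \<in> vcarrier V \<and> w \<in> vcarrier W}"
    using t by (simp add: tensor_def)
  \<comment> \<open>The claim is made for all finite \<open>F'\<close> above \<open>F\<close>, so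
    that the sets belonging to two summands can be replaced by their union in the induction.\<close>
  have "\<exists>F. finite F \<and> F \<subseteq> B \<and> (\<forall>F' \<beta>. finite F' \<longrightarrow> F \<subseteq> F' \<longrightarrow> F' \<subseteq> B \<longrightarrow> bilinear_form V W \<beta> \<longrightarrow>
      t \<beta> = t (\<lambda>v w. \<Sum>x\<in>F'. c x v * \<beta> x w))" (is "\<exists>F. ?P F t")
    using ts
  proof (induction rule: T.span_induct_alt)
    case base
    show ?case by (intro exI[of _ "{}"]) auto
  next
    case (step a p s)
    from step(1) obtain v w where p: "p = pure_tensor V W v w" "v \<in> vcarrier V" "w \<in> vcarrier W" by auto
    from step(2) obtain F where F: "?P F s" ..
    let ?G = "{x. c x v \<noteq> 0}"
    have G: "finite ?G" "?G \<subseteq> B"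
      using V.finite_representation V.representation_ne_zero by (auto simp: c_def)
    have "p \<beta> = p (\<lambda>v w. \<Sum>x\<in>F'. c x v * \<beta> x w)"
      if F': "finite F'" "?G \<subseteq> F'" "F' \<subseteq> B" "bilinear_form V W \<beta>" for F' \<beta>
    proof -
      have "v = (\<Sum>x\<in>?G. smult V (c x v) x)"
        using V.sum_nonzero_representation_eq[OF B(2), of v] p(2) B(3) by (auto simp: c_def)
      also have "\<dots> = (\<Sum>x\<in>F'. smult V (c x v) x)"
        by (rule sum.mono_neutral_left) (use F' in auto)
      finally have "\<beta> v w = \<beta> (\<Sum>x\<in>F'. smult V (c x v) x) w" by simp
      also have "\<dots> = (\<Sum>x\<in>F'. smult ground (c x v) (\<beta> x w))"
        using F' p B by (intro linear_map_sum_smult[OF V is_vspace_ground]) (auto simp: bilinear_map_def)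
      finally show ?thesis using F' bil[OF F'(3,4)] by (simp add: p(1) pure_tensor_apply)
    qed
    moreover have "s \<beta> = s (\<lambda>v w. \<Sum>x\<in>F'. c x v * \<beta> x w)"
      if "finite F'" "F \<subseteq> F'" "F' \<subseteq> B" "bilinear_form V W \<beta>" for F' \<beta>
      using F that by blast
    ultimately have "(fscale a p + s) \<beta> = (fscale a p + s) (\<lambda>v w. \<Sum>x\<in>F'. c x v * \<beta> x w)"
      if "finite F'" "?G \<union> F \<subseteq> F'" "F' \<subseteq> B" "bilinear_form V W \<beta>" for F' \<beta>
      using that by (simp add: fscale_def)
    moreover have "finite (?G \<union> F)" "?G \<union> F \<subseteq> B" using F G by auto
    ultimately show ?case by blast
  qed
  then obtain F where "?P F t" ..
  then show ?thesis
    using B cl by (intro that[of F c]) (blast+)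
qed

text \<open>Slicing: for \<phi> in the first family, contracting \<open>t\<close> with \<phi> gives
  a vector of \<open>W\<close> killed by the second family, hence zero, so \<open>t\<close> vanishes
  on \<phi> times any functional. A second slice frees \<phi> as well, and the finite expansion
  reduces arbitrary bilinear forms to such products.\<close>

lemma separating_tensor:
  fixes V :: "('k::field, 'a::ab_group_add, 'm) vspace_scheme"
    and W :: "('k, 'b::ab_group_add, 'n) vspace_scheme"
  assumes V: "is_vspace V" and W: "is_vspace W" and \<Phi>: "separating V \<Phi>" and \<Psi>: "separating W \<Psi>"
  shows "separating (tensor V W) {\<lambda>t. t (\<lambda>v w. \<phi> v * \<psi> w) |\<phi> \<psi>. \<phi> \<in> \<Phi> \<and> \<psi> \<in> \<Psi>}"
proof -
  interpret V: vector_space "smult V" using V by (rule vspace_vector_space)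
  interpret W: vector_space "smult W" using W by (rule vspace_vector_space)
  have "t = 0" if t: "t \<in> vcarrier (tensor V W)"
    and z: "\<And>\<phi> \<psi>. \<phi> \<in> \<Phi> \<Longrightarrow> \<psi> \<in> \<Psi> \<Longrightarrow> t (\<lambda>v w. \<phi> v * \<psi> w) = 0" for t
  proof -
    have z1: "t (\<lambda>v w. \<phi> v * \<psi> w) = 0" if \<phi>: "\<phi> \<in> \<Phi>" and \<psi>: "functional W \<psi>" for \<phi> \<psi>
    proof -
      have f: "functional V \<phi>" using \<Phi> \<phi> by (simp add: separating_def)
      then have b: "bilinear_map V W W (\<lambda>v w. smult W (\<phi> v) w)"
        by (auto simp: bilinear_map_def linear_map_def vspace_smult[OF W] W.scale_left_distrib
            W.scale_right_distrib mult.commute)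
      let ?w = "tensor_lift V W W (\<lambda>v w. smult W (\<phi> v) w) t"
      have a: "\<psi>' ?w = t (\<lambda>v w. \<phi> v * \<psi>' w)" if \<psi>': "functional W \<psi>'" for \<psi>'
      proof -
        have "\<psi>' ?w = t (\<lambda>v w. \<psi>' (smult W (\<phi> v) w))"
          by (rule tensor_lift_apply[OF W b \<psi>' t])
        also have "\<dots> = t (\<lambda>v w. \<phi> v * \<psi>' w)"
          by (rule tensor_form_cong[OF V W bilinear_map_comp[OF b \<psi>'] t])
             (simp add: linear_map_smult[OF \<psi>'])
        finally show ?thesis .
      qed
      have "?w = 0"
        using \<Psi> a z[OF \<phi>] linear_map_mem[OF tensor_lift_linear[OF W b] t] by (simp add: separating_def)
      then show ?thesis using a[OF \<psi>] linear_map_zero[OF W is_vspace_ground \<psi>] by simp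
    qed
    have z2: "t (\<lambda>v w. \<phi> v * \<psi> w) = 0" if \<phi>: "functional V \<phi>" and \<psi>: "functional W \<psi>" for \<phi> \<psi>
    proof -
      have b: "bilinear_map V W V (\<lambda>v w. smult V (\<psi> w) v)" using \<psi>
        by (auto simp: bilinear_map_def linear_map_def vspace_smult[OF V] V.scale_left_distrib
            V.scale_right_distrib mult.commute)
      let ?v = "tensor_lift V W V (\<lambda>v w. smult V (\<psi> w) v) t"
      have a: "\<phi>' ?v = t (\<lambda>v w. \<phi>' v * \<psi> w)" if \<phi>': "functional V \<phi>'" for \<phi>'
      proof -
        have "\<phi>' ?v = t (\<lambda>v w. \<phi>' (smult V (\<psi> w) v))"
          by (rule tensor_lift_apply[OF V b \<phi>' t])
        also have "\<dots> = t (\<lambda>v w. \<phi>' v * \<psi> w)"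
          by (rule tensor_form_cong[OF V W bilinear_map_comp[OF b \<phi>'] t])
             (simp add: linear_map_smult[OF \<phi>'])
        finally show ?thesis .
      qed
      have "?v = 0"
        using \<Phi> a z1[OF _ \<psi>] linear_map_mem[OF tensor_lift_linear[OF V b] t] by (simp add: separating_def)
      then show ?thesis using a[OF \<phi>] linear_map_zero[OF V is_vspace_ground \<phi>] by simp
    qed
    obtain F c where F: "finite F" "F \<subseteq> vcarrier V" "\<And>x. x \<in> F \<Longrightarrow> functional V (c x)"
      "\<And>\<beta>. bilinear_form V W \<beta> \<Longrightarrow> t \<beta> = t (\<lambda>v w. \<Sum>x\<in>F. c x v * \<beta> x w)"
      by (rule tensor_finite_expansion[OF V t]) blast
    show "t = 0"
    proof (rule tensor_ext[OF t vspace_zero[OF is_vspace_tensor]])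
      fix \<beta> assume \<beta>: "bilinear_form V W \<beta>"
      have fb: "functional W (\<beta> x)" if "x \<in> F" for x
        using \<beta> that F by (auto simp: bilinear_map_def)
      have "t \<beta> = (\<Sum>x\<in>F. t (\<lambda>v w. c x v * \<beta> x w))"
        by (subst F(4)[OF \<beta>]) (rule tensor_sum_form[OF _ t], intro bilinear_form_prod fb F(3))
      also have "\<dots> = 0" by (rule sum.neutral) (simp add: z2 F fb)
      finally show "t \<beta> = 0 \<beta>" by simp
    qed
  qed
  note vanish = this
  show ?thesis unfolding separating_def
  proof (intro conjI ballI impI)
    fix \<theta> :: "('k, 'a, 'b) tens \<Rightarrow> 'k" assume "\<theta> \<in> {\<lambda>t. t (\<lambda>v w. \<phi> v * \<psi> w) |\<phi> \<psi>. \<phi> \<in> \<Phi> \<and> \<psi> \<in> \<Psi>}"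
    then obtain \<phi> \<psi> where \<theta>: "\<theta> = (\<lambda>t. t (\<lambda>v w. \<phi> v * \<psi> w))" by auto
    show "functional (tensor V W) \<theta>" unfolding \<theta> by (rule linear_map_eval)
  next
    fix t :: "('k, 'a, 'b) tens" assume t: "t \<in> vcarrier (tensor V W)"
      and z: "\<forall>\<theta>\<in>{\<lambda>t. t (\<lambda>v w. \<phi> v * \<psi> w) |\<phi> \<psi>. \<phi> \<in> \<Phi> \<and> \<psi> \<in> \<Psi>}. \<theta> t = 0"
    show "t = 0"
    proof (rule vanish[OF t])
      fix \<phi> \<psi> assume "\<phi> \<in> \<Phi>" "\<psi> \<in> \<Psi>"
      then show "t (\<lambda>v w. \<phi> v * \<psi> w) = 0"
        by (intro bspec[OF z, of "\<lambda>t. t (\<lambda>v w. \<phi> v * \<psi> w)"] CollectI exI[of _ \<phi>] exI[of _ \<psi>] conjI refl)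
    qed
  qed
qed

section \<open>Frames of finite-dimensional spaces\<close>

lemma finite_dim_frame:
  fixes V :: "('k::field, 'a::ab_group_add, 'm) vspace_scheme"
  assumes V: "is_vspace V" and "finite_dim V"
  obtains B c where "finite B" "B \<subseteq> vcarrier V" "\<And>x. functional V (c x)"
    "\<And>v. v \<in> vcarrier V \<Longrightarrow> v = (\<Sum>x\<in>B. smult V (c x v) x)"
proof -
  interpret V: vector_space "smult V" using V by (rule vspace_vector_space)
  obtain A where A: "finite A" "V.span A = vcarrier V" using assms(2) by (auto simp: finite_dim_def)
  obtain B where B: "B \<subseteq> A" "V.independent B" "A \<subseteq> V.span B"
    using V.maximal_independent_subset by blast
  have sp: "V.span B = vcarrier V"
    using A B by (metis V.span_mono V.span_minimal V.subspace_span subset_antisym)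
  have fB: "finite B" using A B finite_subset by blast
  show ?thesis
  proof (rule that[of B "\<lambda>x v. V.representation B v x"])
    show "B \<subseteq> vcarrier V" using V.span_superset sp by blast
    show "functional V (\<lambda>v. V.representation B v x)" for x
      using B sp by (auto simp: linear_map_def V.representation_add V.representation_scale)
    show "v = (\<Sum>x\<in>B. smult V (V.representation B v x) x)" if "v \<in> vcarrier V" for v
      using V.sum_representation_eq[OF B(2) _ fB order.refl, of v] that sp by simp
  qed (fact fB)
qed

section \<open>Maps between tensor products\<close>

lemma tensor_mult_form:
  assumes "bilinear_form V W \<beta>" "t \<in> vcarrier (tensor V W)"
  shows "t (\<lambda>v w. \<beta> v w * c) = t \<beta> * c"
proof (rule tensor_lift_unique[OF is_vspace_ground linear_map_eval functional_mult(2)[OF linear_map_eval] _ assms(2)])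
  have "bilinear_form V W (\<lambda>v w. \<beta> v w * c)"
    using assms(1) by (simp add: bilinear_map_def functional_mult)
  then show "pure_tensor V W v w (\<lambda>v w. \<beta> v w * c) = pure_tensor V W v w \<beta> * c" for v w
    using assms(1) by (simp add: pure_tensor_apply)
qed

lemma bilinear_pure_comp:
  assumes "is_vspace V'" "is_vspace W'" "linear_map V V' f" "linear_map W W' g"
  shows "bilinear_map V W (tensor V' W') (\<lambda>v w. pure_tensor V' W' (f v) (g w))"
  by (rule bilinear_mapI)
     (use assms in \<open>auto intro: bilinear_left bilinear_right bilinear_map_pure_tensor dest: linear_map_mem\<close>)

lemma tensor_map_linear:
  assumes "is_vspace V'" "is_vspace W'" "linear_map V V' f" "linear_map W W' g"
  shows "linear_map (tensor V W) (tensor V' W') (tensor_map V W V' W' f g)"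
  unfolding tensor_map_def by (rule tensor_lift_linear[OF is_vspace_tensor bilinear_pure_comp[OF assms]])

lemma tensor_map_pure:
  assumes "is_vspace V'" "is_vspace W'" "linear_map V V' f" "linear_map W W' g" "v \<in> vcarrier V" "w \<in> vcarrier W"
  shows "tensor_map V W V' W' f g (pure_tensor V W v w) = pure_tensor V' W' (f v) (g w)"
  unfolding tensor_map_def by (rule tensor_lift_pure[OF is_vspace_tensor bilinear_pure_comp[OF assms(1-4)] assms(5,6)])

lemma tensor_map_eval:
  assumes "is_vspace V'" "is_vspace W'" "linear_map V V' f" "linear_map W W' g"
    "t \<in> vcarrier (tensor V W)" "bilinear_form V' W' \<beta>"
  shows "tensor_map V W V' W' f g t \<beta> = t (\<lambda>v w. \<beta> (f v) (g w))"
  unfolding tensor_map_def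
  by (subst tensor_lift_eval[OF bilinear_pure_comp[OF assms(1-4)] assms(5)]) (simp add: pure_tensor_apply assms(6))

context
  fixes V :: "('k::field, 'a::ab_group_add, 'm) vspace_scheme"
    and W :: "('k, 'b::ab_group_add, 'n) vspace_scheme"
    and X :: "('k, 'c::ab_group_add, 'p) vspace_scheme"
  assumes V: "is_vspace V" and W: "is_vspace W" and X: "is_vspace X"
begin

lemma assoc_inner_bilinear:
  assumes "x \<in> vcarrier X"
  shows "bilinear_map V W (tensor V (tensor W X)) (\<lambda>v w. pure_tensor V (tensor W X) v (pure_tensor W X w x))"
  by (rule bilinear_pure_comp[OF V is_vspace_tensor linear_map_id])
     (rule bilinear_left[OF bilinear_map_pure_tensor[OF W X] linear_map_id assms])

lemma assoc_outer_bilinear: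
  "bilinear_map (tensor V W) X (tensor V (tensor W X))
     (\<lambda>t x. tensor_lift V W (tensor V (tensor W X))
        (\<lambda>v w. pure_tensor V (tensor W X) v (pure_tensor W X w x)) t)"
proof (rule bilinear_mapI)
  show "linear_map X (tensor V (tensor W X)) (\<lambda>x. tensor_lift V W (tensor V (tensor W X))
        (\<lambda>v w. pure_tensor V (tensor W X) v (pure_tensor W X w x)) t)" if "t \<in> vcarrier (tensor V W)" for t
    by (rule linear_map_tensor_lift_param[OF is_vspace_tensor X assoc_inner_bilinear _ that])
       (auto intro!: bilinear_right[OF bilinear_map_pure_tensor[OF V is_vspace_tensor]]
         bilinear_right[OF bilinear_map_pure_tensor[OF W X] linear_map_id])
qed (rule tensor_lift_linear[OF is_vspace_tensor assoc_inner_bilinear])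

lemma tensor_assoc_mem:
  "t \<in> vcarrier (tensor (tensor V W) X) \<Longrightarrow> tensor_assoc V W X t \<in> vcarrier (tensor V (tensor W X))"
  unfolding tensor_assoc_def by (rule linear_map_mem[OF tensor_lift_linear[OF is_vspace_tensor assoc_outer_bilinear]])

text \<open>Product forms are enough, because products of functionals separate the triple tensor
  product, and on them both nested lifts factor.\<close>

lemma tensor_assoc_eval:
  assumes t: "t \<in> vcarrier (tensor (tensor V W) X)"
    and f: "functional V \<phi>" "functional W \<psi>" "functional X \<chi>"
  shows "tensor_assoc V W X t (\<lambda>v s. \<phi> v * s (\<lambda>w x. \<psi> w * \<chi> x)) =
    t (\<lambda>s x. s (\<lambda>v w. \<phi> v * \<psi> w) * \<chi> x)"
proof -
  let ?\<beta> = "\<lambda>v s. \<phi> v * s (\<lambda>w x. \<psi> w * \<chi> x)"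
  have \<beta>: "bilinear_form V (tensor W X) ?\<beta>"
    by (rule bilinear_form_prod[OF f(1) linear_map_eval])
  have "tensor_assoc V W X t ?\<beta> = t (\<lambda>s x. tensor_lift V W (tensor V (tensor W X))
        (\<lambda>v w. pure_tensor V (tensor W X) v (pure_tensor W X w x)) s ?\<beta>)"
    unfolding tensor_assoc_def by (rule tensor_lift_eval[OF assoc_outer_bilinear t])
  also have "\<dots> = t (\<lambda>s x. s (\<lambda>v w. \<phi> v * \<psi> w) * \<chi> x)"
  proof (rule tensor_form_cong[OF is_vspace_tensor X _ t])
    show "bilinear_form (tensor V W) X (\<lambda>s x. tensor_lift V W (tensor V (tensor W X))
        (\<lambda>v w. pure_tensor V (tensor W X) v (pure_tensor W X w x)) s ?\<beta>)"
      by (rule bilinear_map_comp[OF assoc_outer_bilinear linear_map_eval])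
    fix s x assume s: "s \<in> vcarrier (tensor V W)" and x: "x \<in> vcarrier X"
    have "tensor_lift V W (tensor V (tensor W X))
        (\<lambda>v w. pure_tensor V (tensor W X) v (pure_tensor W X w x)) s ?\<beta> =
      s (\<lambda>v w. pure_tensor V (tensor W X) v (pure_tensor W X w x) ?\<beta>)"
      by (rule tensor_lift_eval[OF assoc_inner_bilinear[OF x] s])
    also have "\<dots> = s (\<lambda>v w. \<phi> v * \<psi> w * \<chi> x)"
      by (simp only: pure_tensor_apply[OF \<beta>] pure_tensor_apply[OF bilinear_form_prod[OF f(2,3)]] mult.assoc)
    also have "\<dots> = s (\<lambda>v w. \<phi> v * \<psi> w) * \<chi> x"
      by (rule tensor_mult_form[OF bilinear_form_prod[OF f(1,2)] s])
    finally show "tensor_lift V W (tensor V (tensor W X))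
        (\<lambda>v w. pure_tensor V (tensor W X) v (pure_tensor W X w x)) s ?\<beta> = s (\<lambda>v w. \<phi> v * \<psi> w) * \<chi> x" .
  qed
  finally show ?thesis .
qed

end

text \<open>Removes \<open>tensor_assoc\<close> and \<open>tensor_map\<close> from both sides of
  Hom-coassociativity. It serves in both directions: to extract the axiom from \<open>H\<close> and
  to prove it for the double.\<close>

lemma hom_coassoc_eval:
  assumes C: "is_vspace C" and \<Delta>: "linear_map C (tensor C C) \<Delta>" and \<alpha>: "linear_map C C \<alpha>"
    and t: "t \<in> vcarrier (tensor C C)"
    and f: "functional C \<phi>" "functional C \<psi>" "functional C \<chi>"
  shows "tensor_assoc C C C (tensor_map C C (tensor C C) C \<Delta> \<alpha> t) (\<lambda>v s. \<phi> v * s (\<lambda>w x. \<psi> w * \<chi> x)) =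
      t (\<lambda>p q. \<Delta> p (\<lambda>x y. \<phi> x * \<psi> y) * \<chi> (\<alpha> q))"
    and "tensor_map C C C (tensor C C) \<alpha> \<Delta> t (\<lambda>v s. \<phi> v * s (\<lambda>w x. \<psi> w * \<chi> x)) =
      t (\<lambda>p q. \<phi> (\<alpha> p) * \<Delta> q (\<lambda>x y. \<psi> x * \<chi> y))"
proof -
  have m: "tensor_map C C (tensor C C) C \<Delta> \<alpha> t \<in> vcarrier (tensor (tensor C C) C)"
    by (rule linear_map_mem[OF tensor_map_linear[OF is_vspace_tensor C \<Delta> \<alpha>] t])
  show "tensor_assoc C C C (tensor_map C C (tensor C C) C \<Delta> \<alpha> t) (\<lambda>v s. \<phi> v * s (\<lambda>w x. \<psi> w * \<chi> x)) =
      t (\<lambda>p q. \<Delta> p (\<lambda>x y. \<phi> x * \<psi> y) * \<chi> (\<alpha> q))"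
    by (simp only: tensor_assoc_eval[OF C C C m f]
        tensor_map_eval[OF is_vspace_tensor C \<Delta> \<alpha> t bilinear_form_prod[OF linear_map_eval f(3)]])
  show "tensor_map C C C (tensor C C) \<alpha> \<Delta> t (\<lambda>v s. \<phi> v * s (\<lambda>w x. \<psi> w * \<chi> x)) =
      t (\<lambda>p q. \<phi> (\<alpha> p) * \<Delta> q (\<lambda>x y. \<psi> x * \<chi> y))"
    by (rule tensor_map_eval[OF C is_vspace_tensor \<alpha> \<Delta> t bilinear_form_prod[OF f(1) linear_map_eval]])
qed

lemma tensor_mul_bilinear:
  assumes A: "is_vspace A" and m: "bilinear_map A A A (mul A)"
  shows "a \<in> vcarrier A \<Longrightarrow> b \<in> vcarrier A \<Longrightarrow>
      bilinear_map A A (tensor A A) (\<lambda>c d. pure_tensor A A (mul A a c) (mul A b d))"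
    and "u \<in> vcarrier (tensor A A) \<Longrightarrow> bilinear_map A A (tensor A A) (\<lambda>a b.
       tensor_lift A A (tensor A A) (\<lambda>c d. pure_tensor A A (mul A a c) (mul A b d)) u)"
proof -
  show 1: "bilinear_map A A (tensor A A) (\<lambda>c d. pure_tensor A A (mul A a c) (mul A b d))"
    if "a \<in> vcarrier A" "b \<in> vcarrier A" for a b
    by (rule bilinear_pure_comp[OF A A]) (use that bilinear_right[OF m linear_map_id] in auto)
  note b = bilinear_map_pure_tensor[OF A A]
  show "bilinear_map A A (tensor A A) (\<lambda>a b.
       tensor_lift A A (tensor A A) (\<lambda>c d. pure_tensor A A (mul A a c) (mul A b d)) u)"
    if u: "u \<in> vcarrier (tensor A A)"
    by (intro bilinear_mapI linear_map_tensor_lift_param[OF is_vspace_tensor A _ _ u] 1)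
       (auto intro!: bilinear_right[OF b] bilinear_left[OF b] bilinear_left[OF m linear_map_id] bilinear_mem[OF m])
qed

lemma tensor_mul_mem:
  assumes "is_vspace A" "bilinear_map A A A (mul A)" "t \<in> vcarrier (tensor A A)" "u \<in> vcarrier (tensor A A)"
  shows "tensor_mul A t u \<in> vcarrier (tensor A A)"
  unfolding tensor_mul_def
  by (rule linear_map_mem[OF tensor_lift_linear[OF is_vspace_tensor tensor_mul_bilinear(2)] assms(3)]) fact+

lemma tensor_mul_eval:
  assumes A: "is_vspace A" and m: "bilinear_map A A A (mul A)"
    and t: "t \<in> vcarrier (tensor A A)" and u: "u \<in> vcarrier (tensor A A)" and \<beta>: "bilinear_form A A \<beta>"
  shows "tensor_mul A t u \<beta> = t (\<lambda>a b. u (\<lambda>c d. \<beta> (mul A a c) (mul A b d)))"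
proof -
  note bil = tensor_mul_bilinear[OF A m]
  have "tensor_mul A t u \<beta> = t (\<lambda>a b. tensor_lift A A (tensor A A) (\<lambda>c d. pure_tensor A A (mul A a c) (mul A b d)) u \<beta>)"
    unfolding tensor_mul_def by (rule tensor_lift_eval[OF bil(2)[OF u] t])
  also have "\<dots> = t (\<lambda>a b. u (\<lambda>c d. \<beta> (mul A a c) (mul A b d)))"
  proof (rule tensor_form_cong[OF A A bilinear_map_comp[OF bil(2)[OF u] linear_map_eval] t])
    fix a b assume "a \<in> vcarrier A" "b \<in> vcarrier A"
    then show "tensor_lift A A (tensor A A) (\<lambda>c d. pure_tensor A A (mul A a c) (mul A b d)) u \<beta> =
        u (\<lambda>c d. \<beta> (mul A a c) (mul A b d))"
      by (subst tensor_lift_eval[OF bil(1) u]) (simp_all add: pure_tensor_apply[OF \<beta>])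
  qed
  finally show ?thesis .
qed

text \<open>The general recipe for a product on a tensor product given on pure tensors. The inner
  lift depends linearly on the outer arguments by
  \<open>linear_map_tensor_lift_param\<close>.\<close>

lemma tensor_lift2_bilinear:
  assumes V: "is_vspace V" and W: "is_vspace W" and U: "is_vspace U"
    and l: "\<And>v w. v \<in> vcarrier V \<Longrightarrow> w \<in> vcarrier W \<Longrightarrow> bilinear_map V' W' U (b v w)"
    and r: "\<And>v w. v \<in> vcarrier V' \<Longrightarrow> w \<in> vcarrier W' \<Longrightarrow> bilinear_map V W U (\<lambda>v' w'. b v' w' v w)"
  shows "bilinear_map (tensor V W) (tensor V' W') U
    (\<lambda>t u. tensor_lift V W U (\<lambda>v w. tensor_lift V' W' U (b v w) u) t)" (is ?A)
    and "v \<in> vcarrier V \<Longrightarrow> w \<in> vcarrier W \<Longrightarrow> v' \<in> vcarrier V' \<Longrightarrow> w' \<in> vcarrier W' \<Longrightarrow>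
      tensor_lift V W U (\<lambda>v w. tensor_lift V' W' U (b v w) (pure_tensor V' W' v' w')) (pure_tensor V W v w)
      = b v w v' w'"
proof -
  have bil: "bilinear_map V W U (\<lambda>v w. tensor_lift V' W' U (b v w) u)" if "u \<in> vcarrier (tensor V' W')" for u
    using r by (intro bilinear_mapI linear_map_tensor_lift_param[OF U] V W l that) (auto simp: bilinear_map_def)
  show ?A
    by (intro bilinear_mapI linear_map_tensor_lift_param[OF U is_vspace_tensor bil] tensor_lift_linear[OF U bil]
        tensor_lift_linear[OF U l])
  show "tensor_lift V W U (\<lambda>v w. tensor_lift V' W' U (b v w) (pure_tensor V' W' v' w')) (pure_tensor V W v w)
      = b v w v' w'" if "v \<in> vcarrier V" "w \<in> vcarrier W" "v' \<in> vcarrier V'" "w' \<in> vcarrier W'"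
    using that by (simp add: tensor_lift_pure[OF U bil] tensor_lift_pure[OF U l] pure_tensor_mem)
qed

lemma tensor_mul_linear:
  assumes A: "is_vspace A" and m: "bilinear_map A A A (mul A)"
  shows "u \<in> vcarrier (tensor A A) \<Longrightarrow> linear_map (tensor A A) (tensor A A) (\<lambda>t. tensor_mul A t u)"
    and "t \<in> vcarrier (tensor A A) \<Longrightarrow> linear_map (tensor A A) (tensor A A) (tensor_mul A t)"
  unfolding tensor_mul_def
  by (rule tensor_lift_linear[OF is_vspace_tensor tensor_mul_bilinear(2)[OF A m]]
      linear_map_tensor_lift_param[OF is_vspace_tensor is_vspace_tensor tensor_mul_bilinear(2)[OF A m]
        tensor_lift_linear[OF is_vspace_tensor tensor_mul_bilinear(1)[OF A m]]]; assumption)+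

lemma tensor_form_linear:
  assumes X: "is_vspace X" and b: "\<And>x. x \<in> vcarrier X \<Longrightarrow> bilinear_form V W (b x)"
    and l: "\<And>v w. v \<in> vcarrier V \<Longrightarrow> w \<in> vcarrier W \<Longrightarrow> functional X (\<lambda>x. b x v w)"
    and t: "t \<in> vcarrier (tensor V W)"
  shows "functional X (\<lambda>x. t (b x))"
proof -
  have "functional X (\<lambda>x. tensor_lift V W ground (b x) t)"
    by (rule linear_map_tensor_lift_param[OF is_vspace_ground X b l t])
  then show ?thesis
    by (rule linear_map_cong[THEN iffD2, OF _ X, rotated]) (simp add: tensor_lift_ground[OF b t])
qed

lemma tensor_linear_eqI:
  assumes "is_vspace U" "linear_map (tensor V W) U L" "linear_map (tensor V W) U M"
    "t \<in> vcarrier (tensor V W)"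
    "\<And>v w. v \<in> vcarrier V \<Longrightarrow> w \<in> vcarrier W \<Longrightarrow> L (pure_tensor V W v w) = M (pure_tensor V W v w)"
  shows "L t = M t"
  by (rule tensor_lift_unique[OF assms(1-3) assms(5) assms(4)])

text \<open>The same space occurs in several records, such as \<open>dual_space H\<close> and
  \<open>dual_hom H\<close>, or the double and its underlying tensor product. These congruences
  identify the resulting notions of linearity and of tensor product, which look only at carrier and
  scalars.\<close>

lemma linear_map_vspace_cong:
  assumes "vcarrier V = vcarrier V'" "smult V = smult V'" "vcarrier W = vcarrier W'" "smult W = smult W'"
  shows "linear_map V W f = linear_map V' W' f"
  using assms by (simp add: linear_map_def)

lemma bilinear_map_vspace_cong:
  assumes "vcarrier V = vcarrier V'" "smult V = smult V'" "vcarrier W = vcarrier W'" "smult W = smult W'"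
    "vcarrier U = vcarrier U'" "smult U = smult U'"
  shows "bilinear_map V W U f = bilinear_map V' W' U' f"
  using assms by (simp add: bilinear_map_def linear_map_def)

lemma tensor_vspace_cong:
  assumes "vcarrier V = vcarrier V'" "smult V = smult V'" "vcarrier W = vcarrier W'" "smult W = smult W'"
  shows "pure_tensor V W = pure_tensor V' W'" "tensor V W = tensor V' W'"
proof -
  have "bilinear_form V W f = bilinear_form V' W' f" for f
    by (rule bilinear_map_vspace_cong[OF assms refl refl])
  then show p: "pure_tensor V W = pure_tensor V' W'"
    by (simp add: pure_tensor_def fun_eq_iff)
  show "tensor V W = tensor V' W'" unfolding tensor_def p using assms by simp
qed

lemma tensor_lift_vspace_cong:
  assumes "vcarrier V = vcarrier V'" "smult V = smult V'" "vcarrier W = vcarrier W'" "smult W = smult W'"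
    "vcarrier U = vcarrier U'" "smult U = smult U'"
  shows "tensor_lift V W U = tensor_lift V' W' U'"
proof -
  have "linear_map (tensor V W) U f = linear_map (tensor V' W') U' f" for f
    unfolding tensor_vspace_cong(2)[OF assms(1-4)] by (rule linear_map_vspace_cong[OF refl refl assms(5,6)])
  then show ?thesis
    unfolding tensor_lift_def[abs_def] by (simp only: tensor_vspace_cong(1)[OF assms(1-4)] assms)
qed

section \<open>Fitting's lemma\<close>

text \<open>The ambient space may be infinite-dimensional, so dimension is counted inside
  \<open>W\<close>: the image of a basis \<open>A\<close> is independent of the same size in
  \<open>span A\<close>, and a vector of \<open>span A\<close> outside its span would violate the
  exchange bound.\<close>

lemma (in vector_space) inj_endo_imp_surj:
  assumes W: "subspace W" "W \<subseteq> span T" "finite T"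
    and g: "Vector_Spaces.linear scale scale g" "g ` W \<subseteq> W" "inj_on g W"
  shows "g ` W = W"
proof -
  interpret g: Vector_Spaces.linear scale scale g by (rule g(1))
  obtain A where A: "A \<subseteq> W" "independent A" "W \<subseteq> span A" using maximal_independent_subset by blast
  have sp: "span A = W" using A W by (simp add: span_minimal subset_antisym)
  have fA: "finite A" using independent_span_bound[OF W(3) A(2)] A W by blast
  have ind: "independent (g ` A)" using g.independent_injective_image[OF A(2)] sp g(3) by simp
  have card: "card (g ` A) = card A" using A g(3) by (meson card_image inj_on_subset)
  have gA: "g ` A \<subseteq> span A" using A g(2) sp by blast
  have "span A \<subseteq> span (g ` A)"
  proof
    fix x assume x: "x \<in> span A"
    show "x \<in> span (g ` A)"
    proof (rule ccontr)
      assume n: "x \<notin> span (g ` A)"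
      then have "card (insert x (g ` A)) \<le> card A"
        using independent_span_bound[OF fA independent_insertI[OF n ind]] gA x by blast
      moreover have "x \<notin> g ` A" using n span_base by blast
      ultimately show False using card fA by simp
    qed
  qed
  also have "span (g ` A) = g ` W" using sp g.span_image by metis
  finally show ?thesis using sp g(2) by blast
qed

text \<open>\<open>linear_map\<close> constrains a map on the carrier alone, whereas
  \<open>Vector_Spaces.linear\<close> concerns the whole type. Extending over a basis of the carrier
  gives access to the theory of the latter.\<close>

lemma linear_map_extend:
  fixes V :: "('k::field, 'a::ab_group_add, 'm) vspace_scheme"
  assumes V: "is_vspace V" and f: "linear_map V V f"
  obtains g where "Vector_Spaces.linear (smult V) (smult V) g" "\<And>x. x \<in> vcarrier V \<Longrightarrow> g x = f x"
proof -
  interpret p: vector_space_pair "smult V" "smult V"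
    using vspace_vector_space[OF V] by (simp add: vector_space_pair_def)
  obtain B where B: "B \<subseteq> vcarrier V" "p.vs1.independent B" "vcarrier V \<subseteq> p.vs1.span B"
    using p.vs1.maximal_independent_subset by blast
  obtain g where g: "Vector_Spaces.linear (smult V) (smult V) g" "\<And>x. x \<in> B \<Longrightarrow> g x = f x"
    using p.linear_independent_extend[OF B(2), of f] by blast
  interpret g: Vector_Spaces.linear "smult V" "smult V" g by (rule g(1))
  have sub: "p.vs1.subspace {x \<in> vcarrier V. g x = f x}"
    using V by (auto simp: p.vs1.subspace_def vspace_zero vspace_add vspace_smult g.add g.scale g.zero
        linear_map_zero[OF V V f] linear_map_add[OF f] linear_map_smult[OF f])
  have "p.vs1.span B \<subseteq> {x \<in> vcarrier V. g x = f x}"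
    by (rule p.vs1.span_minimal[OF _ sub]) (use B g in auto)
  then show ?thesis using B g(1) by (intro that[of g]) auto
qed

text \<open>The kernels of the powers stabilise at some \<open>n\<close>. For \<open>N\<close>
  beyond \<open>n\<close>, the power \<open>f ^^ N\<close> is then injective on its own image, hence
  surjective onto it by finite dimension.\<close>

lemma fitting:
  fixes V :: "('k::field, 'a::ab_group_add, 'm) vspace_scheme"
  assumes V: "is_vspace V" and fd: "finite_dim V" and f: "linear_map V V f"
  obtains n where "\<And>N. n \<le> N \<Longrightarrow> inj_on (f ^^ N) ((f ^^ N) ` vcarrier V)"
    "\<And>N. n \<le> N \<Longrightarrow> (f ^^ N) ` (f ^^ N) ` vcarrier V = (f ^^ N) ` vcarrier V"
proof -
  interpret vector_space "smult V" using V by (rule vspace_vector_space)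
  obtain T where T: "finite T" "span T = vcarrier V" using fd by (auto simp: finite_dim_def)
  obtain g where g: "Vector_Spaces.linear (smult V) (smult V) g" "\<And>x. x \<in> vcarrier V \<Longrightarrow> g x = f x"
    by (rule linear_map_extend[OF V f]) blast
  have gn: "Vector_Spaces.linear (smult V) (smult V) (g ^^ n)" for n
  proof (induction n)
    case 0
    show ?case by (simp add: Vector_Spaces.linear_iff vector_space_axioms)
  next
    case (Suc n)
    show ?case using Vector_Spaces.linear_compose[OF Suc g(1)] by (simp add: o_def)
  qed
  have fg: "(f ^^ n) x = (g ^^ n) x \<and> (g ^^ n) x \<in> vcarrier V" if "x \<in> vcarrier V" for n x
    by (induction n) (use that g f in \<open>auto simp: linear_map_def\<close>)
  define K where "K n = {x \<in> vcarrier V. (g ^^ n) x = 0}" for n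
  have Ksub: "subspace (K n)" for n
  proof -
    interpret g: Vector_Spaces.linear "smult V" "smult V" "g ^^ n" by (rule gn)
    show ?thesis using V
      by (auto simp: subspace_def K_def vspace_zero vspace_add vspace_smult g.zero g.add g.scale)
  qed
  have g0: "(g ^^ n) 0 = 0" for n
  proof -
    interpret g: Vector_Spaces.linear "smult V" "smult V" "g ^^ n" by (rule gn)
    show ?thesis by (rule g.zero)
  qed
  have Kmono: "K n \<subseteq> K m" if "n \<le> m" for n m
  proof -
    have "(g ^^ m) x = (g ^^ (m - n)) ((g ^^ n) x)" for x
      using that by (simp flip: funpow_add comp_apply[of "g ^^ (m - n)"])
    then show ?thesis using g0 by (auto simp: K_def)
  qed
  \<comment> \<open>The sizes of independent sets inside some kernel are bounded by the size of
    \<open>T\<close>. A kernel containing a set of maximal size contains all the others, which gives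
    the stable index without a dimension function.\<close>
  define Q where "Q k \<longleftrightarrow> (\<exists>A n. independent A \<and> A \<subseteq> K n \<and> card A = k)" for k
  have "Q 0" unfolding Q_def by (intro exI[of _ "{}"]) (simp add: independent_empty)
  moreover have "k < Suc (card T)" if "Q k" for k
  proof -
    obtain A n where A: "independent A" "A \<subseteq> K n" "card A = k" using \<open>Q k\<close> unfolding Q_def by blast
    then have "A \<subseteq> span T" using T(2) by (auto simp: K_def)
    then show ?thesis using independent_span_bound[OF T(1) A(1)] A(3) by simp
  qed
  ultimately obtain k where k: "Q k" "\<And>j. Q j \<Longrightarrow> j \<le> k"
    using Nat.ex_has_greatest_nat[of Q 0 "Suc (card T)"] by (meson less_imp_le)
  then obtain A n where A: "independent A" "A \<subseteq> K n" "card A = k" unfolding Q_def by blast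
  have fA: "finite A" using independent_span_bound[OF T(1) A(1)] A(2) T(2) by (auto simp: K_def)
  have Kn: "K m \<subseteq> K n" for m
  proof
    fix x assume x: "x \<in> K m"
    have "x \<in> span A"
    proof (rule ccontr)
      assume n: "x \<notin> span A"
      have "insert x A \<subseteq> K (max m n)" using x A(2) Kmono[of m "max m n"] Kmono[of n "max m n"] by auto
      then have "Q (card (insert x A))" unfolding Q_def using independent_insertI[OF n A(1)] by blast
      moreover have "x \<notin> A" using n span_base by blast
      ultimately show False using k(2)[of "Suc k"] A(3) fA by simp
    qed
    then show "x \<in> K n" using span_minimal[OF A(2) Ksub] by blast
  qed
  have im: "(f ^^ N) ` vcarrier V = (g ^^ N) ` vcarrier V" for N using fg by auto
  have sub: "(g ^^ N) ` vcarrier V \<subseteq> vcarrier V" for N using fg by auto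
  have inj: "inj_on (g ^^ N) ((g ^^ N) ` vcarrier V)" if "n \<le> N" for N
  proof (rule inj_onI)
    interpret g: Vector_Spaces.linear "smult V" "smult V" "g ^^ N" by (rule gn)
    fix x y assume "x \<in> (g ^^ N) ` vcarrier V" "y \<in> (g ^^ N) ` vcarrier V" and e: "(g ^^ N) x = (g ^^ N) y"
    then obtain a b where ab: "a \<in> vcarrier V" "b \<in> vcarrier V" "x = (g ^^ N) a" "y = (g ^^ N) b" by auto
    \<comment> \<open>Two elements of the image with equal images differ by \<open>g ^^ N\<close> of
      an element of \<open>K (N + N)\<close>, and this kernel is already contained in
      \<open>K N\<close>.\<close>
    have "(g ^^ (N + N)) (a - b) = 0" using e ab by (simp add: funpow_add g.diff)
    then have "a - b \<in> K (N + N)" using ab V by (simp add: K_def vspace_diff)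
    then have "a - b \<in> K N" using Kn Kmono[OF that] by blast
    then show "x = y" using ab by (simp add: K_def g.diff)
  qed
  have surj: "(g ^^ N) ` (g ^^ N) ` vcarrier V = (g ^^ N) ` vcarrier V" if "n \<le> N" for N
  proof (rule inj_endo_imp_surj[OF _ _ T(1) gn _ inj[OF that]])
    interpret g: Vector_Spaces.linear "smult V" "smult V" "g ^^ N" by (rule gn)
    show "subspace ((g ^^ N) ` vcarrier V)" by (rule g.subspace_image[OF vspace_subspace[OF V]])
    show "(g ^^ N) ` vcarrier V \<subseteq> span T" using sub T(2) by simp
    show "(g ^^ N) ` (g ^^ N) ` vcarrier V \<subseteq> (g ^^ N) ` vcarrier V" using sub by blast
  qed
  have eq: "(f ^^ N) x = (g ^^ N) x" if "x \<in> (f ^^ N) ` vcarrier V" for x N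
    using that fg by auto
  have "inj_on (f ^^ N) ((f ^^ N) ` vcarrier V)" if "n \<le> N" for N
    using inj[OF that] inj_on_cong[of "(f ^^ N) ` vcarrier V" "f ^^ N" "g ^^ N"] eq im by simp
  moreover have "(f ^^ N) ` (f ^^ N) ` vcarrier V = (f ^^ N) ` vcarrier V" if "n \<le> N" for N
    using surj[OF that] image_cong[of "(f ^^ N) ` vcarrier V" _ "f ^^ N" "g ^^ N"] eq im by simp
  ultimately show ?thesis by (rule that[of n])
qed

section \<open>Sweedler calculus\<close>

locale framed_space =
  fixes V :: "('k::field, 'a::ab_group_add, 'm) vspace_scheme"
    and B :: "'a set" and crd :: "'a \<Rightarrow> 'a \<Rightarrow> 'k" and cf :: "'a \<Rightarrow> 'a \<Rightarrow> 'a \<Rightarrow> 'k"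
  assumes V: "is_vspace V"
    and finite_B: "finite B" and B_carrier: "B \<subseteq> vcarrier V"
    and crd_linear: "functional V (crd i)"
    and frame: "v \<in> vcarrier V \<Longrightarrow> v = (\<Sum>i\<in>B. smult V (crd i v) i)"
    and cf_linear: "functional V (\<lambda>a. cf a i j)"
begin

abbreviation "C \<equiv> vcarrier V"

definition sw :: "'a \<Rightarrow> ('a \<Rightarrow> 'a \<Rightarrow> 'k) \<Rightarrow> 'k" where
  "sw a \<beta> = (\<Sum>i\<in>B. \<Sum>j\<in>B. cf a i j * \<beta> i j)"

lemma B_mem: "i \<in> B \<Longrightarrow> i \<in> C" using B_carrier by auto

text \<open>As a congruence rule this hands carrier membership of the Sweedler components to the
  simplifier under \<open>sw\<close>; without it no conditional rewriting would fire there.\<close>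

lemma sw_cong [cong]:
  "a = a' \<Longrightarrow> (\<And>x y. x \<in> C \<Longrightarrow> y \<in> C \<Longrightarrow> \<beta> x y = \<beta>' x y) \<Longrightarrow> sw a \<beta> = sw a' \<beta>'"
  unfolding sw_def by (intro sum.cong refl) (auto dest: B_mem)

lemma sw_mult_left: "c * sw a \<beta> = sw a (\<lambda>x y. c * \<beta> x y)"
  and sw_mult_right: "sw a \<beta> * c = sw a (\<lambda>x y. \<beta> x y * c)"
  by (simp_all add: sw_def sum_distrib_left sum_distrib_right mult_ac)

lemma sw_pairs: "sw a \<beta> = (\<Sum>p\<in>B \<times> B. cf a (fst p) (snd p) * \<beta> (fst p) (snd p))"
  by (simp add: sw_def sum.cartesian_product case_prod_unfold)

lemma sw_swap: "sw a (\<lambda>x y. sw b (\<lambda>p q. \<beta> x y p q)) = sw b (\<lambda>p q. sw a (\<lambda>x y. \<beta> x y p q))"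
  unfolding sw_pairs sum_distrib_left by (subst sum.swap) (simp add: mult_ac)

lemma sw_sum: "(\<Sum>i\<in>A. sw a (\<beta> i)) = sw a (\<lambda>x y. \<Sum>i\<in>A. \<beta> i x y)"
  unfolding sw_pairs sum_distrib_left by (rule sum.swap)

lemma functional_sw:
  "(\<And>u v. u \<in> C \<Longrightarrow> v \<in> C \<Longrightarrow> functional X (\<lambda>x. \<beta> x u v)) \<Longrightarrow> functional X (\<lambda>x. sw a (\<beta> x))"
  unfolding sw_def by (intro functional_sum functional_mult) (auto dest: B_mem)

lemma functional_sw_arg: "linear_map X V G \<Longrightarrow> functional X (\<lambda>x. sw (G x) \<beta>)"
  unfolding sw_def by (intro functional_sum functional_mult linear_map_comp[OF _ cf_linear])

lemma functional_expand: "functional V \<phi> \<Longrightarrow> v \<in> C \<Longrightarrow> \<phi> v = (\<Sum>i\<in>B. crd i v * \<phi> i)"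
  using linear_map_sum_smult[OF V is_vspace_ground, of \<phi> B "\<lambda>i. i" "\<lambda>i. crd i v"] frame[of v] B_mem by auto

lemma bilinear_expand:
  assumes \<beta>: "bilinear_form V V \<beta>" and "v \<in> C" "w \<in> C"
  shows "\<beta> v w = (\<Sum>i\<in>B. \<Sum>j\<in>B. crd i v * crd j w * \<beta> i j)"
proof -
  have "\<beta> v w = (\<Sum>i\<in>B. crd i v * \<beta> i w)"
    using assms functional_expand[of "\<lambda>v. \<beta> v w" v] by (simp add: bilinear_map_def)
  also have "\<dots> = (\<Sum>i\<in>B. crd i v * (\<Sum>j\<in>B. crd j w * \<beta> i j))"
    using assms functional_expand[of "\<beta> _" w] B_mem by (intro sum.cong) (auto simp: bilinear_map_def)
  finally show ?thesis by (simp add: sum_distrib_left mult_ac)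
qed

lemma eqI:
  "v \<in> C \<Longrightarrow> w \<in> C \<Longrightarrow> (\<And>\<phi>. functional V \<phi> \<Longrightarrow> \<phi> v = \<phi> w) \<Longrightarrow> v = w"
  using separating_eqI[OF V separating_functionals[OF V]] by blast

text \<open>The vector-valued counterpart of \<open>sw\<close>, for the place where a Sweedler sum
  must itself be fed to a power of the antipode.\<close>

definition swv :: "'a \<Rightarrow> ('a \<Rightarrow> 'a \<Rightarrow> 'a) \<Rightarrow> 'a" where
  "swv a b = (\<Sum>i\<in>B. \<Sum>j\<in>B. smult V (cf a i j) (b i j))"

lemma swv_mem: "(\<And>x y. x \<in> C \<Longrightarrow> y \<in> C \<Longrightarrow> b x y \<in> C) \<Longrightarrow> swv a b \<in> C"
  unfolding swv_def using V by (intro vspace_sum vspace_smult) (auto dest: B_mem)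

lemma functional_swv:
  assumes "functional V \<phi>" "\<And>x y. x \<in> C \<Longrightarrow> y \<in> C \<Longrightarrow> b x y \<in> C"
  shows "\<phi> (swv a b) = sw a (\<lambda>x y. \<phi> (b x y))"
proof -
  have "\<phi> (swv a b) = (\<Sum>i\<in>B. \<phi> (\<Sum>j\<in>B. smult V (cf a i j) (b i j)))"
    unfolding swv_def using V assms B_mem
    by (intro linear_map_sum[OF V is_vspace_ground assms(1)]) (auto intro!: vspace_sum vspace_smult)
  also have "\<dots> = sw a (\<lambda>x y. \<phi> (b x y))"
    unfolding sw_def
    using linear_map_sum_smult[OF V is_vspace_ground assms(1), of B "b _" "cf a _"] assms B_mem
    by (intro sum.cong) auto
  finally show ?thesis .
qed

end

text \<open>An ordinary Hopf algebra, presented by coproduct coefficients and tested by functionals.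
  \<open>coassoc\<close> can be asked of every \<open>\<tau>\<close> because it is an identity of
  coefficients; \<open>sw_m\<close> and \<open>sw_u\<close> need bilinear forms, since a product of
  frame vectors is no frame vector.\<close>

locale hopf = framed_space V B crd cf
  for V :: "('k::field, 'a::ab_group_add, 'm) vspace_scheme" and B crd cf +
  fixes m :: "'a \<Rightarrow> 'a \<Rightarrow> 'a" (infixl "\<odot>" 70) and u :: 'a and eps :: "'a \<Rightarrow> 'k" and S :: "'a \<Rightarrow> 'a"
  assumes m_bilinear: "bilinear_map V V V (\<odot>)"
    and u_mem [simp]: "u \<in> vcarrier V"
    and S_linear: "linear_map V V S"
    and eps_linear: "functional V eps"
    and unit_left [simp]: "a \<in> vcarrier V \<Longrightarrow> u \<odot> a = a"
    and unit_right [simp]: "a \<in> vcarrier V \<Longrightarrow> a \<odot> u = a"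
    and assoc: "a \<in> vcarrier V \<Longrightarrow> b \<in> vcarrier V \<Longrightarrow> c \<in> vcarrier V \<Longrightarrow> (a \<odot> b) \<odot> c = a \<odot> (b \<odot> c)"
    and coassoc: "a \<in> vcarrier V \<Longrightarrow>
      sw a (\<lambda>x y. sw x (\<lambda>p q. \<tau> p q y)) = sw a (\<lambda>x y. sw y (\<lambda>p q. \<tau> x p q))"
    and counit_left: "functional V \<phi> \<Longrightarrow> a \<in> vcarrier V \<Longrightarrow> sw a (\<lambda>x y. eps x * \<phi> y) = \<phi> a"
    and counit_right: "functional V \<phi> \<Longrightarrow> a \<in> vcarrier V \<Longrightarrow> sw a (\<lambda>x y. eps y * \<phi> x) = \<phi> a"
    and sw_m: "bilinear_form V V \<beta> \<Longrightarrow> a \<in> vcarrier V \<Longrightarrow> b \<in> vcarrier V \<Longrightarrow>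
      sw (a \<odot> b) \<beta> = sw a (\<lambda>x y. sw b (\<lambda>p q. \<beta> (x \<odot> p) (y \<odot> q)))"
    and sw_u: "bilinear_form V V \<beta> \<Longrightarrow> sw u \<beta> = \<beta> u u"
    and eps_u [simp]: "eps u = 1"
    and eps_m [simp]: "a \<in> vcarrier V \<Longrightarrow> b \<in> vcarrier V \<Longrightarrow> eps (a \<odot> b) = eps a * eps b"
    and antipode_left: "functional V \<phi> \<Longrightarrow> a \<in> vcarrier V \<Longrightarrow> sw a (\<lambda>x y. \<phi> (S x \<odot> y)) = eps a * \<phi> u"
    and antipode_right: "functional V \<phi> \<Longrightarrow> a \<in> vcarrier V \<Longrightarrow> sw a (\<lambda>x y. \<phi> (x \<odot> S y)) = eps a * \<phi> u"
begin

lemma m_mem [simp]: "a \<in> C \<Longrightarrow> b \<in> C \<Longrightarrow> a \<odot> b \<in> C"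
  by (rule bilinear_mem[OF m_bilinear])

lemma S_mem [simp]: "a \<in> C \<Longrightarrow> S a \<in> C"
  by (rule linear_map_mem[OF S_linear])

lemmas m_linear_left = bilinear_left[OF m_bilinear]
  and m_linear_right = bilinear_right[OF m_bilinear]

lemma linear_comp_S: "linear_map X V G \<Longrightarrow> linear_map X V (\<lambda>x. S (G x))"
  by (rule linear_map_comp[OF _ S_linear])

lemma functional_comp_eps: "linear_map X V G \<Longrightarrow> functional X (\<lambda>x. eps (G x))"
  by (rule linear_map_comp[OF _ eps_linear])

lemmas lin = bilinear_map_def linear_map_id functional_mult functional_sw functional_sw_arg
  m_linear_left m_linear_right linear_comp_S functional_comp_eps

section \<open>The antipode as an anti-morphism of algebras and coalgebras\<close>

lemma eps_S [simp]:
  assumes a: "a \<in> C" shows "eps (S a) = eps a"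
proof -
  have "eps a = sw a (\<lambda>x y. eps (S x \<odot> y))" using antipode_left[OF eps_linear a] by simp
  also have "\<dots> = sw a (\<lambda>x y. eps y * eps (S x))" by (simp add: mult.commute)
  also have "\<dots> = eps (S a)" by (rule counit_right) (simp_all add: a lin)
  finally show ?thesis by simp
qed

lemma S_u [simp]: "S u = u"
proof (rule eqI)
  fix \<phi> assume \<phi>: "functional V \<phi>"
  note [simp] = lin linear_map_comp[OF _ \<phi>]
  have "\<phi> u = sw u (\<lambda>x y. \<phi> (S x \<odot> y))" using antipode_left[OF \<phi>, of u] by simp
  also have "\<dots> = \<phi> (S u)" by (subst sw_u) simp_all
  finally show "\<phi> (S u) = \<phi> u" by simp
qed simp_all

text \<open>Both sides are convolution inverses of the multiplication as a map on the tensor square.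
  \<open>\<tau>\<close> is the triple convolution of \<open>S\<close> after the product, the
  product, and the product of antipodes in reverse order; collapsing it from the right gives one
  side, from the left the other.\<close>

lemma S_m:
  assumes a: "a \<in> C" and b: "b \<in> C"
  shows "S (a \<odot> b) = S b \<odot> S a"
proof (rule eqI)
  fix \<phi> assume \<phi>: "functional V \<phi>"
  note [simp] = lin linear_map_comp[OF _ \<phi>] a b
  define \<tau> where "\<tau> a1 a2 a3 b1 b2 b3 = \<phi> (S (a1 \<odot> b1) \<odot> (a2 \<odot> b2) \<odot> (S b3 \<odot> S a3))" for a1 a2 a3 b1 b2 b3
  have 1: "sw s (\<lambda>b2 b3. \<tau> a1 a2 a3 b1 b2 b3) = eps s * \<phi> (S (a1 \<odot> b1) \<odot> (a2 \<odot> S a3))"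
    if [simp]: "s \<in> C" "a1 \<in> C" "a2 \<in> C" "a3 \<in> C" "b1 \<in> C" for s a1 a2 a3 b1
  proof -
    have "sw s (\<lambda>b2 b3. \<tau> a1 a2 a3 b1 b2 b3) = sw s (\<lambda>b2 b3. \<phi> (S (a1 \<odot> b1) \<odot> a2 \<odot> (b2 \<odot> S b3) \<odot> S a3))"
      by (simp add: \<tau>_def assoc)
    also have "\<dots> = eps s * \<phi> (S (a1 \<odot> b1) \<odot> a2 \<odot> u \<odot> S a3)"
      by (rule antipode_right) simp_all
    finally show ?thesis by (simp add: assoc)
  qed
  have 2: "sw b (\<lambda>b1 s. eps s * \<phi> (S (a1 \<odot> b1) \<odot> (a2 \<odot> S a3))) = \<phi> (S (a1 \<odot> b) \<odot> (a2 \<odot> S a3))"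
    if [simp]: "a1 \<in> C" "a2 \<in> C" "a3 \<in> C" for a1 a2 a3
    by (rule counit_right) simp_all
  have 3: "sw r (\<lambda>a2 a3. \<phi> (S (a1 \<odot> b) \<odot> (a2 \<odot> S a3))) = eps r * \<phi> (S (a1 \<odot> b) \<odot> u)"
    if [simp]: "a1 \<in> C" "r \<in> C" for a1 r
    by (rule antipode_right) simp_all
  have 4: "sw a (\<lambda>a1 r. eps r * \<phi> (S (a1 \<odot> b))) = \<phi> (S (a \<odot> b))"
    by (rule counit_right) simp_all
  have "\<phi> (S (a \<odot> b)) = sw a (\<lambda>a1 r. sw r (\<lambda>a2 a3. sw b (\<lambda>b1 s. sw s (\<lambda>b2 b3. \<tau> a1 a2 a3 b1 b2 b3))))"
    by (simp add: 1 2 3 4)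
  also have "\<dots> = sw a (\<lambda>r a3. sw r (\<lambda>a1 a2. sw b (\<lambda>s b3. sw s (\<lambda>b1 b2. \<tau> a1 a2 a3 b1 b2 b3))))"
    by (simp add: coassoc)
  also have "\<dots> = sw a (\<lambda>r a3. sw b (\<lambda>s b3. sw r (\<lambda>a1 a2. sw s (\<lambda>b1 b2. \<tau> a1 a2 a3 b1 b2 b3))))"
    by (subst sw_swap) simp
  also have "\<dots> = sw a (\<lambda>r a3. sw b (\<lambda>s b3. eps s * (eps r * \<phi> (S b3 \<odot> S a3))))"
  proof (intro sw_cong refl)
    fix r a3 s b3 assume [simp]: "r \<in> C" "a3 \<in> C" "s \<in> C" "b3 \<in> C"
    have "sw r (\<lambda>a1 a2. sw s (\<lambda>b1 b2. \<tau> a1 a2 a3 b1 b2 b3)) = sw (r \<odot> s) (\<lambda>x y. \<phi> (S x \<odot> y \<odot> (S b3 \<odot> S a3)))"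
      unfolding \<tau>_def by (rule sw_m[symmetric]) simp_all
    also have "\<dots> = eps (r \<odot> s) * \<phi> (u \<odot> (S b3 \<odot> S a3))"
      by (rule antipode_left) simp_all
    finally show "sw r (\<lambda>a1 a2. sw s (\<lambda>b1 b2. \<tau> a1 a2 a3 b1 b2 b3)) = eps s * (eps r * \<phi> (S b3 \<odot> S a3))" by simp
  qed
  also have "\<dots> = sw a (\<lambda>r a3. eps r * \<phi> (S b \<odot> S a3))"
    by (intro sw_cong refl counit_left) simp_all
  also have "\<dots> = \<phi> (S b \<odot> S a)"
    by (intro counit_left) simp_all
  finally show "\<phi> (S (a \<odot> b)) = \<phi> (S b \<odot> S a)" .
qed (simp_all add: a b)

text \<open>The dual argument: the coproduct after \<open>S\<close> and the flipped pair of
  antipodes after the coproduct are both convolution inverses of the coproduct. \<open>F\<close> is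
  the integrand of the triple convolution of the former, the coproduct and the latter.\<close>

lemma sw_S:
  assumes a: "a \<in> C" and \<beta>: "bilinear_form V V \<beta>"
  shows "sw (S a) \<beta> = sw a (\<lambda>x y. \<beta> (S y) (S x))"
proof -
  have bl: "linear_map X V G \<Longrightarrow> w \<in> C \<Longrightarrow> functional X (\<lambda>x. \<beta> (G x) w)"
    and br: "linear_map X V G \<Longrightarrow> w \<in> C \<Longrightarrow> functional X (\<lambda>x. \<beta> w (G x))" for X :: "('k, 'a, 'm) vspace_scheme" and G w
    using \<beta> by (auto intro: bilinear_left bilinear_right)
  note [simp] = lin bl br a
  define F where "F p q r s a3 a4 = \<beta> (p \<odot> r \<odot> S a4) (q \<odot> s \<odot> S a3)" for p q r s a3 a4
  define \<tau> where "\<tau> a1 a2 a3 a4 = sw (S a1) (\<lambda>p q. sw a2 (\<lambda>r s. F p q r s a3 a4))" for a1 a2 a3 a4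
  have "sw a (\<lambda>x y. \<beta> (S y) (S x)) = sw a (\<lambda>t w. eps t * sw w (\<lambda>a3 a4. \<beta> (S a4) (S a3)))"
    by (rule counit_left[symmetric]) simp_all
  also have "\<dots> = sw a (\<lambda>t w. sw t (\<lambda>a1 a2. sw w (\<lambda>a3 a4. \<tau> a1 a2 a3 a4)))"
  proof (intro sw_cong refl)
    fix t w assume [simp]: "t \<in> C" "w \<in> C"
    have "sw t (\<lambda>a1 a2. \<tau> a1 a2 a3 a4) = eps t * \<beta> (S a4) (S a3)" if [simp]: "a3 \<in> C" "a4 \<in> C" for a3 a4
    proof -
      have "sw t (\<lambda>a1 a2. \<tau> a1 a2 a3 a4) = sw t (\<lambda>a1 a2. sw (S a1 \<odot> a2) (\<lambda>x y. \<beta> (x \<odot> S a4) (y \<odot> S a3)))"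
        by (simp add: \<tau>_def F_def sw_m)
      also have "\<dots> = eps t * sw u (\<lambda>x y. \<beta> (x \<odot> S a4) (y \<odot> S a3))"
        by (rule antipode_left) simp_all
      finally show ?thesis by (simp add: sw_u)
    qed
    then show "eps t * sw w (\<lambda>a3 a4. \<beta> (S a4) (S a3)) = sw t (\<lambda>a1 a2. sw w (\<lambda>a3 a4. \<tau> a1 a2 a3 a4))"
      by (subst sw_swap) (simp add: sw_mult_left)
  qed
  also have "\<dots> = sw a (\<lambda>a1 z. sw z (\<lambda>a2 w. sw w (\<lambda>a3 a4. \<tau> a1 a2 a3 a4)))"
    by (simp add: coassoc)
  also have "\<dots> = sw a (\<lambda>a1 z. eps z * sw (S a1) \<beta>)"
  proof (intro sw_cong refl)
    fix a1 z assume [simp]: "a1 \<in> C" "z \<in> C"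
    have "sw z (\<lambda>a2 w. sw w (\<lambda>a3 a4. \<tau> a1 a2 a3 a4)) =
        sw (S a1) (\<lambda>p q. sw z (\<lambda>a2 w. sw a2 (\<lambda>r s. sw w (\<lambda>a3 a4. F p q r s a3 a4))))"
      unfolding \<tau>_def by (simp only: sw_swap[of "S a1"]) (subst (2) sw_swap, rule refl)
    \<comment> \<open>Regrouping makes \<open>s\<close> and \<open>a3\<close> neighbours, so the
      product of \<open>s\<close> with the antipode of \<open>a3\<close> cancels; this brings
      \<open>r\<close> next to \<open>a4\<close> for a second cancellation.\<close>
    also have "\<dots> = sw (S a1) (\<lambda>p q. sw z (\<lambda>r y. sw y (\<lambda>v a4. sw v (\<lambda>s a3. F p q r s a3 a4))))"
      by (simp add: coassoc)
    also have "\<dots> = sw (S a1) (\<lambda>p q. eps z * \<beta> p q)"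
    proof (intro sw_cong refl)
      fix p q assume [simp]: "p \<in> C" "q \<in> C"
      have 1: "sw v (\<lambda>s a3. F p q r s a3 a4) = eps v * \<beta> (p \<odot> (r \<odot> S a4)) q"
        if [simp]: "r \<in> C" "v \<in> C" "a4 \<in> C" for r v a4
        using antipode_right[of "\<lambda>x. \<beta> (p \<odot> (r \<odot> S a4)) (q \<odot> x)" v] by (simp add: F_def assoc)
      have 2: "sw y (\<lambda>v a4. eps v * \<beta> (p \<odot> (r \<odot> S a4)) q) = \<beta> (p \<odot> (r \<odot> S y)) q" if [simp]: "r \<in> C" "y \<in> C" for r y
        by (rule counit_left) simp_all
      have 3: "sw z (\<lambda>r y. \<beta> (p \<odot> (r \<odot> S y)) q) = eps z * \<beta> (p \<odot> u) q"
        by (rule antipode_right) simp_all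
      show "sw z (\<lambda>r y. sw y (\<lambda>v a4. sw v (\<lambda>s a3. F p q r s a3 a4))) = eps z * \<beta> p q"
        using 3 by (simp add: 1 2)
    qed
    finally show "sw z (\<lambda>a2 w. sw w (\<lambda>a3 a4. \<tau> a1 a2 a3 a4)) = eps z * sw (S a1) \<beta>"
      by (simp add: sw_mult_left)
  qed
  also have "\<dots> = sw (S a) \<beta>"
    by (rule counit_right) simp_all
  finally show ?thesis by simp
qed

end

section \<open>Bijectivity of the antipode\<close>

context hopf begin

abbreviation S_pow where "S_pow n \<equiv> S ^^ n"

text \<open>\<open>S_pow n\<close> and \<open>S_pow (Suc n)\<close> are mutually inverse for the convolution product built from
  \<open>mul_par n\<close>; this parity bookkeeping is forced by \<open>S\<close> being an anti-morphism.\<close>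

definition mul_par :: "nat \<Rightarrow> 'a \<Rightarrow> 'a \<Rightarrow> 'a" where
  "mul_par n a b = (if even n then a \<odot> b else b \<odot> a)"

lemma mul_par_mem [simp]: "a \<in> C \<Longrightarrow> b \<in> C \<Longrightarrow> mul_par n a b \<in> C"
  by (simp add: mul_par_def)

lemma mul_par_unit [simp]: "a \<in> C \<Longrightarrow> mul_par n u a = a" "a \<in> C \<Longrightarrow> mul_par n a u = a"
  by (simp_all add: mul_par_def)

lemma mul_par_assoc: "a \<in> C \<Longrightarrow> b \<in> C \<Longrightarrow> c \<in> C \<Longrightarrow> mul_par n (mul_par n a b) c = mul_par n a (mul_par n b c)"
  by (simp add: mul_par_def assoc)

lemma mul_par_linear:
  "linear_map X V G \<Longrightarrow> c \<in> C \<Longrightarrow> linear_map X V (\<lambda>x. mul_par n (G x) c)"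
  "linear_map X V G \<Longrightarrow> c \<in> C \<Longrightarrow> linear_map X V (\<lambda>x. mul_par n c (G x))"
  by (cases "even n"; simp add: mul_par_def lin)+

lemma S_pow_linear: "linear_map V V (S_pow n)"
  by (induction n) (simp_all add: linear_map_id id_def comp_def linear_comp_S)

lemma S_pow_comp_linear: "linear_map X V G \<Longrightarrow> linear_map X V (\<lambda>x. S_pow n (G x))"
  by (rule linear_map_comp[OF _ S_pow_linear])

lemma S_pow_mem [simp]: "a \<in> C \<Longrightarrow> S_pow n a \<in> C"
  by (rule linear_map_mem[OF S_pow_linear])

lemma S_pow_u [simp]: "S_pow n u = u"
  by (induction n) simp_all

lemma eps_S_pow [simp]: "a \<in> C \<Longrightarrow> eps (S_pow n a) = eps a"
  by (induction n) simp_all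

lemma S_pow_m: "a \<in> C \<Longrightarrow> b \<in> C \<Longrightarrow> S_pow n (a \<odot> b) = mul_par n (S_pow n a) (S_pow n b)"
  by (induction n) (simp_all add: mul_par_def S_m)

lemma sw_S_pow:
  "a \<in> C \<Longrightarrow> bilinear_form V V \<beta> \<Longrightarrow>
    sw (S_pow n a) \<beta> = (if even n then sw a (\<lambda>x y. \<beta> (S_pow n x) (S_pow n y))
      else sw a (\<lambda>x y. \<beta> (S_pow n y) (S_pow n x)))"
proof (induction n arbitrary: \<beta>)
  case (Suc n)
  have "bilinear_form V V (\<lambda>x y. \<beta> (S y) (S x))"
    using bilinear_left[OF Suc.prems(2) S_linear] bilinear_right[OF Suc.prems(2) S_linear]
    by (simp add: bilinear_map_def)
  from Suc.IH[OF Suc.prems(1) this] show ?case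
    using Suc.prems by (simp add: sw_S)
qed simp

text \<open>The antipode axioms at \<open>S_pow n a\<close>, with the coproduct pushed through
  \<open>S_pow n\<close>. For odd \<open>n\<close> the components come out in reverse order, so the
  two axioms swap roles and \<open>mul_par\<close> restores the order.\<close>

lemma S_pow_inverse:
  assumes \<phi>: "functional V \<phi>" and a: "a \<in> C"
  shows "sw a (\<lambda>x y. \<phi> (mul_par n (S_pow n x) (S_pow (Suc n) y))) = eps a * \<phi> u"
    and "sw a (\<lambda>x y. \<phi> (mul_par n (S_pow (Suc n) x) (S_pow n y))) = eps a * \<phi> u"
proof -
  note [simp] = lin linear_map_comp[OF _ \<phi>] a
  have "sw (S_pow n a) (\<lambda>x y. \<phi> (x \<odot> S y)) = eps a * \<phi> u"
    "sw (S_pow n a) (\<lambda>x y. \<phi> (S x \<odot> y)) = eps a * \<phi> u"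
    using antipode_right[OF \<phi>, of "S_pow n a"] antipode_left[OF \<phi>, of "S_pow n a"] by simp_all
  then show "sw a (\<lambda>x y. \<phi> (mul_par n (S_pow n x) (S_pow (Suc n) y))) = eps a * \<phi> u"
    "sw a (\<lambda>x y. \<phi> (mul_par n (S_pow (Suc n) x) (S_pow n y))) = eps a * \<phi> u"
    by (auto simp: sw_S_pow mul_par_def split: if_splits)
qed

text \<open>\<open>E'\<close> is any choice of preimages; linearity is asked of \<open>E\<close>
  alone. The equation \<open>E_eq\<close> says that \<open>E\<close> is invisible after
  \<open>N\<close> antipodes, and convolution inverses allow one antipode to be stripped at a time.
  Evenness of \<open>N\<close> makes \<open>S_pow N\<close> multiplicative for every
  \<open>mul_par n\<close>.\<close>

lemma id_eq_of_S_pow_eq: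
  assumes N: "even N"
    and inj: "inj_on (S_pow N) (S_pow N ` C)"
    and E': "\<And>h. h \<in> C \<Longrightarrow> E' h \<in> C" and E: "\<And>h. E h = S_pow N (E' h)"
    and E_lin: "linear_map V V E"
    and E_eq: "\<And>h. h \<in> C \<Longrightarrow> S_pow N (E h) = S_pow N h"
    and h: "h \<in> C"
  shows "E h = h"
proof -
  have [simp]: "E h \<in> C" if "h \<in> C" for h using that E' E by simp
  have S_pow_add: "S_pow n (S_pow k a) = S_pow (n + k) a" for n k a by (simp add: funpow_add)
  have S_pow_commute: "S_pow n (S_pow k a) = S_pow k (S_pow n a)" for n k a
    by (simp add: S_pow_add add.commute)
  have par: "S_pow N (mul_par n a b) = mul_par n (S_pow N a) (S_pow N b)" if "a \<in> C" "b \<in> C" for n a b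
    using that N by (simp add: mul_par_def S_pow_m)
  \<comment> \<open>Injectivity of \<open>S_pow N\<close> on its image shows that \<open>E\<close> respects the convolution inverses,
    although \<open>E\<close> is not known to be a coalgebra map.\<close>
  have E_inverse: "sw a (\<lambda>x y. \<phi> (mul_par n (S_pow (Suc n) (E x)) (S_pow n (E y)))) = eps a * \<phi> u"
    if \<phi>: "functional V \<phi>" and a: "a \<in> C" for \<phi> n a
  proof -
    define X where "X = swv a (\<lambda>x y. mul_par n (S_pow (Suc n) (E x)) (S_pow n (E y)))"
    have X: "X \<in> C" unfolding X_def by (intro swv_mem) simp
    have *: "functional V (\<lambda>x. \<psi> (S_pow N x))" if "functional V \<psi>" for \<psi>
      by (rule linear_map_comp[OF S_pow_linear that])
    have "X = S_pow N (swv a (\<lambda>x y. mul_par n (S_pow (Suc n) (E' x)) (S_pow n (E' y))))" (is "_ = S_pow N ?Y")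
    proof (rule eqI[OF X])
      show "S_pow N ?Y \<in> C" by (intro S_pow_mem swv_mem) (simp add: E')
      fix \<psi> assume \<psi>: "functional V \<psi>"
      have "\<psi> (S_pow N ?Y) = sw a (\<lambda>x y. \<psi> (S_pow N (mul_par n (S_pow (Suc n) (E' x)) (S_pow n (E' y)))))"
        by (rule functional_swv[OF *[OF \<psi>]]) (simp add: E')
      also have "\<dots> = \<psi> X"
        unfolding X_def by (subst functional_swv[OF \<psi>])
          (simp_all add: E E' par S_pow_commute[of n] S_pow_commute[of "Suc n"] del: funpow.simps)
      finally show "\<psi> X = \<psi> (S_pow N ?Y)" by simp
    qed
    then have X_im: "X \<in> S_pow N ` C" using E' by (auto intro!: imageI swv_mem)
    have sc: "smult V (eps a) u \<in> C" using V by (simp add: vspace_smult)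
    have "S_pow N X = S_pow N (smult V (eps a) u)"
    proof (rule eqI)
      fix \<psi> assume \<psi>: "functional V \<psi>"
      have "\<psi> (S_pow N X) = sw a (\<lambda>x y. \<psi> (S_pow N (mul_par n (S_pow (Suc n) (E x)) (S_pow n (E y)))))"
        unfolding X_def by (rule functional_swv[OF *[OF \<psi>]]) simp
      also have "\<dots> = sw a (\<lambda>x y. \<psi> (S_pow N (mul_par n (S_pow (Suc n) x) (S_pow n y))))"
        by (simp add: E_eq par S_pow_commute[of N n] S_pow_commute[of N "Suc n"] del: funpow.simps)
      also have "\<dots> = eps a * \<psi> (S_pow N u)"
        by (rule S_pow_inverse(2)[OF *[OF \<psi>] a])
      also have "\<dots> = \<psi> (S_pow N (smult V (eps a) u))"
        by (simp add: linear_map_smult[OF *[OF \<psi>]])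
      finally show "\<psi> (S_pow N X) = \<psi> (S_pow N (smult V (eps a) u))" .
    qed (use X sc in simp_all)
    moreover have "smult V (eps a) u \<in> S_pow N ` C"
      by (rule image_eqI[OF _ sc]) (simp add: linear_map_smult[OF S_pow_linear])
    ultimately have "X = smult V (eps a) u" using inj X_im by (auto dest: inj_onD)
    then have "\<phi> X = eps a * \<phi> u" by (simp add: linear_map_smult[OF \<phi>])
    then show ?thesis unfolding X_def by (subst (asm) functional_swv[OF \<phi>]) simp_all
  qed
  \<comment> \<open>Descent on the exponent, phrased with truncated subtraction: beyond
    \<open>k = N\<close> nothing changes, and the instance \<open>k = N\<close> is the
    claim.\<close>
  have "\<forall>h\<in>C. S_pow (N - k) (E h) = S_pow (N - k) h" for k
  proof (induction k)
    case 0
    show ?case using E_eq by simp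
  next
    case (Suc k)
    show ?case
    proof (cases "k < N")
      case False
      then show ?thesis using Suc by simp
    next
      case True
      define n where "n = N - Suc k"
      then have n: "N - k = Suc n" "N - Suc k = n" using True by auto
      have IH: "S_pow (Suc n) (E x) = S_pow (Suc n) x" if "x \<in> C" for x using Suc that by (simp add: n)
      show ?thesis unfolding n
      proof (intro ballI eqI)
        fix h \<phi> assume h [simp]: "h \<in> C" and \<phi>: "functional V \<phi>"
        note [simp] = lin linear_map_comp[OF _ \<phi>] mul_par_linear S_pow_comp_linear linear_map_comp[OF _ E_lin]
        have 1: "sw r (\<lambda>h2 h3. \<phi> (mul_par n (S_pow n h1) (mul_par n (S_pow (Suc n) h2) (S_pow n (E h3))))) =
            eps r * \<phi> (S_pow n h1)" if [simp]: "h1 \<in> C" "r \<in> C" for h1 r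
          using E_inverse[of "\<lambda>x. \<phi> (mul_par n (S_pow n h1) x)" r n] by (simp add: IH del: funpow.simps)
        have 2: "sw r (\<lambda>h1 h2. \<phi> (mul_par n (S_pow n h1) (mul_par n (S_pow (Suc n) h2) (S_pow n (E h3))))) =
            eps r * \<phi> (S_pow n (E h3))" if [simp]: "h3 \<in> C" "r \<in> C" for h3 r
          using S_pow_inverse(1)[of "\<lambda>x. \<phi> (mul_par n x (S_pow n (E h3)))" r n]
          by (simp add: mul_par_assoc del: funpow.simps)
        have "\<phi> (S_pow n h) = sw h (\<lambda>h1 r. eps r * \<phi> (S_pow n h1))"
          by (rule counit_right[symmetric]) simp_all
        \<comment> \<open>Triple convolution of the \<open>n\<close>-th power, the next power, and
          the \<open>n\<close>-th power after \<open>E\<close>. The first two factors cancel by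
          \<open>S_pow_inverse\<close>; the last two cancel by \<open>E_inverse\<close>, because the
          induction hypothesis lets the middle factor absorb an \<open>E\<close>.\<close>
        also have "\<dots> = sw h (\<lambda>r h3. eps r * \<phi> (S_pow n (E h3)))"
          using coassoc[OF h, of "\<lambda>h1 h2 h3. \<phi> (mul_par n (S_pow n h1) (mul_par n (S_pow (Suc n) h2) (S_pow n (E h3))))"]
          by (simp add: 1 2 del: funpow.simps)
        also have "\<dots> = \<phi> (S_pow n (E h))"
          by (rule counit_left) simp_all
        finally show "\<phi> (S_pow n (E h)) = \<phi> (S_pow n h)" by simp
      qed simp_all
    qed
  qed
  from this[of N] show ?thesis using h by simp
qed

lemma finite_dim_V: "finite_dim V"
proof -
  interpret v: vector_space "smult V" by (rule vspace_vector_space[OF V])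
  have "v.span B = C"
  proof
    show "v.span B \<subseteq> C" by (rule v.span_minimal[OF B_carrier vspace_subspace[OF V]])
    show "C \<subseteq> v.span B"
    proof
      fix x assume "x \<in> C"
      then have "x = (\<Sum>i\<in>B. smult V (crd i x) i)" by (rule frame)
      also have "\<dots> \<in> v.span B" by (intro v.span_sum v.span_scale v.span_base)
      finally show "x \<in> v.span B" .
    qed
  qed
  then show ?thesis using finite_B by (auto simp: finite_dim_def)
qed

lemma S_bij: "bij_betw S C C"
proof -
  obtain n where n: "\<And>N. n \<le> N \<Longrightarrow> inj_on (S_pow N) (S_pow N ` C)"
    "\<And>N. n \<le> N \<Longrightarrow> S_pow N ` S_pow N ` C = S_pow N ` C"
    by (rule fitting[OF V finite_dim_V S_linear]) blast
  \<comment> \<open>Even for the descent, at least \<open>n\<close> for Fitting, and nonzero so that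
    one \<open>S\<close> can be split off: on the inside for injectivity, on the outside for
    surjectivity.\<close>
  define N where "N = 2 * Suc n"
  have N: "even N" "n \<le> N" "N \<noteq> 0" by (simp_all add: N_def)
  have "\<forall>h\<in>C. \<exists>e\<in>C. S_pow N (S_pow N e) = S_pow N h"
  proof
    fix h assume "h \<in> C"
    then have "S_pow N h \<in> S_pow N ` S_pow N ` C" using n(2)[OF N(2)] by blast
    then show "\<exists>e\<in>C. S_pow N (S_pow N e) = S_pow N h" by fastforce
  qed
  then obtain E' where E': "\<And>h. h \<in> C \<Longrightarrow> E' h \<in> C" "\<And>h. h \<in> C \<Longrightarrow> S_pow N (S_pow N (E' h)) = S_pow N h"
    by metis
  define E where "E h = S_pow N (E' h)" for h
  have inj: "S_pow N a = S_pow N b" if "a \<in> C" "b \<in> C" "S_pow N (S_pow N a) = S_pow N (S_pow N b)" for a b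
    using n(1)[OF N(2)] that by (auto dest: inj_onD)
  note [simp] = V E' vspace_add vspace_smult linear_map_add[OF S_pow_linear] linear_map_smult[OF S_pow_linear]
  \<comment> \<open>\<open>E'\<close> is chosen pointwise and need not be additive. \<open>E\<close>
    is, because both sides lie in the image of \<open>S_pow N\<close>, where this power is
    injective.\<close>
  have add: "E (x + y) = S_pow N (E' x + E' y)" if "x \<in> C" "y \<in> C" for x y
    unfolding E_def by (rule inj) (use that in simp_all)
  have smult: "E (smult V c x) = S_pow N (smult V c (E' x))" if "x \<in> C" for x c
    unfolding E_def by (rule inj) (use that in simp_all)
  have "linear_map V V E"
    unfolding linear_map_def using add smult by (simp add: E_def)
  then have E: "S_pow N (E' h) = h" if "h \<in> C" for h
    using id_eq_of_S_pow_eq[OF N(1) n(1)[OF N(2)], of E' E h] that by (simp add: E_def)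
  obtain M where M: "N = Suc M" using N(3) by (cases N) auto
  have "inj_on S C"
  proof (rule inj_onI)
    fix a b assume ab: "a \<in> C" "b \<in> C" and "S a = S b"
    then have "S_pow N a = S_pow N b" by (simp add: M funpow_Suc_right del: funpow.simps)
    then have "S_pow N (S_pow N (E' a)) = S_pow N (S_pow N (E' b))" using E ab by simp
    then show "a = b" using inj[of "E' a" "E' b"] E ab by simp
  qed
  moreover have "C \<subseteq> S ` C"
  proof
    fix h assume "h \<in> C"
    then have "h = S (S_pow M (E' h))" "S_pow M (E' h) \<in> C" using E[of h] by (simp_all add: M)
    then show "h \<in> S ` C" by (rule image_eqI)
  qed
  ultimately show ?thesis by (auto simp: bij_betw_def)
qed

definition S_inv :: "'a \<Rightarrow> 'a" where "S_inv = inv_into C S"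

lemma S_inv_mem [simp]: "a \<in> C \<Longrightarrow> S_inv a \<in> C"
  and S_S_inv [simp]: "a \<in> C \<Longrightarrow> S (S_inv a) = a"
  and S_inv_S [simp]: "a \<in> C \<Longrightarrow> S_inv (S a) = a"
  using S_bij unfolding S_inv_def bij_betw_def
  by (auto intro: inv_into_into f_inv_into_f inv_into_f_f)

lemma S_inv_linear: "linear_map V V S_inv"
  unfolding linear_map_def
proof (intro conjI ballI allI)
  fix x y c assume x: "x \<in> C" and y: "y \<in> C"
  have "S (S_inv x + S_inv y) = x + y"
    using x y by (simp add: linear_map_add[OF S_linear])
  then show "S_inv (x + y) = S_inv x + S_inv y"
    using S_inv_S[of "S_inv x + S_inv y"] x y V by (simp add: vspace_add)
  have "S (smult V c (S_inv x)) = smult V c x"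
    using x by (simp add: linear_map_smult[OF S_linear])
  then show "S_inv (smult V c x) = smult V c (S_inv x)"
    using S_inv_S[of "smult V c (S_inv x)"] x V by (simp add: vspace_smult)
qed simp

text \<open>Writing \<open>a\<close> as \<open>S b\<close> turns these into the antipode axioms at
  \<open>b\<close>. The order of factors is reversed because \<open>sw_S\<close> flips the
  components; these are the antipode laws of the opposite algebra.\<close>

lemma S_inv_antipode:
  assumes \<phi>: "functional V \<phi>" and a: "a \<in> C"
  shows "sw a (\<lambda>x y. \<phi> (y \<odot> S_inv x)) = eps a * \<phi> u"
    and "sw a (\<lambda>x y. \<phi> (S_inv y \<odot> x)) = eps a * \<phi> u"
proof -
  note [simp] = lin linear_map_comp[OF _ \<phi>] linear_map_comp[OF _ S_inv_linear]
  obtain b where b [simp]: "b \<in> C" and ab: "a = S b" using a S_S_inv by (metis S_inv_mem)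
  show "sw a (\<lambda>x y. \<phi> (y \<odot> S_inv x)) = eps a * \<phi> u"
    using antipode_left[OF \<phi> b] by (simp add: ab sw_S)
  show "sw a (\<lambda>x y. \<phi> (S_inv y \<odot> x)) = eps a * \<phi> u"
    using antipode_right[OF \<phi> b] by (simp add: ab sw_S)
qed

end

section \<open>Untwisting a Hom-Hopf algebra\<close>

locale framed_hom_hopf =
  fixes H :: "('k::field, 'a::ab_group_add, 'm) hom_struct_scheme" and S :: "'a \<Rightarrow> 'a"
    and B :: "'a set" and crd :: "'a \<Rightarrow> 'a \<Rightarrow> 'k"
  assumes hopf_H: "hom_hopf_algebra H S"
    and twist_bij: "bij_betw (twist H) (vcarrier H) (vcarrier H)"
    and fin: "finite B" and sub: "B \<subseteq> vcarrier H"
    and crd: "\<And>i. functional H (crd i)"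
    and frame_H: "\<And>v. v \<in> vcarrier H \<Longrightarrow> v = (\<Sum>i\<in>B. smult H (crd i v) i)"
begin

abbreviation al where "al \<equiv> twist H"
abbreviation ai where "ai \<equiv> inv_twist H"

definition um :: "'a \<Rightarrow> 'a \<Rightarrow> 'a"  (infixl "\<cdot>" 70) where "um a b = ai (mul H a b)"
definition ucf :: "'a \<Rightarrow> 'a \<Rightarrow> 'a \<Rightarrow> 'k" where "ucf a i j = comul H (ai a) (\<lambda>x y. crd i x * crd j y)"

lemma algebra_H: "hom_algebra H" and coalgebra_H: "hom_coalgebra H" and bialgebra_H: "hom_bialgebra H"
  using hopf_H by (simp_all add: hom_hopf_algebra_def hom_bialgebra_def)

lemma H: "is_vspace H" and mul_bilinear: "bilinear_map H H H (mul H)" and al_linear: "linear_map H H al"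
  and unt_mem: "unt H \<in> vcarrier H" and al_unt [simp]: "al (unt H) = unt H"
  using algebra_H by (simp_all add: hom_algebra_def)

lemma al_mul: "a \<in> vcarrier H \<Longrightarrow> b \<in> vcarrier H \<Longrightarrow> al (mul H a b) = mul H (al a) (al b)"
  and mul_unt: "a \<in> vcarrier H \<Longrightarrow> mul H (unt H) a = al a" "a \<in> vcarrier H \<Longrightarrow> mul H a (unt H) = al a"
  and hom_assoc: "a \<in> vcarrier H \<Longrightarrow> b \<in> vcarrier H \<Longrightarrow> c \<in> vcarrier H \<Longrightarrow>
     mul H (al a) (mul H b c) = mul H (mul H a b) (al c)"
  using algebra_H by (simp_all add: hom_algebra_def)

lemma comul_linear: "linear_map H (tensor H H) (comul H)" and counit_linear: "functional H (counit H)"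
  and counit_al [simp]: "c \<in> vcarrier H \<Longrightarrow> counit H (al c) = counit H c"
  using coalgebra_H by (simp_all add: hom_coalgebra_def)

lemma comul_mem: "c \<in> vcarrier H \<Longrightarrow> comul H c \<in> vcarrier (tensor H H)"
  by (rule linear_map_mem[OF comul_linear])

lemma al_mem [simp]: "a \<in> vcarrier H \<Longrightarrow> al a \<in> vcarrier H"
  by (rule linear_map_mem[OF al_linear])

lemma ai_mem [simp]: "a \<in> vcarrier H \<Longrightarrow> ai a \<in> vcarrier H"
  and al_ai [simp]: "a \<in> vcarrier H \<Longrightarrow> al (ai a) = a"
  and ai_al [simp]: "a \<in> vcarrier H \<Longrightarrow> ai (al a) = a"
  using twist_bij unfolding inv_twist_def bij_betw_def
  by (auto intro: inv_into_into f_inv_into_f inv_into_f_f)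

lemma ai_linear: "linear_map H H ai"
  unfolding linear_map_def
proof (intro conjI ballI allI)
  fix x y c assume x: "x \<in> vcarrier H" and y: "y \<in> vcarrier H"
  have "al (ai x + ai y) = x + y" using x y by (simp add: linear_map_add[OF al_linear])
  then show "ai (x + y) = ai x + ai y"
    using ai_al[of "ai x + ai y"] x y H by (simp add: vspace_add)
  have "al (smult H c (ai x)) = smult H c x" using x by (simp add: linear_map_smult[OF al_linear])
  then show "ai (smult H c x) = smult H c (ai x)"
    using ai_al[of "smult H c (ai x)"] x H by (simp add: vspace_smult)
qed simp

lemma ai_unt [simp]: "ai (unt H) = unt H"
  using ai_al[OF unt_mem] by simp

lemma counit_ai [simp]: "c \<in> vcarrier H \<Longrightarrow> counit H (ai c) = counit H c"
  using counit_al[of "ai c"] by simp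

lemma mul_mem: "a \<in> vcarrier H \<Longrightarrow> b \<in> vcarrier H \<Longrightarrow> mul H a b \<in> vcarrier H"
  by (rule bilinear_mem[OF mul_bilinear])

lemma um_mem: "a \<in> vcarrier H \<Longrightarrow> b \<in> vcarrier H \<Longrightarrow> um a b \<in> vcarrier H"
  by (simp add: um_def mul_mem)

lemma mul_um: "a \<in> vcarrier H \<Longrightarrow> b \<in> vcarrier H \<Longrightarrow> mul H a b = al (um a b)"
  by (simp add: um_def mul_mem)

lemma al_um: "a \<in> vcarrier H \<Longrightarrow> b \<in> vcarrier H \<Longrightarrow> al (um a b) = um (al a) (al b)"
  by (simp add: um_def mul_mem flip: al_mul)

lemma ai_um: "a \<in> vcarrier H \<Longrightarrow> b \<in> vcarrier H \<Longrightarrow> ai (um a b) = um (ai a) (ai b)"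
  using al_um[of "ai a" "ai b"] by (metis ai_al ai_mem al_ai um_mem)

sublocale framed_space H B crd ucf
proof
  show "functional H (\<lambda>a. ucf a i j)" for i j
    unfolding ucf_def by (rule linear_map_comp[OF linear_map_comp[OF ai_linear comul_linear] linear_map_eval])
qed (use H fin sub crd frame_H in auto)

text \<open>The bridge from the coproduct of \<open>H\<close> to \<open>sw\<close>. Bilinearity is
  essential here: the form is expanded over the frame in both arguments.\<close>

lemma comul_ai:
  assumes a: "a \<in> C" and \<beta>: "bilinear_form H H \<beta>"
  shows "comul H (ai a) \<beta> = sw a \<beta>"
proof -
  have t: "comul H (ai a) \<in> vcarrier (tensor H H)" using a by (simp add: comul_mem)
  have b: "bilinear_form H H (\<lambda>v w. crd i v * crd j w * \<beta> i j)" for i j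
    using crd by (simp add: bilinear_map_def functional_mult)
  have "comul H (ai a) \<beta> = comul H (ai a) (\<lambda>v w. \<Sum>i\<in>B. \<Sum>j\<in>B. crd i v * crd j w * \<beta> i j)"
    by (rule tensor_form_cong[OF H H \<beta> t bilinear_expand[OF \<beta>]])
  also have "\<dots> = (\<Sum>i\<in>B. comul H (ai a) (\<lambda>v w. \<Sum>j\<in>B. crd i v * crd j w * \<beta> i j))"
    by (rule tensor_sum_form[OF _ t]) (auto simp: bilinear_map_def crd functional_mult intro!: functional_sum)
  also have "\<dots> = (\<Sum>i\<in>B. \<Sum>j\<in>B. comul H (ai a) (\<lambda>v w. crd i v * crd j w * \<beta> i j))"
    by (intro sum.cong refl tensor_sum_form[OF b t])
  also have "\<dots> = sw a \<beta>"
    unfolding sw_def ucf_def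
    by (intro sum.cong refl tensor_mult_form[OF bilinear_form_prod[OF crd crd] t])
  finally show ?thesis .
qed

lemma comul_sw: "a \<in> C \<Longrightarrow> bilinear_form H H \<beta> \<Longrightarrow> comul H a \<beta> = sw (al a) \<beta>"
  using comul_ai[of "al a" \<beta>] by simp

lemma bilinear_form_comp: "bilinear_form H H \<beta> \<Longrightarrow> linear_map H H f \<Longrightarrow> linear_map H H g \<Longrightarrow>
    bilinear_form H H (\<lambda>x y. \<beta> (f x) (g y))"
  by (auto simp: bilinear_map_def linear_map_def)

lemma sw_al:
  assumes a: "a \<in> C" and \<beta>: "bilinear_form H H \<beta>"
  shows "sw (al a) \<beta> = sw a (\<lambda>x y. \<beta> (al x) (al y))"
proof -
  have "sw (al a) \<beta> = comul H (al (ai a)) \<beta>" using a \<beta> by (simp add: comul_sw)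
  also have "comul H (al (ai a)) = tensor_map H H H H al al (comul H (ai a))"
    using coalgebra_H a by (simp add: hom_coalgebra_def)
  also have "\<dots> \<beta> = comul H (ai a) (\<lambda>x y. \<beta> (al x) (al y))"
    by (rule tensor_map_eval[OF H H al_linear al_linear _ \<beta>]) (simp add: a comul_mem)
  also have "\<dots> = sw a (\<lambda>x y. \<beta> (al x) (al y))"
    by (rule comul_ai[OF a bilinear_form_comp[OF \<beta> al_linear al_linear]])
  finally show ?thesis .
qed

lemma sw_ai:
  assumes a: "a \<in> C" and \<beta>: "bilinear_form H H \<beta>"
  shows "sw (ai a) \<beta> = sw a (\<lambda>x y. \<beta> (ai x) (ai y))"
  using sw_al[of "ai a" "\<lambda>x y. \<beta> (ai x) (ai y)"] a bilinear_form_comp[OF \<beta> ai_linear ai_linear]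
  by simp

text \<open>Both sides are sums over the frame with the same \<open>\<tau> p q y\<close>, so only
  the coefficients need comparing. Their equality is Hom-coassociativity evaluated at products of
  coordinate functionals.\<close>

lemma ucf_coassoc:
  assumes a: "a \<in> C"
  shows "sw a (\<lambda>x y. sw x (\<lambda>p q. \<tau> p q y)) = sw a (\<lambda>x y. sw y (\<lambda>p q. \<tau> x p q))"
proof -
  have sum4: "sw a (\<lambda>x y. sw x (\<lambda>p q. \<tau> p q y)) =
      (\<Sum>p\<in>B. \<Sum>q\<in>B. \<Sum>y\<in>B. (\<Sum>x\<in>B. ucf a x y * ucf x p q) * \<tau> p q y)" (is "_ = ?L") for \<tau>
  proof -
    have "sw a (\<lambda>x y. sw x (\<lambda>p q. \<tau> p q y)) =
        (\<Sum>x\<in>B. \<Sum>y\<in>B. \<Sum>p\<in>B. \<Sum>q\<in>B. ucf a x y * ucf x p q * \<tau> p q y)"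
      by (simp add: sw_def sum_distrib_left mult.assoc)
    also have "\<dots> = (\<Sum>(x, y, p, q)\<in>B \<times> B \<times> B \<times> B. ucf a x y * ucf x p q * \<tau> p q y)"
      by (simp add: sum.cartesian_product)
    also have "\<dots> = (\<Sum>(p, q, y, x)\<in>B \<times> B \<times> B \<times> B. ucf a x y * ucf x p q * \<tau> p q y)"
      by (rule sum.reindex_bij_witness[of _ "\<lambda>(p, q, y, x). (x, y, p, q)" "\<lambda>(x, y, p, q). (p, q, y, x)"]) auto
    also have "\<dots> = ?L" by (simp add: sum.cartesian_product[symmetric] sum_distrib_right)
    finally show ?thesis .
  qed
  have sum4': "sw a (\<lambda>x y. sw y (\<lambda>p q. \<tau> x p q)) =
      (\<Sum>p\<in>B. \<Sum>q\<in>B. \<Sum>y\<in>B. (\<Sum>x\<in>B. ucf a p x * ucf x q y) * \<tau> p q y)" (is "_ = ?L") for \<tau>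
  proof -
    have "sw a (\<lambda>x y. sw y (\<lambda>p q. \<tau> x p q)) =
        (\<Sum>p\<in>B. \<Sum>x\<in>B. \<Sum>q\<in>B. \<Sum>y\<in>B. ucf a p x * ucf x q y * \<tau> p q y)"
      by (simp add: sw_def sum_distrib_left mult.assoc)
    also have "\<dots> = (\<Sum>(p, x, q, y)\<in>B \<times> B \<times> B \<times> B. ucf a p x * ucf x q y * \<tau> p q y)"
      by (simp add: sum.cartesian_product)
    also have "\<dots> = (\<Sum>(p, q, y, x)\<in>B \<times> B \<times> B \<times> B. ucf a p x * ucf x q y * \<tau> p q y)"
      by (rule sum.reindex_bij_witness[of _ "\<lambda>(p, q, y, x). (p, x, q, y)" "\<lambda>(p, x, q, y). (p, q, y, x)"]) auto
    also have "\<dots> = ?L" by (simp add: sum.cartesian_product[symmetric] sum_distrib_right)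
    finally show ?thesis .
  qed
  have "(\<Sum>x\<in>B. ucf a x y * ucf x p q) = (\<Sum>x\<in>B. ucf a p x * ucf x q y)" for p q y
  proof -
    let ?t = "comul H (ai a)"
    have t: "?t \<in> vcarrier (tensor H H)" using a by (simp add: comul_mem)
    \<comment> \<open>Hom-coassociativity has an \<open>al\<close> on the leg that is not split.
      Testing with coordinates after \<open>ai\<close> removes it, and on the split leg the same
      \<open>ai\<close> turns \<open>comul H v\<close> into the coefficients
      \<open>ucf v\<close>.\<close>
    have c: "functional H (\<lambda>x. crd i (ai x))" for i by (rule linear_map_comp[OF ai_linear crd])
    have ucf_expand: "ucf z i j = (\<Sum>x\<in>B. crd x z * ucf x i j)" if "z \<in> C" for z i j
      by (rule functional_expand[OF cf_linear that])
    have b1: "bilinear_form H H (\<lambda>v w. ucf v p q * crd y w)" by (intro bilinear_form_prod cf_linear crd)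
    have b2: "bilinear_form H H (\<lambda>v w. crd p v * ucf w q y)" by (intro bilinear_form_prod cf_linear crd)
    have u: "comul H v (\<lambda>x y. crd i (ai x) * crd j (ai y)) = ucf v i j" if "v \<in> C" for v i j
      using that by (simp add: comul_sw sw_al bilinear_form_prod c)
        (simp add: ucf_def comul_ai bilinear_form_prod crd)
    have "tensor_assoc H H H (tensor_map H H (tensor H H) H (comul H) al ?t) =
        tensor_map H H H (tensor H H) al (comul H) ?t"
      using coalgebra_H a by (simp add: hom_coalgebra_def)
    then have "?t (\<lambda>v w. comul H v (\<lambda>x y. crd p (ai x) * crd q (ai y)) * crd y (ai (al w))) =
      ?t (\<lambda>v w. crd p (ai (al v)) * comul H w (\<lambda>x z. crd q (ai x) * crd y (ai z)))"
      using hom_coassoc_eval[OF H comul_linear al_linear t c[of p] c[of q] c[of y]] by simp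
    also have "?t (\<lambda>v w. comul H v (\<lambda>x y. crd p (ai x) * crd q (ai y)) * crd y (ai (al w))) =
        ?t (\<lambda>v w. ucf v p q * crd y w)"
      by (rule tensor_form_cong[OF H H b1 t, symmetric]) (simp add: u)
    also have "?t (\<lambda>v w. crd p (ai (al v)) * comul H w (\<lambda>x z. crd q (ai x) * crd y (ai z))) =
        ?t (\<lambda>v w. crd p v * ucf w q y)"
      by (rule tensor_form_cong[OF H H b2 t, symmetric]) (simp add: u)
    finally have e: "?t (\<lambda>v w. ucf v p q * crd y w) = ?t (\<lambda>v w. crd p v * ucf w q y)" .
    have bb: "bilinear_form H H (\<lambda>v w. crd i v * crd j w * c)" for i j c
      using crd by (simp add: bilinear_map_def functional_mult)
    have "?t (\<lambda>v w. ucf v p q * crd y w) = ?t (\<lambda>v w. \<Sum>x\<in>B. crd x v * crd y w * ucf x p q)"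
      by (rule tensor_form_cong[OF H H b1 t])
         (subst ucf_expand, simp_all add: sum_distrib_left sum_distrib_right mult_ac)
    also have "\<dots> = (\<Sum>x\<in>B. ucf a x y * ucf x p q)"
      by (simp add: tensor_sum_form[OF bb t] tensor_mult_form[OF bilinear_form_prod[OF crd crd] t] ucf_def)
    finally have 1: "?t (\<lambda>v w. ucf v p q * crd y w) = (\<Sum>x\<in>B. ucf a x y * ucf x p q)" .
    have "?t (\<lambda>v w. crd p v * ucf w q y) = ?t (\<lambda>v w. \<Sum>x\<in>B. crd p v * crd x w * ucf x q y)"
      by (rule tensor_form_cong[OF H H b2 t])
         (subst ucf_expand, simp_all add: sum_distrib_left mult_ac)
    also have "\<dots> = (\<Sum>x\<in>B. ucf a p x * ucf x q y)"
      by (simp add: tensor_sum_form[OF bb t] tensor_mult_form[OF bilinear_form_prod[OF crd crd] t] ucf_def)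
    finally show ?thesis using e 1 by simp
  qed
  then show ?thesis by (simp add: sum4 sum4')
qed

lemma um_bilinear: "bilinear_map H H H um"
  unfolding um_def by (rule bilinear_map_comp[OF mul_bilinear ai_linear])

text \<open>Every product and coproduct of \<open>H\<close> brings one surplus \<open>al\<close>,
  which the \<open>ai\<close> in \<open>um\<close> and \<open>ucf\<close> absorbs. Unit, counit and
  antipode carry over unchanged, since \<open>ai\<close> fixes the unit and preserves the
  counit.\<close>

sublocale hopf H B crd ucf um "unt H" "counit H" S
proof
  show "linear_map H H S" using hopf_H by (simp add: hom_hopf_algebra_def)
  show "um (unt H) a = a" "um a (unt H) = a" if "a \<in> C" for a
    using that by (simp_all add: um_def mul_unt)
  show "um (um a b) c = um a (um b c)" if "a \<in> C" "b \<in> C" "c \<in> C" for a b c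
  proof -
    have "al (al (um (um a b) c)) = mul H (mul H a b) (al c)"
      using that by (simp add: mul_um al_um um_mem)
    also have "\<dots> = al (al (um a (um b c)))"
      using that hom_assoc[of a b c] by (simp add: mul_um al_um um_mem)
    finally have "ai (ai (al (al (um (um a b) c)))) = ai (ai (al (al (um a (um b c)))))" by simp
    then show ?thesis using that by (simp add: um_mem)
  qed
  show "sw a (\<lambda>x y. sw x (\<lambda>p q. \<tau> p q y)) = sw a (\<lambda>x y. sw y (\<lambda>p q. \<tau> x p q))"
    if "a \<in> C" for a \<tau> using that by (rule ucf_coassoc)
  show "sw a (\<lambda>x y. counit H x * \<phi> y) = \<phi> a" "sw a (\<lambda>x y. counit H y * \<phi> x) = \<phi> a"
    if \<phi>: "functional H \<phi>" and a: "a \<in> C" for \<phi> a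
  proof -
    interpret v: vector_space "smult H" by (rule vspace_vector_space[OF H])
    have t: "comul H (ai a) \<in> vcarrier (tensor H H)" using a by (simp add: comul_mem)
    have b: "bilinear_map H H H (\<lambda>x y. smult H (counit H x) y)" "bilinear_map H H H (\<lambda>x y. smult H (counit H y) x)"
      using counit_linear H
      by (auto simp: bilinear_map_def linear_map_def vspace_smult v.scale_right_distrib v.scale_left_distrib mult.commute)
    have b2: "bilinear_form H H (\<lambda>x y. counit H x * \<phi> y)" "bilinear_form H H (\<lambda>x y. counit H y * \<phi> x)"
      using \<phi> counit_linear by (simp_all add: bilinear_map_def functional_mult)
    have "tensor_lift H H H (\<lambda>x y. smult H (counit H x) y) (comul H (ai a)) = a"
      "tensor_lift H H H (\<lambda>x y. smult H (counit H y) x) (comul H (ai a)) = a"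
      using coalgebra_H a by (simp_all add: hom_coalgebra_def)
    with tensor_lift_apply[OF H b(1) \<phi> t] tensor_lift_apply[OF H b(2) \<phi> t]
    have e: "comul H (ai a) (\<lambda>x y. \<phi> (smult H (counit H x) y)) = \<phi> a"
      "comul H (ai a) (\<lambda>x y. \<phi> (smult H (counit H y) x)) = \<phi> a" by simp_all
    have "sw a (\<lambda>x y. counit H x * \<phi> y) = comul H (ai a) (\<lambda>x y. counit H x * \<phi> y)"
      by (simp add: comul_ai a b2)
    also have "\<dots> = comul H (ai a) (\<lambda>x y. \<phi> (smult H (counit H x) y))"
      by (rule tensor_form_cong[OF H H b2(1) t]) (simp add: linear_map_smult[OF \<phi>])
    finally show "sw a (\<lambda>x y. counit H x * \<phi> y) = \<phi> a" using e by simp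
    have "sw a (\<lambda>x y. counit H y * \<phi> x) = comul H (ai a) (\<lambda>x y. counit H y * \<phi> x)"
      by (simp add: comul_ai a b2)
    also have "\<dots> = comul H (ai a) (\<lambda>x y. \<phi> (smult H (counit H y) x))"
      by (rule tensor_form_cong[OF H H b2(2) t]) (simp add: linear_map_smult[OF \<phi>])
    finally show "sw a (\<lambda>x y. counit H y * \<phi> x) = \<phi> a" using e by simp
  qed
  show "sw (um a b) \<beta> = sw a (\<lambda>x y. sw b (\<lambda>p q. \<beta> (um x p) (um y q)))"
    if \<beta>: "bilinear_form H H \<beta>" and a: "a \<in> C" and b: "b \<in> C" for \<beta> a b
  proof -
    have bi: "bilinear_form H H (\<lambda>x y. \<beta> (ai x) (ai y))" by (rule bilinear_form_comp[OF \<beta> ai_linear ai_linear])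
    have t: "comul H (ai c) \<in> vcarrier (tensor H H)" if "c \<in> C" for c using that by (simp add: comul_mem)
    have bq: "bilinear_form H H (\<lambda>p q. \<beta> (um x p) (um y q))" if "x \<in> C" "y \<in> C" for x y
      by (rule bilinear_form_comp[OF \<beta>]) (use that in \<open>auto intro: bilinear_right[OF um_bilinear linear_map_id]\<close>)
    have bp: "bilinear_form H H (\<lambda>x y. sw b (\<lambda>p q. \<beta> (um x p) (um y q)))"
      using bilinear_left[OF \<beta> bilinear_left[OF um_bilinear linear_map_id]]
        bilinear_right[OF \<beta> bilinear_left[OF um_bilinear linear_map_id]] um_mem
      by (intro bilinear_mapI functional_sw) auto
    have "sw (um a b) \<beta> = sw (ai (mul H a b)) \<beta>" by (simp add: um_def)
    also have "\<dots> = sw (mul H a b) (\<lambda>x y. \<beta> (ai x) (ai y))" using a b \<beta> by (simp add: sw_ai mul_mem)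
    also have "\<dots> = comul H (ai (mul H a b)) (\<lambda>x y. \<beta> (ai x) (ai y))" using a b bi by (simp add: comul_ai mul_mem)
    also have "ai (mul H a b) = mul H (ai a) (ai b)" using a b by (simp add: mul_um ai_um[symmetric] um_mem)
    also have "comul H (mul H (ai a) (ai b)) = tensor_mul H (comul H (ai a)) (comul H (ai b))"
      using bialgebra_H a b by (simp add: hom_bialgebra_def)
    also have "\<dots> (\<lambda>x y. \<beta> (ai x) (ai y)) =
        comul H (ai a) (\<lambda>x y. comul H (ai b) (\<lambda>p q. \<beta> (ai (mul H x p)) (ai (mul H y q))))"
      by (rule tensor_mul_eval[OF H mul_bilinear t[OF a] t[OF b] bi])
    also have "\<dots> = comul H (ai a) (\<lambda>x y. sw b (\<lambda>p q. \<beta> (um x p) (um y q)))"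
      by (rule tensor_form_cong[OF H H bp t[OF a], symmetric])
         (use b bq in \<open>simp add: comul_ai[symmetric] um_def\<close>)
    also have "\<dots> = sw a (\<lambda>x y. sw b (\<lambda>p q. \<beta> (um x p) (um y q)))"
      by (rule comul_ai[OF a bp])
    finally show ?thesis .
  qed
  show "sw (unt H) \<beta> = \<beta> (unt H) (unt H)" if \<beta>: "bilinear_form H H \<beta>" for \<beta>
  proof -
    have "comul H (unt H) = pure_tensor H H (unt H) (unt H)" using bialgebra_H by (simp add: hom_bialgebra_def)
    then show ?thesis using comul_ai[OF unt_mem \<beta>] \<beta> by (simp add: pure_tensor_apply)
  qed
  show "counit H (unt H) = 1" using bialgebra_H by (simp add: hom_bialgebra_def)
  show "counit H (um a b) = counit H a * counit H b" if "a \<in> C" "b \<in> C" for a b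
    using bialgebra_H that by (simp add: hom_bialgebra_def um_def mul_mem)
  show "sw a (\<lambda>x y. \<phi> (um (S x) y)) = counit H a * \<phi> (unt H)"
    "sw a (\<lambda>x y. \<phi> (um x (S y))) = counit H a * \<phi> (unt H)"
    if \<phi>: "functional H \<phi>" and a: "a \<in> C" for \<phi> a
  proof -
    have t: "comul H (ai a) \<in> vcarrier (tensor H H)" using a by (simp add: comul_mem)
    have SL: "linear_map H H S" using hopf_H by (simp add: hom_hopf_algebra_def)
    have \<phi>': "functional H (\<lambda>x. \<phi> (ai x))" by (rule linear_map_comp[OF ai_linear \<phi>])
    have b: "bilinear_map H H H (\<lambda>x y. mul H (S x) y)" "bilinear_map H H H (\<lambda>x y. mul H x (S y))"
      using mul_bilinear SL by (auto simp: bilinear_map_def linear_map_def)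
    have "tensor_lift H H H (\<lambda>x y. mul H (S x) y) (comul H (ai a)) = smult H (counit H a) (unt H)"
      "tensor_lift H H H (\<lambda>x y. mul H x (S y)) (comul H (ai a)) = smult H (counit H a) (unt H)"
      using hopf_H a by (simp_all add: hom_hopf_algebra_def)
    with tensor_lift_apply[OF H b(1) \<phi>' t] tensor_lift_apply[OF H b(2) \<phi>' t]
    show "sw a (\<lambda>x y. \<phi> (um (S x) y)) = counit H a * \<phi> (unt H)"
      "sw a (\<lambda>x y. \<phi> (um x (S y))) = counit H a * \<phi> (unt H)"
      using bilinear_map_comp[OF b(1) \<phi>'] bilinear_map_comp[OF b(2) \<phi>'] unt_mem
      by (simp_all add: comul_ai a um_def linear_map_smult[OF \<phi>'])
  qed
qed (rule um_bilinear counit_linear unt_mem)+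

end

section \<open>The dual space and the underlying space of the double\<close>

context framed_hom_hopf begin

abbreviation Hd where "Hd \<equiv> dual_hom H"
abbreviation C' where "C' \<equiv> vcarrier Hd"
abbreviation D where "D \<equiv> tensor H Hd"
abbreviation pt where "pt \<equiv> pure_tensor H Hd"

lemma smult_Hd [simp]: "smult Hd = fscale"
  by (simp add: dual_hom_def dual_space_def)

lemma Hd_iff: "f \<in> C' \<longleftrightarrow> functional H f \<and> restr H f = f"
  by (simp add: dual_hom_def dual_space_def)

lemma restr_apply [simp]: "x \<in> C \<Longrightarrow> restr H f x = f x"
  by (simp add: restr_def)

lemma Hd_functional: "f \<in> C' \<Longrightarrow> functional H f"
  by (simp add: Hd_iff)

lemma Hd_eqI: "f \<in> C' \<Longrightarrow> g \<in> C' \<Longrightarrow> (\<And>x. x \<in> C \<Longrightarrow> f x = g x) \<Longrightarrow> f = g"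
  by (metis Hd_iff restr_def ext)

lemma restr_cong: "(\<And>x. x \<in> C \<Longrightarrow> f x = g x) \<Longrightarrow> restr H f = restr H g"
  by (auto simp: restr_def)

lemma restr_mem: "functional H f \<Longrightarrow> restr H f \<in> C'"
  using linear_map_cong[OF _ H, of "restr H f" f ground] by (auto simp: Hd_iff restr_def)

lemma Hd: "is_vspace Hd"
proof -
  interpret vector_space "fscale :: 'k \<Rightarrow> ('a \<Rightarrow> 'k) \<Rightarrow> _" by (rule vector_space_fscale)
  have *: "restr H f = f \<longleftrightarrow> (\<forall>x. x \<notin> C \<longrightarrow> f x = 0)" for f
    by (auto simp: restr_def fun_eq_iff)
  show ?thesis
    by (auto simp: is_vspace_def vector_space_fscale subspace_def Hd_iff * linear_map_def fscale_def algebra_simps)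
qed

lemma linear_eval: "linear_map X Hd F \<Longrightarrow> y \<in> C \<Longrightarrow> functional X (\<lambda>x. F x y)"
  by (auto simp: linear_map_def fscale_def)

lemma linear_restr:
  assumes "is_vspace X" "\<And>x. x \<in> vcarrier X \<Longrightarrow> functional H (F x)"
    "\<And>y. y \<in> C \<Longrightarrow> functional X (\<lambda>x. F x y)"
  shows "linear_map X Hd (\<lambda>x. restr H (F x))"
proof -
  have "F (x + y) z = F x z + F y z" "F (smult X c x) z = c * F x z"
    if "x \<in> vcarrier X" "y \<in> vcarrier X" "z \<in> C" for x y z c
    using assms(3) that by (auto simp: linear_map_def)
  then show ?thesis
    unfolding linear_map_def using assms(2) by (simp add: restr_mem) (auto simp: restr_def fun_eq_iff fscale_def)
qed

text \<open>Testing functionals at points spares the bidual: an identity in the dual becomes an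
  identity of values on \<open>H\<close>.\<close>

lemma separating_Hd: "separating Hd {\<lambda>f. f x |x. x \<in> C}"
  unfolding separating_def
proof (intro conjI ballI impI)
  fix \<phi> :: "('a \<Rightarrow> 'k) \<Rightarrow> 'k" assume "\<phi> \<in> {\<lambda>f. f x |x. x \<in> C}"
  then obtain x where "\<phi> = (\<lambda>f. f x)" by auto
  then show "functional Hd \<phi>" by (simp add: linear_map_def fscale_def)
next
  fix f assume f: "f \<in> C'" and "\<forall>\<phi>\<in>{\<lambda>f. f x |x. x \<in> C}. \<phi> f = 0"
  then have "f x = 0" if "x \<in> C" for x using that by auto
  then show "f = 0" using vspace_zero[OF Hd] by (intro Hd_eqI f) auto
qed

lemma functional_at: "functional Hd (\<lambda>f. f x)"
  by (simp add: linear_map_def fscale_def)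

text \<open>The tensor product of \<phi> with evaluation at \<open>x\<close>. These functionals
  separate the points of the double, and their products separate its tensor powers.\<close>

definition dtest :: "('a \<Rightarrow> 'k) \<Rightarrow> 'a \<Rightarrow> ('k, 'a) double \<Rightarrow> 'k" where
  "dtest \<phi> x t = t (\<lambda>h f. \<phi> h * f x)"

lemma dtest_functional: "functional D (dtest \<phi> x)"
  unfolding dtest_def by (rule linear_map_eval)

lemma dtest_pure: "functional H \<phi> \<Longrightarrow> dtest \<phi> x (pt h f) = \<phi> h * f x"
  unfolding dtest_def by (rule pure_tensor_apply) (intro bilinear_form_prod functional_at)

lemma separating_D: "separating D {dtest \<phi> x |\<phi> x. functional H \<phi> \<and> x \<in> C}"
proof -
  have "{\<lambda>t. t (\<lambda>v w. \<phi> v * \<psi> w) |\<phi> \<psi>. \<phi> \<in> {\<phi>. functional H \<phi>} \<and> \<psi> \<in> {\<lambda>f. f x |x. x \<in> C}} =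
      {dtest \<phi> x |\<phi> x. functional H \<phi> \<and> x \<in> C}"
    by (fastforce simp: dtest_def[abs_def])
  then show ?thesis
    using separating_tensor[OF H Hd separating_functionals[OF H] separating_Hd] by simp
qed

lemma D_eqI:
  assumes "s \<in> vcarrier D" "t \<in> vcarrier D"
    "\<And>\<phi> x. functional H \<phi> \<Longrightarrow> x \<in> C \<Longrightarrow> dtest \<phi> x s = dtest \<phi> x t"
  shows "s = t"
  by (rule separating_eqI[OF is_vspace_tensor separating_D assms(1,2)]) (use assms(3) in auto)

lemma tensor_DD_eqI:
  assumes "s \<in> vcarrier (tensor D D)" "t \<in> vcarrier (tensor D D)"
    "\<And>\<phi> x \<psi> y. functional H \<phi> \<Longrightarrow> x \<in> C \<Longrightarrow> functional H \<psi> \<Longrightarrow> y \<in> C \<Longrightarrow>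
      s (\<lambda>a b. dtest \<phi> x a * dtest \<psi> y b) = t (\<lambda>a b. dtest \<phi> x a * dtest \<psi> y b)"
  shows "s = t"
  by (rule separating_eqI[OF is_vspace_tensor
      separating_tensor[OF is_vspace_tensor is_vspace_tensor separating_D separating_D] assms(1,2)])
    (use assms(3) in auto)

lemma tensor_DDD_eqI:
  assumes "s \<in> vcarrier (tensor D (tensor D D))" "t \<in> vcarrier (tensor D (tensor D D))"
    "\<And>\<phi> x \<psi> y \<chi> z. functional H \<phi> \<Longrightarrow> x \<in> C \<Longrightarrow> functional H \<psi> \<Longrightarrow> y \<in> C \<Longrightarrow> functional H \<chi> \<Longrightarrow> z \<in> C \<Longrightarrow>
      s (\<lambda>a r. dtest \<phi> x a * r (\<lambda>b c. dtest \<psi> y b * dtest \<chi> z c)) = t (\<lambda>a r. dtest \<phi> x a * r (\<lambda>b c. dtest \<psi> y b * dtest \<chi> z c))"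
  shows "s = t"
  by (rule separating_eqI[OF is_vspace_tensor
      separating_tensor[OF is_vspace_tensor is_vspace_tensor separating_D
        separating_tensor[OF is_vspace_tensor is_vspace_tensor separating_D separating_D]] assms(1,2)])
    (use assms(3) in auto)

lemma pure_mem [simp]: "h \<in> C \<Longrightarrow> f \<in> C' \<Longrightarrow> pt h f \<in> vcarrier D"
  by (rule pure_tensor_mem)

lemma ai_pow: "(ai ^^ 2) x = ai (ai x)" "(ai ^^ 3) x = ai (ai (ai x))"
  by (simp_all add: numeral_2_eq_2 numeral_3_eq_3)

lemma linear_al: "linear_map X H G \<Longrightarrow> linear_map X H (\<lambda>x. al (G x))"
  and linear_ai: "linear_map X H G \<Longrightarrow> linear_map X H (\<lambda>x. ai (G x))"
  by (auto intro: linear_map_comp al_linear ai_linear)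

lemmas linH = lin linear_al linear_ai

lemma functional_Hd: "f \<in> C' \<Longrightarrow> linear_map X H G \<Longrightarrow> functional X (\<lambda>x. f (G x))"
  by (auto intro: linear_map_comp Hd_functional)

lemma functional_Hd_arg: "linear_map X Hd F \<Longrightarrow> x \<in> C \<Longrightarrow> functional X (\<lambda>t. F t x)"
  by (rule linear_eval)

lemma S_al [simp]: "a \<in> C \<Longrightarrow> S (al a) = al (S a)"
  using hopf_H by (simp add: hom_hopf_algebra_def)

lemma S_ai: "a \<in> C \<Longrightarrow> S (ai a) = ai (S a)"
  using S_al[of "ai a"] ai_al[of "S (ai a)"] by simp

section \<open>Structure maps of the dual\<close>

text \<open>The coproduct of \<open>H\<close> at \<open>x\<close> is the untwisted one at
  \<open>al x\<close>; against the two \<open>ai\<close> on each leg of the dual product, one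
  \<open>ai\<close> is left over.\<close>

lemma mul_Hd:
  assumes f: "f \<in> C'" and g: "g \<in> C'"
  shows "mul Hd f g = restr H (\<lambda>x. sw (ai x) (\<lambda>p q. f p * g q))"
proof -
  note [simp] = linH functional_Hd[OF f] functional_Hd[OF g]
  have "tensor_lift H H ground (\<lambda>p q. f ((ai ^^ 2) p) * g ((ai ^^ 2) q)) (comul H x) =
      sw (ai x) (\<lambda>p q. f p * g q)" if x: "x \<in> C" for x
  proof -
    have "tensor_lift H H ground (\<lambda>p q. f (ai (ai p)) * g (ai (ai q))) (comul H x) =
        comul H x (\<lambda>p q. f (ai (ai p)) * g (ai (ai q)))"
      by (rule tensor_lift_ground) (simp_all add: x comul_mem)
    also have "\<dots> = sw (al x) (\<lambda>p q. f (ai (ai p)) * g (ai (ai q)))"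
      by (rule comul_sw) (simp_all add: x)
    finally show ?thesis by (simp add: ai_pow x sw_al sw_ai)
  qed
  then show ?thesis by (auto simp: dual_hom_def intro: restr_cong)
qed

lemma mul_Hd_apply: "f \<in> C' \<Longrightarrow> g \<in> C' \<Longrightarrow> x \<in> C \<Longrightarrow>
    mul Hd f g x = sw (ai x) (\<lambda>p q. f p * g q)"
  by (simp add: mul_Hd)

lemma mul_Hd_mem [simp]: "f \<in> C' \<Longrightarrow> g \<in> C' \<Longrightarrow> mul Hd f g \<in> C'"
  by (simp add: mul_Hd restr_mem linH)

lemma mul_Hd_linear:
  assumes X: "is_vspace X" and F: "linear_map X Hd F" and g: "g \<in> C'"
  shows "linear_map X Hd (\<lambda>x. mul Hd (F x) g)" "linear_map X Hd (\<lambda>x. mul Hd g (F x))"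
proof -
  have m: "F x \<in> C'" if "x \<in> vcarrier X" for x using F that by (rule linear_map_mem)
  have "linear_map X Hd (\<lambda>x. restr H (\<lambda>y. sw (ai y) (\<lambda>p q. F x p * g q)))"
    by (intro linear_restr X) (simp_all add: g m linH functional_Hd[of "F _"] functional_Hd[of g] functional_Hd_arg[OF F])
  then show "linear_map X Hd (\<lambda>x. mul Hd (F x) g)"
    by (rule linear_map_cong[THEN iffD2, OF _ X, rotated]) (simp add: mul_Hd m g)
  have "linear_map X Hd (\<lambda>x. restr H (\<lambda>y. sw (ai y) (\<lambda>p q. g p * F x q)))"
    by (intro linear_restr X) (simp_all add: g m linH functional_Hd[of "F _"] functional_Hd[of g] functional_Hd_arg[OF F])
  then show "linear_map X Hd (\<lambda>x. mul Hd g (F x))"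
    by (rule linear_map_cong[THEN iffD2, OF _ X, rotated]) (simp add: mul_Hd m g)
qed

definition act :: "'a \<Rightarrow> 'a \<Rightarrow> ('a \<Rightarrow> 'k) \<Rightarrow> 'a \<Rightarrow> 'k" where
  "act a b f = act_left H ((ai ^^ 3) b) (act_right H ((alpha_star H ^^ 2) f) (S ((ai ^^ 3) a)))"

text \<open>The two \<open>alpha_star\<close>, the cubes and squares of \<open>ai\<close> and the
  twists hidden in \<open>mul H\<close> cancel, up to one \<open>ai\<close> on \<open>b\<close>.
  That asymmetry is repaired in the product, where the last leg carries one \<open>al\<close> more
  than the leg \<open>k1\<close>.\<close>

lemma act_eq:
  assumes f: "f \<in> C'" and a [simp]: "a \<in> C" and b [simp]: "b \<in> C"
  shows "act a b f = restr H (\<lambda>x. f (S a \<cdot> (x \<cdot> ai b)))"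
  unfolding act_def act_left_def
proof (rule restr_cong)
  fix x assume [simp]: "x \<in> C"
  have "al (al (S (ai (ai (ai a))) \<cdot> ai (ai (al (ai (ai x) \<cdot> ai (ai (ai b))))))) \<in> C"
    by (simp add: um_mem)
  have "act_right H ((alpha_star H ^^ 2) f) (S ((ai ^^ 3) a)) (mul H ((ai ^^ 2) x) ((ai ^^ 3) b)) =
      f (al (al (al (S (ai (ai (ai a))) \<cdot> ai (ai (al (ai (ai x) \<cdot> ai (ai (ai b)))))))))"
    by (simp add: act_right_def alpha_star_def numeral_2_eq_2 numeral_3_eq_3 mul_um um_mem)
  also have "al (al (al (S (ai (ai (ai a))) \<cdot> ai (ai (al (ai (ai x) \<cdot> ai (ai (ai b)))))))) = S a \<cdot> (x \<cdot> ai b)"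
    by (simp add: al_um ai_um um_mem S_ai)
  finally show "act_right H ((alpha_star H ^^ 2) f) (S ((ai ^^ 3) a)) (mul H ((ai ^^ 2) x) ((ai ^^ 3) b)) =
    f (S a \<cdot> (x \<cdot> ai b))" .
qed

lemma act_mem [simp]: "f \<in> C' \<Longrightarrow> a \<in> C \<Longrightarrow> b \<in> C \<Longrightarrow> act a b f \<in> C'"
  by (simp add: act_eq restr_mem linH functional_Hd[of f])

lemma act_linear:
  assumes X: "is_vspace X"
  shows "linear_map X H G \<Longrightarrow> b \<in> C \<Longrightarrow> f \<in> C' \<Longrightarrow> linear_map X Hd (\<lambda>x. act (G x) b f)"
    and "linear_map X H G \<Longrightarrow> a \<in> C \<Longrightarrow> f \<in> C' \<Longrightarrow> linear_map X Hd (\<lambda>x. act a (G x) f)"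
    and "linear_map X Hd F \<Longrightarrow> a \<in> C \<Longrightarrow> b \<in> C \<Longrightarrow> linear_map X Hd (\<lambda>x. act a b (F x))"
proof -
  show "linear_map X Hd (\<lambda>x. act (G x) b f)" if G: "linear_map X H G" and [simp]: "b \<in> C" "f \<in> C'"
  proof -
    have [simp]: "G x \<in> C" if "x \<in> vcarrier X" for x using G that by (rule linear_map_mem)
    have "linear_map X Hd (\<lambda>x. restr H (\<lambda>y. f (S (G x) \<cdot> (y \<cdot> ai b))))"
      by (intro linear_restr X) (simp_all add: linH functional_Hd[of f] G)
    then show ?thesis by (rule linear_map_cong[THEN iffD2, OF _ X, rotated]) (simp add: act_eq)
  qed
  show "linear_map X Hd (\<lambda>x. act a (G x) f)" if G: "linear_map X H G" and [simp]: "a \<in> C" "f \<in> C'"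
  proof -
    have [simp]: "G x \<in> C" if "x \<in> vcarrier X" for x using G that by (rule linear_map_mem)
    have "linear_map X Hd (\<lambda>x. restr H (\<lambda>y. f (S a \<cdot> (y \<cdot> ai (G x)))))"
      by (intro linear_restr X) (simp_all add: linH functional_Hd[of f] G)
    then show ?thesis by (rule linear_map_cong[THEN iffD2, OF _ X, rotated]) (simp add: act_eq)
  qed
  show "linear_map X Hd (\<lambda>x. act a b (F x))" if F: "linear_map X Hd F" and [simp]: "a \<in> C" "b \<in> C"
  proof -
    have [simp]: "F x \<in> C'" if "x \<in> vcarrier X" for x using F that by (rule linear_map_mem)
    have "linear_map X Hd (\<lambda>x. restr H (\<lambda>y. F x (S a \<cdot> (y \<cdot> ai b))))"
      by (intro linear_restr X) (simp_all add: linH functional_Hd[of "F _"] functional_Hd_arg[OF F])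
    then show ?thesis by (rule linear_map_cong[THEN iffD2, OF _ X, rotated]) (simp add: act_eq)
  qed
qed

text \<open>The expansion of the dual coproduct in the dual frame. Having fixed representatives
  makes sums over \<open>f1\<close> and \<open>f2\<close> commute with \<open>sw\<close> for
  arbitrary integrands.\<close>

definition dual_split :: "('a \<Rightarrow> 'k) \<Rightarrow> (('a \<Rightarrow> 'k) \<Rightarrow> ('a \<Rightarrow> 'k) \<Rightarrow> 'k) \<Rightarrow> 'k" where
  "dual_split f \<beta> = (\<Sum>i\<in>B. \<beta> (restr H (crd i)) (restr H (\<lambda>k. f (ai (i \<cdot> k)))))"

lemma dual_split_mem:
  assumes "f \<in> C'" "i \<in> B"
  shows "restr H (crd i) \<in> C'" "restr H (\<lambda>k. f (ai (i \<cdot> k))) \<in> C'"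
  using assms B_mem by (auto intro!: restr_mem crd simp: functional_Hd[of f] linH)

lemma dual_split_prod:
  assumes f: "f \<in> C'" and [simp]: "h \<in> C" "k \<in> C"
  shows "dual_split f (\<lambda>f1 f2. c * (f1 h * f2 k)) = c * f (ai (h \<cdot> k))"
proof -
  have "functional H (\<lambda>x. f (ai (x \<cdot> k)))" by (simp add: functional_Hd[of f] f linH)
  from functional_expand[OF this, of h] show ?thesis
    by (simp add: dual_split_def sum_distrib_left)
qed

text \<open>Discharges the definite description in \<open>dual_hom\<close>: the finite frame
  supplies the witness \<open>t0\<close>, and uniqueness holds because pairs of point evaluations
  separate the tensor square of the dual.\<close>

lemma comul_Hd_char:
  assumes f: "f \<in> C'"
  shows "comul Hd f \<in> vcarrier (tensor Hd Hd)"
    and "bilinear_form Hd Hd \<beta> \<Longrightarrow> comul Hd f \<beta> = dual_split f \<beta>"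
proof -
  have eqs: "vcarrier (dual_space H) = C'" "smult (dual_space H) = smult Hd"
    by (simp_all add: dual_hom_def)
  have ts: "tensor (dual_space H) (dual_space H) = tensor Hd Hd"
    by (rule tensor_vspace_cong) (simp_all only: eqs)
  have tl: "tensor_lift (dual_space H) (dual_space H) ground = tensor_lift Hd Hd ground"
    by (rule tensor_lift_vspace_cong) (simp_all only: eqs)
  have bil: "bilinear_form Hd Hd (\<lambda>f1 f2. f1 h * f2 k)" for h k
    by (intro bilinear_form_prod functional_at)
  define P where "P t \<longleftrightarrow> t \<in> vcarrier (tensor (dual_space H) (dual_space H)) \<and>
    (\<forall>h\<in>C. \<forall>k\<in>C. tensor_lift (dual_space H) (dual_space H) ground (\<lambda>f1 f2. f1 h * f2 k) t = f ((ai ^^ 2) (mul H h k)))" for t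
  have P: "P t \<longleftrightarrow> t \<in> vcarrier (tensor Hd Hd) \<and> (\<forall>h\<in>C. \<forall>k\<in>C. t (\<lambda>f1 f2. f1 h * f2 k) = f (ai (h \<cdot> k)))" for t
    unfolding P_def ts tl by (auto simp: tensor_lift_ground[OF bil] mul_um ai_pow um_mem)
  define t0 where "t0 = (\<Sum>i\<in>B. pure_tensor Hd Hd (restr H (crd i)) (restr H (\<lambda>k. f (ai (i \<cdot> k)))))"
  have t0_mem: "t0 \<in> vcarrier (tensor Hd Hd)"
    unfolding t0_def by (intro vspace_sum[OF is_vspace_tensor] pure_tensor_mem dual_split_mem[OF f])
  have t0_eval: "t0 \<beta> = dual_split f \<beta>" if "bilinear_form Hd Hd \<beta>" for \<beta>
  proof -
    have "(\<lambda>t. t \<beta>) t0 = (\<Sum>i\<in>B. (\<lambda>t. t \<beta>) (pure_tensor Hd Hd (restr H (crd i)) (restr H (\<lambda>k. f (ai (i \<cdot> k))))))"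
      unfolding t0_def
      by (rule linear_map_sum[OF is_vspace_tensor[of Hd Hd] is_vspace_ground linear_map_eval])
        (intro pure_tensor_mem dual_split_mem[OF f])
    then show ?thesis by (simp add: dual_split_def pure_tensor_apply[OF that])
  qed
  have Pt0: "P t0"
    unfolding P using t0_mem dual_split_prod[OF f, where c = 1] by (simp add: t0_eval[OF bil])
  have uniq: "t = t0" if "P t" for t
  proof (rule separating_eqI[OF is_vspace_tensor separating_tensor[OF Hd Hd separating_Hd separating_Hd] _ t0_mem])
    show "t \<in> vcarrier (tensor Hd Hd)" using that by (simp add: P)
    fix \<theta> :: "('k, 'a \<Rightarrow> 'k, 'a \<Rightarrow> 'k) tens \<Rightarrow> 'k"
    assume "\<theta> \<in> {\<lambda>t. t (\<lambda>v w. \<phi> v * \<psi> w) |\<phi> \<psi>. \<phi> \<in> {\<lambda>f. f x |x. x \<in> C} \<and> \<psi> \<in> {\<lambda>f. f x |x. x \<in> C}}"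
    then obtain h k where "\<theta> = (\<lambda>t. t (\<lambda>f1 f2. f1 h * f2 k))" "h \<in> C" "k \<in> C" by auto
    then show "\<theta> t = \<theta> t0" using that Pt0 by (simp add: P)
  qed
  have "comul Hd f = (THE t. P t)" by (simp add: dual_hom_def P_def)
  also have "\<dots> = t0" by (rule the_equality[of P, OF Pt0 uniq])
  finally have c: "comul Hd f = t0" .
  show "comul Hd f \<in> vcarrier (tensor Hd Hd)" using c t0_mem by simp
  show "comul Hd f \<beta> = dual_split f \<beta>" if "bilinear_form Hd Hd \<beta>" using c t0_eval[OF that] by simp
qed

text \<open>A description by \<open>THE\<close> carries no linearity; it is read off from
  \<open>dual_split\<close>, where \<open>f\<close> enters linearly through the second leg.\<close>

lemma comul_Hd_linear: "linear_map Hd (tensor Hd Hd) (comul Hd)"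
proof -
  have eq: "t = u" if "t \<in> vcarrier (tensor Hd Hd)" "u \<in> vcarrier (tensor Hd Hd)"
    "\<And>\<beta>. bilinear_form Hd Hd \<beta> \<Longrightarrow> t \<beta> = u \<beta>" for t u using that by (rule tensor_ext)
  have r: "restr H (\<lambda>k. (f + g) (ai (i \<cdot> k))) = restr H (\<lambda>k. f (ai (i \<cdot> k))) + restr H (\<lambda>k. g (ai (i \<cdot> k)))"
    "restr H (\<lambda>k. fscale c f (ai (i \<cdot> k))) = fscale c (restr H (\<lambda>k. f (ai (i \<cdot> k))))" for f g c i
    by (auto simp: restr_def fscale_def)
  show ?thesis unfolding linear_map_def
  proof (intro conjI ballI allI)
    fix f g c assume f: "f \<in> C'" and g: "g \<in> C'"
    note fg = vspace_add[OF Hd f g] and cf = vspace_smult[OF Hd f, of c]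
    show "comul Hd f \<in> vcarrier (tensor Hd Hd)" by (rule comul_Hd_char(1)[OF f])
    show "comul Hd (f + g) = comul Hd f + comul Hd g"
    proof (rule eq)
      fix \<beta> assume \<beta>: "bilinear_form Hd Hd \<beta>"
      then have "\<beta> F (G + G') = \<beta> F G + \<beta> F G'" if "F \<in> C'" "G \<in> C'" "G' \<in> C'" for F G G'
        using that by (simp add: bilinear_map_def linear_map_def)
      then show "comul Hd (f + g) \<beta> = (comul Hd f + comul Hd g) \<beta>"
        using dual_split_mem[OF f] dual_split_mem[OF g]
        by (simp add: comul_Hd_char(2)[OF _ \<beta>] f g fg dual_split_def r sum.distrib del: plus_fun_apply)
          (simp add: comul_Hd_char(2)[OF _ \<beta>] f g dual_split_def)
    qed (use f g fg comul_Hd_char(1) vspace_add[OF is_vspace_tensor[of Hd Hd]] in auto)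
    show "comul Hd (smult Hd c f) = smult (tensor Hd Hd) c (comul Hd f)"
    proof (rule eq)
      fix \<beta> assume \<beta>: "bilinear_form Hd Hd \<beta>"
      then have "\<beta> F (fscale c G) = c * \<beta> F G" if "F \<in> C'" "G \<in> C'" for F G c
        using that by (simp add: bilinear_map_def linear_map_def)
      then show "comul Hd (smult Hd c f) \<beta> = smult (tensor Hd Hd) c (comul Hd f) \<beta>"
        using dual_split_mem[OF f] cf
        by (simp add: comul_Hd_char(2)[OF _ \<beta>] f dual_split_def r sum_distrib_left)
          (simp add: fscale_def comul_Hd_char(2)[OF _ \<beta>] f dual_split_def sum_distrib_left)
    qed (use f cf comul_Hd_char(1) vspace_smult[OF is_vspace_tensor, of "comul Hd f" Hd Hd c] in auto)
  qed
qed

end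

section \<open>The product of the double\<close>

context framed_hom_hopf begin

lemmas pure_left = bilinear_left[OF bilinear_map_pure_tensor[OF H Hd]]
  and pure_right = bilinear_right[OF bilinear_map_pure_tensor[OF H Hd]]

lemma functional_form_left:
  "bilinear_form H Hd \<beta> \<Longrightarrow> linear_map X H G \<Longrightarrow> f \<in> C' \<Longrightarrow> functional X (\<lambda>x. \<beta> (G x) f)"
  by (rule bilinear_left[where b = \<beta>])

lemma functional_form_right:
  "bilinear_form H Hd \<beta> \<Longrightarrow> linear_map X Hd F \<Longrightarrow> h \<in> C \<Longrightarrow> functional X (\<lambda>x. \<beta> h (F x))"
  by (rule bilinear_right[where b = \<beta>])

text \<open>Isolated so that linearity in each of its six arguments is available before the two
  nested lifts are taken.\<close>

definition kernel :: "'a \<Rightarrow> ('a \<Rightarrow> 'k) \<Rightarrow> ('a \<Rightarrow> 'k) \<Rightarrow> 'a \<Rightarrow> 'a \<Rightarrow> 'a \<Rightarrow> ('k, 'a) double" where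
  "kernel h f g k1 k21 k22 = pt (mul H (ai (ai k21)) h) (mul Hd (act k1 k22 f) g)"

lemma double_mul_pure_kernel:
  "double_mul_pure H S h f k g =
    tensor_lift H H D (\<lambda>k1 k2. tensor_lift H H D (kernel h f g k1) (comul H k2)) (comul H k)"
  by (simp add: double_mul_pure_def kernel_def[abs_def] act_def ai_pow)

lemma kernel_mem: "h \<in> C \<Longrightarrow> f \<in> C' \<Longrightarrow> g \<in> C' \<Longrightarrow> a \<in> C \<Longrightarrow> b \<in> C \<Longrightarrow> c \<in> C \<Longrightarrow>
    kernel h f g a b c \<in> vcarrier D"
  by (simp add: kernel_def mul_mem)

lemma kernel_linear:
  assumes X: "is_vspace X"
  shows "linear_map X H G \<Longrightarrow> f \<in> C' \<Longrightarrow> g \<in> C' \<Longrightarrow> a \<in> C \<Longrightarrow> b \<in> C \<Longrightarrow> c \<in> C \<Longrightarrow>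
      linear_map X D (\<lambda>x. kernel (G x) f g a b c)"
    "linear_map X Hd F \<Longrightarrow> h \<in> C \<Longrightarrow> g \<in> C' \<Longrightarrow> a \<in> C \<Longrightarrow> b \<in> C \<Longrightarrow> c \<in> C \<Longrightarrow>
      linear_map X D (\<lambda>x. kernel h (F x) g a b c)"
    "linear_map X Hd F \<Longrightarrow> h \<in> C \<Longrightarrow> f \<in> C' \<Longrightarrow> a \<in> C \<Longrightarrow> b \<in> C \<Longrightarrow> c \<in> C \<Longrightarrow>
      linear_map X D (\<lambda>x. kernel h f (F x) a b c)"
    "linear_map X H G \<Longrightarrow> h \<in> C \<Longrightarrow> f \<in> C' \<Longrightarrow> g \<in> C' \<Longrightarrow> b \<in> C \<Longrightarrow> c \<in> C \<Longrightarrow>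
      linear_map X D (\<lambda>x. kernel h f g (G x) b c)"
    "linear_map X H G \<Longrightarrow> h \<in> C \<Longrightarrow> f \<in> C' \<Longrightarrow> g \<in> C' \<Longrightarrow> a \<in> C \<Longrightarrow> c \<in> C \<Longrightarrow>
      linear_map X D (\<lambda>x. kernel h f g a (G x) c)"
    "linear_map X H G \<Longrightarrow> h \<in> C \<Longrightarrow> f \<in> C' \<Longrightarrow> g \<in> C' \<Longrightarrow> a \<in> C \<Longrightarrow> b \<in> C \<Longrightarrow>
      linear_map X D (\<lambda>x. kernel h f g a b (G x))"
  unfolding kernel_def
  by (simp_all add: pure_left pure_right bilinear_left[OF mul_bilinear] bilinear_right[OF mul_bilinear]
      linear_ai act_linear mul_Hd_linear X mul_mem)

lemma kernel_bilinear: "h \<in> C \<Longrightarrow> f \<in> C' \<Longrightarrow> g \<in> C' \<Longrightarrow> a \<in> C \<Longrightarrow>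
    bilinear_map H H D (kernel h f g a)"
  by (intro bilinear_mapI kernel_linear H linear_map_id)

lemma kernel_lift_bilinear:
  assumes [simp]: "h \<in> C" "f \<in> C'" "g \<in> C'"
  shows "bilinear_map H H D (\<lambda>a b. tensor_lift H H D (kernel h f g a) (comul H b))"
proof (rule bilinear_mapI)
  show "linear_map H D (\<lambda>b. tensor_lift H H D (kernel h f g a) (comul H b))" if "a \<in> C" for a
    by (rule linear_map_comp[OF comul_linear tensor_lift_linear[OF is_vspace_tensor kernel_bilinear]]) (use that in simp_all)
  show "linear_map H D (\<lambda>a. tensor_lift H H D (kernel h f g a) (comul H b))" if "b \<in> C" for b
    by (rule linear_map_tensor_lift_param[OF is_vspace_tensor H])
      (use that in \<open>simp_all add: kernel_bilinear kernel_linear H linear_map_id comul_mem\<close>)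
qed

lemma kernel_lift_linear:
  assumes X: "is_vspace X"
  shows "linear_map X H G \<Longrightarrow> f \<in> C' \<Longrightarrow> g \<in> C' \<Longrightarrow> a \<in> C \<Longrightarrow> b \<in> C \<Longrightarrow>
      linear_map X D (\<lambda>x. tensor_lift H H D (kernel (G x) f g a) (comul H b))"
    "linear_map X Hd F \<Longrightarrow> h \<in> C \<Longrightarrow> g \<in> C' \<Longrightarrow> a \<in> C \<Longrightarrow> b \<in> C \<Longrightarrow>
      linear_map X D (\<lambda>x. tensor_lift H H D (kernel h (F x) g a) (comul H b))"
    "linear_map X Hd F \<Longrightarrow> h \<in> C \<Longrightarrow> f \<in> C' \<Longrightarrow> a \<in> C \<Longrightarrow> b \<in> C \<Longrightarrow>
      linear_map X D (\<lambda>x. tensor_lift H H D (kernel h f (F x) a) (comul H b))"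
  by (rule linear_map_tensor_lift_param[OF is_vspace_tensor X];
      simp add: kernel_bilinear kernel_linear X comul_mem linear_map_mem)+

lemma double_mul_pure_bilinear:
  "h \<in> C \<Longrightarrow> f \<in> C' \<Longrightarrow> bilinear_map H Hd D (double_mul_pure H S h f)"
  "k \<in> C \<Longrightarrow> g \<in> C' \<Longrightarrow> bilinear_map H Hd D (\<lambda>h f. double_mul_pure H S h f k g)"
proof -
  show "bilinear_map H Hd D (double_mul_pure H S h f)" if [simp]: "h \<in> C" "f \<in> C'"
    unfolding double_mul_pure_kernel
  proof (rule bilinear_mapI)
    show "linear_map Hd D (\<lambda>g. tensor_lift H H D (\<lambda>a b. tensor_lift H H D (kernel h f g a) (comul H b)) (comul H k))"
      if "k \<in> C" for k
      by (rule linear_map_tensor_lift_param[OF is_vspace_tensor Hd])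
        (use that in \<open>simp_all add: kernel_lift_bilinear kernel_lift_linear Hd linear_map_id comul_mem\<close>)
    show "linear_map H D (\<lambda>k. tensor_lift H H D (\<lambda>a b. tensor_lift H H D (kernel h f g a) (comul H b)) (comul H k))"
      if "g \<in> C'" for g
      by (rule linear_map_comp[OF comul_linear tensor_lift_linear[OF is_vspace_tensor kernel_lift_bilinear]])
        (use that in simp_all)
  qed
  show "bilinear_map H Hd D (\<lambda>h f. double_mul_pure H S h f k g)" if [simp]: "k \<in> C" "g \<in> C'"
    unfolding double_mul_pure_kernel
  proof (rule bilinear_mapI)
    show "linear_map Hd D (\<lambda>f. tensor_lift H H D (\<lambda>a b. tensor_lift H H D (kernel h f g a) (comul H b)) (comul H k))"
      if "h \<in> C" for h
      by (rule linear_map_tensor_lift_param[OF is_vspace_tensor Hd])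
        (use that in \<open>simp_all add: kernel_lift_bilinear kernel_lift_linear Hd linear_map_id comul_mem\<close>)
    show "linear_map H D (\<lambda>h. tensor_lift H H D (\<lambda>a b. tensor_lift H H D (kernel h f g a) (comul H b)) (comul H k))"
      if "f \<in> C'" for f
      by (rule linear_map_tensor_lift_param[OF is_vspace_tensor H])
        (use that in \<open>simp_all add: kernel_lift_bilinear kernel_lift_linear H linear_map_id comul_mem\<close>)
  qed
qed

text \<open>In the untwisted coproduct \<open>k1\<close> acquires one \<open>al\<close>, the other
  two legs two each. On \<open>k2\<close> they cancel the two \<open>ai\<close> of the formula; on
  \<open>k3\<close> one cancels the surplus \<open>ai\<close> of \<open>act_eq\<close>. So
  \<open>k1\<close> and \<open>k3\<close> both act through one \<open>al\<close>.\<close>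

lemma double_mul_pure_eval:
  assumes [simp]: "h \<in> C" "f \<in> C'" "k \<in> C" "g \<in> C'" and \<beta>: "bilinear_form H Hd \<beta>"
  shows "double_mul_pure H S h f k g \<beta> =
    sw k (\<lambda>k1 r. sw r (\<lambda>k2 k3. \<beta> (al (k2 \<cdot> h)) (mul Hd (act (al k1) (al (al k3)) f) g)))"
proof -
  have kb: "bilinear_form H H (\<lambda>b c. kernel h f g a b c \<beta>)" if "a \<in> C" for a
    by (rule bilinear_map_comp[OF kernel_bilinear linear_map_eval]) (use that in simp_all)
  have ke: "kernel h f g a b c \<beta> = \<beta> (mul H (ai (ai b)) h) (mul Hd (act a c f) g)" for a b c
    by (simp add: kernel_def pure_tensor_apply[OF \<beta>])
  have inner: "tensor_lift H H D (kernel h f g a) (comul H b) \<beta> =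
      sw b (\<lambda>b c. kernel h f g a (al b) (al c) \<beta>)" if [simp]: "a \<in> C" "b \<in> C" for a b
    by (simp add: tensor_lift_eval[OF kernel_bilinear] comul_mem comul_sw kb sw_al)
  have ob: "bilinear_form H H (\<lambda>a b. tensor_lift H H D (kernel h f g a) (comul H b) \<beta>)"
    by (rule bilinear_map_comp[OF kernel_lift_bilinear linear_map_eval]) simp_all
  have "double_mul_pure H S h f k g \<beta> =
      sw k (\<lambda>a b. tensor_lift H H D (kernel h f g (al a)) (comul H (al b)) \<beta>)"
    unfolding double_mul_pure_kernel
    by (simp add: tensor_lift_eval[OF kernel_lift_bilinear] comul_mem comul_sw[OF _ ob] sw_al[OF _ ob])
  also have "\<dots> = sw k (\<lambda>k1 r. sw r (\<lambda>k2 k3. kernel h f g (al k1) (al (al k2)) (al (al k3)) \<beta>))"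
    by (simp add: inner sw_al kb bilinear_form_comp[OF kb al_linear al_linear])
  finally show ?thesis by (simp add: ke mul_um)
qed

definition dmul :: "('k, 'a) double \<Rightarrow> ('k, 'a) double \<Rightarrow> ('k, 'a) double" where
  "dmul t s = tensor_lift H Hd D (\<lambda>h f. tensor_lift H Hd D (\<lambda>k g. double_mul_pure H S h f k g) s) t"

lemma dmul_bilinear: "bilinear_map D D D dmul"
  and dmul_pure: "h \<in> C \<Longrightarrow> f \<in> C' \<Longrightarrow> k \<in> C \<Longrightarrow> g \<in> C' \<Longrightarrow>
    dmul (pt h f) (pt k g) = double_mul_pure H S h f k g"
  unfolding dmul_def
  using tensor_lift2_bilinear[OF H Hd is_vspace_tensor double_mul_pure_bilinear] by auto

section \<open>The untwisted double\<close>

text \<open>\<open>dtwist\<close> is the structure map of the double and \<open>umul\<close> the ordinary associative product of which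
  the product of the double is the twist by \<open>dtwist\<close>. In \<open>umul\<close> an element \<open>k\<close> acts on the dual through
  \<open>al k\<close>, so it is the untwisted double only up to the automorphism \<open>al\<close> in the pairing.\<close>

abbreviation Hd_twist where "Hd_twist \<equiv> twist Hd"

lemma Hd_twist_eq: "Hd_twist f = restr H (\<lambda>x. f (ai x))"
  by (simp add: dual_hom_def)

lemma Hd_twist_linear: "linear_map Hd Hd Hd_twist"
  and as_linear: "linear_map Hd Hd (alpha_star H)"
  unfolding Hd_twist_eq[abs_def] alpha_star_def[abs_def]
  by (rule linear_restr[OF Hd], auto intro: functional_Hd al_linear ai_linear functional_at)+

lemma Hd_twist_mem [simp]: "f \<in> C' \<Longrightarrow> Hd_twist f \<in> C'"
  and as_mem [simp]: "f \<in> C' \<Longrightarrow> alpha_star H f \<in> C'"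
  by (rule linear_map_mem[OF Hd_twist_linear] linear_map_mem[OF as_linear], assumption)+

lemma Hd_twist_apply [simp]: "x \<in> C \<Longrightarrow> Hd_twist f x = f (ai x)"
  and as_apply [simp]: "x \<in> C \<Longrightarrow> alpha_star H f x = f (al x)"
  by (simp_all add: Hd_twist_eq alpha_star_def)

lemma Hd_twist_as [simp]: "f \<in> C' \<Longrightarrow> Hd_twist (alpha_star H f) = f"
  by (rule Hd_eqI) simp_all

definition dtwist where "dtwist = tensor_map H Hd H Hd al Hd_twist"
definition dtwist_inv where "dtwist_inv = tensor_map H Hd H Hd ai (alpha_star H)"
definition umul where "umul s t = dtwist_inv (dmul s t)"

lemma dtwist_linear: "linear_map D D dtwist" and dtwist_inv_linear: "linear_map D D dtwist_inv"
  unfolding dtwist_def dtwist_inv_def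
  by (rule tensor_map_linear[OF H Hd al_linear Hd_twist_linear] tensor_map_linear[OF H Hd ai_linear as_linear])+

lemma dtwist_mem [simp]: "t \<in> vcarrier D \<Longrightarrow> dtwist t \<in> vcarrier D"
  and dtwist_inv_mem [simp]: "t \<in> vcarrier D \<Longrightarrow> dtwist_inv t \<in> vcarrier D"
  by (rule linear_map_mem[OF dtwist_linear] linear_map_mem[OF dtwist_inv_linear], assumption)+

lemma dtwist_pure: "h \<in> C \<Longrightarrow> f \<in> C' \<Longrightarrow> dtwist (pt h f) = pt (al h) (Hd_twist f)"
  and dtwist_inv_pure: "h \<in> C \<Longrightarrow> f \<in> C' \<Longrightarrow> dtwist_inv (pt h f) = pt (ai h) (alpha_star H f)"
  unfolding dtwist_def dtwist_inv_def
  by (rule tensor_map_pure[OF H Hd al_linear Hd_twist_linear] tensor_map_pure[OF H Hd ai_linear as_linear]; assumption)+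

lemma dtwist_dtwist_inv [simp]: "t \<in> vcarrier D \<Longrightarrow> dtwist (dtwist_inv t) = t"
  by (rule tensor_linear_eqI[OF is_vspace_tensor linear_map_comp[OF dtwist_inv_linear dtwist_linear] linear_map_id])
    (simp_all add: dtwist_pure dtwist_inv_pure)

lemma umul_bilinear: "bilinear_map D D D umul"
  unfolding umul_def[abs_def] by (rule bilinear_map_comp[OF dmul_bilinear dtwist_inv_linear])

lemma umul_mem [simp]: "s \<in> vcarrier D \<Longrightarrow> t \<in> vcarrier D \<Longrightarrow> umul s t \<in> vcarrier D"
  and dmul_mem: "s \<in> vcarrier D \<Longrightarrow> t \<in> vcarrier D \<Longrightarrow> dmul s t \<in> vcarrier D"
  by (rule bilinear_mem[OF umul_bilinear] bilinear_mem[OF dmul_bilinear], assumption+)+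

lemma dmul_umul: "s \<in> vcarrier D \<Longrightarrow> t \<in> vcarrier D \<Longrightarrow> dmul s t = dtwist (umul s t)"
  by (simp add: umul_def dmul_mem)

lemma dtest_dtwist: "t \<in> vcarrier D \<Longrightarrow> functional H \<phi> \<Longrightarrow> x \<in> C \<Longrightarrow> dtest \<phi> x (dtwist t) = dtest (\<lambda>h. \<phi> (al h)) (ai x) t"
  unfolding dtest_def dtwist_def
  by (subst tensor_map_eval[OF H Hd al_linear Hd_twist_linear]) (auto intro: bilinear_form_prod functional_at)

definition conj_conv :: "'a \<Rightarrow> 'a \<Rightarrow> ('a \<Rightarrow> 'k) \<Rightarrow> ('a \<Rightarrow> 'k) \<Rightarrow> 'a \<Rightarrow> 'k" where
  "conj_conv a b f g = restr H (\<lambda>x. sw x (\<lambda>p q. f (S a \<cdot> (p \<cdot> b)) * g q))"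

lemma conj_conv_apply: "x \<in> C \<Longrightarrow> conj_conv a b f g x = sw x (\<lambda>p q. f (S a \<cdot> (p \<cdot> b)) * g q)"
  by (simp add: conj_conv_def)

lemma conj_conv_mem [simp]: "f \<in> C' \<Longrightarrow> g \<in> C' \<Longrightarrow> a \<in> C \<Longrightarrow> b \<in> C \<Longrightarrow> conj_conv a b f g \<in> C'"
  unfolding conj_conv_def by (intro restr_mem functional_sw_arg linear_map_id)

lemma as_mul_act:
  assumes [simp]: "f \<in> C'" "g \<in> C'" "a \<in> C" "b \<in> C"
  shows "alpha_star H (mul Hd (act a (al b) f) g) = conj_conv a b f g"
proof (rule Hd_eqI)
  fix x assume "x \<in> C"
  then have "alpha_star H (mul Hd (act a (al b) f) g) x = sw x (\<lambda>p q. act a (al b) f p * g q)"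
    by (simp add: mul_Hd_apply)
  then show "alpha_star H (mul Hd (act a (al b) f) g) x = conj_conv a b f g x"
    using \<open>x \<in> C\<close> by (simp add: act_eq conj_conv_apply)
qed simp_all

lemma umul_pure_eval:
  assumes [simp]: "h \<in> C" "f \<in> C'" "k \<in> C" "g \<in> C'" and \<beta>: "bilinear_form H Hd \<beta>"
  shows "umul (pt h f) (pt k g) \<beta> =
    sw k (\<lambda>k1 r. sw r (\<lambda>k2 k3. \<beta> (k2 \<cdot> h) (conj_conv (al k1) (al k3) f g)))"
proof -
  have \<beta>': "bilinear_form H Hd (\<lambda>h f. \<beta> (ai h) (alpha_star H f))"
    by (intro bilinear_mapI functional_form_left[OF \<beta>] functional_form_right[OF \<beta>] as_linear ai_linear) simp_all
  have "umul (pt h f) (pt k g) \<beta> =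
      double_mul_pure H S h f k g (\<lambda>h f. \<beta> (ai h) (alpha_star H f))"
    unfolding umul_def dtwist_inv_def
    by (subst tensor_map_eval[OF H Hd ai_linear as_linear dmul_mem \<beta>]) (simp_all add: dmul_pure)
  also have "\<dots> = sw k (\<lambda>k1 r. sw r (\<lambda>k2 k3. \<beta> (k2 \<cdot> h) (conj_conv (al k1) (al k3) f g)))"
    by (simp add: double_mul_pure_eval[OF _ _ _ _ \<beta>'] as_mul_act)
  finally show ?thesis .
qed

text \<open>The product of two pure tensors seen through \<open>dtest\<close>. With tensors gone,
  the axioms of the double become statements about \<open>sw\<close>.\<close>

definition mul_test :: "'a \<Rightarrow> ('a \<Rightarrow> 'k) \<Rightarrow> 'a \<Rightarrow> ('a \<Rightarrow> 'k) \<Rightarrow> ('a \<Rightarrow> 'k) \<Rightarrow> 'a \<Rightarrow> 'k" where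
  "mul_test h f k g \<phi> x = sw k (\<lambda>k1 r. sw r (\<lambda>k2 k3. \<phi> (k2 \<cdot> h) *
     sw x (\<lambda>p q. f (S (al k1) \<cdot> (p \<cdot> al k3)) * g q)))"

lemma dtest_umul:
  assumes [simp]: "h \<in> C" "f \<in> C'" "k \<in> C" "g \<in> C'" "x \<in> C" and \<phi>: "functional H \<phi>"
  shows "dtest \<phi> x (umul (pt h f) (pt k g)) = mul_test h f k g \<phi> x"
  unfolding dtest_def mul_test_def
  by (simp add: umul_pure_eval bilinear_form_prod[OF \<phi> functional_at] conj_conv_apply)

end

section \<open>Sweedler identities for the untwisted double\<close>

context framed_hom_hopf begin

section \<open>Associativity of the untwisted product in Sweedler form\<close>

definition sw5 :: "'a \<Rightarrow> ('a \<Rightarrow> 'a \<Rightarrow> 'a \<Rightarrow> 'a \<Rightarrow> 'a \<Rightarrow> 'k) \<Rightarrow> 'k" where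
  "sw5 a \<tau> = sw a (\<lambda>v r. sw r (\<lambda>w s. sw s (\<lambda>x t. sw t (\<lambda>y z. \<tau> v w x y z))))"

text \<open>The two bracketings of a triple product split the last factor differently: one halves
  the outer two of three components, the other cuts the middle one in three. This lemma and
  \<open>sw5_inner\<close> bring both to one normal form.\<close>

lemma sw5_outer:
  assumes "a \<in> C"
  shows "sw a (\<lambda>x r. sw r (\<lambda>y z. sw x (\<lambda>x1 x2. sw z (\<lambda>z1 z2. \<tau> x1 x2 y z1 z2)))) = sw5 a \<tau>"
proof -
  have "sw a (\<lambda>x r. sw r (\<lambda>y z. sw x (\<lambda>x1 x2. sw z (\<lambda>z1 z2. \<tau> x1 x2 y z1 z2)))) =
      sw a (\<lambda>x r. sw x (\<lambda>x1 x2. sw r (\<lambda>y z. sw z (\<lambda>z1 z2. \<tau> x1 x2 y z1 z2))))"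
    by (intro sw_cong refl sw_swap)
  then show ?thesis using assms by (simp add: coassoc sw5_def)
qed

lemma sw5_inner:
  assumes "a \<in> C"
  shows "sw a (\<lambda>x r. sw r (\<lambda>y z. sw y (\<lambda>y1 t. sw t (\<lambda>y2 y3. \<tau> x y1 y2 y3 z)))) = sw5 a \<tau>"
  using assms by (simp add: coassoc sw5_def)

lemma sw_m3:
  assumes "a \<in> C" "b \<in> C"
    and W: "\<And>v w. v \<in> C \<Longrightarrow> w \<in> C \<Longrightarrow> functional H (\<lambda>x. W x v w)"
      "\<And>v w. v \<in> C \<Longrightarrow> w \<in> C \<Longrightarrow> functional H (\<lambda>x. W v x w)"
      "\<And>v w. v \<in> C \<Longrightarrow> w \<in> C \<Longrightarrow> functional H (\<lambda>x. W v w x)"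
  shows "sw (a \<cdot> b) (\<lambda>x r. sw r (\<lambda>y z. W x y z)) =
    sw b (\<lambda>b1 r. sw r (\<lambda>b2 b3. sw a (\<lambda>a1 s. sw s (\<lambda>a2 a3. W (a1 \<cdot> b1) (a2 \<cdot> b2) (a3 \<cdot> b3)))))"
proof -
  note [simp] = lin W assms(1,2)
  have "sw (a \<cdot> b) (\<lambda>x r. sw r (\<lambda>y z. W x y z)) =
      sw a (\<lambda>a1 s. sw b (\<lambda>b1 r. sw (s \<cdot> r) (\<lambda>y z. W (a1 \<cdot> b1) y z)))"
    by (rule sw_m) simp_all
  also have "\<dots> = sw a (\<lambda>a1 s. sw b (\<lambda>b1 r. sw s (\<lambda>a2 a3. sw r (\<lambda>b2 b3. W (a1 \<cdot> b1) (a2 \<cdot> b2) (a3 \<cdot> b3)))))"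
    by (intro sw_cong refl sw_m) simp_all
  also have "\<dots> = sw b (\<lambda>b1 r. sw a (\<lambda>a1 s. sw s (\<lambda>a2 a3. sw r (\<lambda>b2 b3. W (a1 \<cdot> b1) (a2 \<cdot> b2) (a3 \<cdot> b3)))))"
    by (rule sw_swap)
  also have "\<dots> = sw b (\<lambda>b1 r. sw a (\<lambda>a1 s. sw r (\<lambda>b2 b3. sw s (\<lambda>a2 a3. W (a1 \<cdot> b1) (a2 \<cdot> b2) (a3 \<cdot> b3)))))"
    by (intro sw_cong refl sw_swap)
  also have "\<dots> = sw b (\<lambda>b1 r. sw r (\<lambda>b2 b3. sw a (\<lambda>a1 s. sw s (\<lambda>a2 a3. W (a1 \<cdot> b1) (a2 \<cdot> b2) (a3 \<cdot> b3)))))"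
    by (intro sw_cong refl sw_swap)
  finally show ?thesis .
qed

text \<open>\<open>S\<close> reverses the coproduct, so the second component of \<open>a\<close>
  lands in the first leg. That \<open>al\<close> is a coalgebra map lets it pass to the
  components.\<close>

lemma sw_conj:
  assumes [simp]: "a \<in> C" "b \<in> C" "x \<in> C" and \<beta>: "bilinear_form H H \<beta>"
  shows "sw (S (al a) \<cdot> (x \<cdot> al b)) \<beta> = sw a (\<lambda>a1 a2. sw b (\<lambda>b1 b2. sw x (\<lambda>x1 x2.
    \<beta> (S (al a2) \<cdot> (x1 \<cdot> al b1)) (S (al a1) \<cdot> (x2 \<cdot> al b2)))))"
proof -
  have bl: "linear_map X H G \<Longrightarrow> w \<in> C \<Longrightarrow> functional X (\<lambda>x. \<beta> (G x) w)"
    and br: "linear_map X H G \<Longrightarrow> w \<in> C \<Longrightarrow> functional X (\<lambda>x. \<beta> w (G x))" for X :: "('k, 'a, 'm) hom_struct_scheme" and G w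
    using bilinear_left[OF \<beta>, of X G w] bilinear_right[OF \<beta>, of X G w] by simp_all
  note [simp] = linH bl br
  have "sw (S (al a) \<cdot> (x \<cdot> al b)) \<beta> = sw (S (al a)) (\<lambda>p q. sw (x \<cdot> al b) (\<lambda>s t. \<beta> (p \<cdot> s) (q \<cdot> t)))"
    by (rule sw_m[OF \<beta>]) simp_all
  also have "\<dots> = sw (al a) (\<lambda>p q. sw (x \<cdot> al b) (\<lambda>s t. \<beta> (S q \<cdot> s) (S p \<cdot> t)))"
    by (rule sw_S) simp_all
  also have "\<dots> = sw a (\<lambda>p q. sw (x \<cdot> al b) (\<lambda>s t. \<beta> (S (al q) \<cdot> s) (S (al p) \<cdot> t)))"
    by (rule sw_al) simp_all
  also have "\<dots> = sw a (\<lambda>p q. sw x (\<lambda>x1 x2. sw (al b) (\<lambda>s t. \<beta> (S (al q) \<cdot> (x1 \<cdot> s)) (S (al p) \<cdot> (x2 \<cdot> t)))))"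
    by (intro sw_cong refl sw_m) simp_all
  also have "\<dots> = sw a (\<lambda>p q. sw x (\<lambda>x1 x2. sw b (\<lambda>s t. \<beta> (S (al q) \<cdot> (x1 \<cdot> al s)) (S (al p) \<cdot> (x2 \<cdot> al t)))))"
    by (intro sw_cong refl sw_al) simp_all
  also have "\<dots> = sw a (\<lambda>p q. sw b (\<lambda>s t. sw x (\<lambda>x1 x2. \<beta> (S (al q) \<cdot> (x1 \<cdot> al s)) (S (al p) \<cdot> (x2 \<cdot> al t)))))"
    by (intro sw_cong refl sw_swap)
  finally show ?thesis .
qed

text \<open>\<open>T\<close> is the common integrand, with three components each of \<open>k\<close>
  and \<open>x\<close> and five of \<open>l\<close>. On the left, \<open>l\<close> acts on a
  convolution product and its outer legs are split by \<open>sw_conj\<close>; on the right, its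
  middle leg is multiplied into \<open>k\<close> and split by \<open>sw_m3\<close>. The factors
  match since \<open>S\<close> is anti-multiplicative and \<open>al\<close> multiplicative.\<close>

lemma mul_test_assoc:
  assumes f: "f \<in> C'" and g: "g \<in> C'" and p: "p \<in> C'" and \<phi>: "functional H \<phi>"
    and C [simp]: "h \<in> C" "k \<in> C" "l \<in> C" "x \<in> C"
  shows "sw k (\<lambda>k1 r. sw r (\<lambda>k2 k3. mul_test (k2 \<cdot> h) (conj_conv (al k1) (al k3) f g) l p \<phi> x)) =
    sw l (\<lambda>l1 s. sw s (\<lambda>l2 l3. mul_test h f (l2 \<cdot> k) (conj_conv (al l1) (al l3) g p) \<phi> x))"
proof -
  note [simp] = linH functional_Hd[OF f] functional_Hd[OF g] functional_Hd[OF p] linear_map_comp[OF _ \<phi>]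
  define T where "T k1 k2 k3 l1 l2 l3 l4 l5 x1 x2 x3 =
      \<phi> (l3 \<cdot> (k2 \<cdot> h)) * (f (S (al k1) \<cdot> ((S (al l2) \<cdot> (x1 \<cdot> al l4)) \<cdot> al k3)) * g (S (al l1) \<cdot> (x2 \<cdot> al l5)) * p x3)"
    for k1 k2 k3 l1 l2 l3 l4 l5 x1 x2 x3
  define N where "N k1 k2 k3 l1 l2 l3 l4 l5 = sw x (\<lambda>y x3. sw y (\<lambda>x1 x2. T k1 k2 k3 l1 l2 l3 l4 l5 x1 x2 x3))"
    for k1 k2 k3 l1 l2 l3 l4 l5
  have L: "mul_test (k2 \<cdot> h) (conj_conv (al k1) (al k3) f g) l p \<phi> x = sw5 l (N k1 k2 k3)"
    if [simp]: "k1 \<in> C" "k2 \<in> C" "k3 \<in> C" for k1 k2 k3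
  proof -
    have e: "conj_conv (al k1) (al k3) f g (S (al l1) \<cdot> (y \<cdot> al l3)) =
        sw l1 (\<lambda>la lb. sw l3 (\<lambda>lc ld. sw y (\<lambda>x1 x2. f (S (al k1) \<cdot> ((S (al lb) \<cdot> (x1 \<cdot> al lc)) \<cdot> al k3)) *
          g (S (al la) \<cdot> (x2 \<cdot> al ld)))))" if [simp]: "l1 \<in> C" "l3 \<in> C" "y \<in> C" for l1 l3 y
      by (subst conj_conv_apply, simp) (subst sw_conj; simp del: S_al)
    have "\<phi> (l2 \<cdot> (k2 \<cdot> h)) * sw x (\<lambda>y q. conj_conv (al k1) (al k3) f g (S (al l1) \<cdot> (y \<cdot> al l3)) * p q) =
      sw l1 (\<lambda>la lb. sw l3 (\<lambda>lc ld. N k1 k2 k3 la lb l2 lc ld))"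
      if [simp]: "l1 \<in> C" "l2 \<in> C" "l3 \<in> C" for l1 l2 l3
    proof -
      have "\<phi> (l2 \<cdot> (k2 \<cdot> h)) * sw x (\<lambda>y q. conj_conv (al k1) (al k3) f g (S (al l1) \<cdot> (y \<cdot> al l3)) * p q) =
        sw x (\<lambda>y q. sw l1 (\<lambda>la lb. sw l3 (\<lambda>lc ld. sw y (\<lambda>x1 x2. T k1 k2 k3 la lb l2 lc ld x1 x2 q))))"
        by (simp add: e sw_mult_left sw_mult_right T_def del: S_al)
      also have "\<dots> = sw l1 (\<lambda>la lb. sw x (\<lambda>y q. sw l3 (\<lambda>lc ld. sw y (\<lambda>x1 x2. T k1 k2 k3 la lb l2 lc ld x1 x2 q))))"
        by (rule sw_swap)
      also have "\<dots> = sw l1 (\<lambda>la lb. sw l3 (\<lambda>lc ld. N k1 k2 k3 la lb l2 lc ld))"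
        unfolding N_def by (intro sw_cong refl sw_swap)
      finally show ?thesis .
    qed
    then show ?thesis unfolding mul_test_def by (simp add: sw5_outer)
  qed
  have R: "mul_test h f (l2 \<cdot> k) (conj_conv (al l1) (al l3) g p) \<phi> x =
      sw k (\<lambda>k1 r. sw r (\<lambda>k2 k3. sw l2 (\<lambda>y1 t. sw t (\<lambda>y2 y3. N k1 k2 k3 l1 y1 y2 y3 l3))))"
    if [simp]: "l1 \<in> C" "l2 \<in> C" "l3 \<in> C" for l1 l2 l3
  proof -
    let ?W = "\<lambda>K1 K2 K3. \<phi> (K2 \<cdot> h) * sw x (\<lambda>x1 r. f (S (al K1) \<cdot> (x1 \<cdot> al K3)) * conj_conv (al l1) (al l3) g p r)"
    have "mul_test h f (l2 \<cdot> k) (conj_conv (al l1) (al l3) g p) \<phi> x =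
      sw k (\<lambda>k1 r. sw r (\<lambda>k2 k3. sw l2 (\<lambda>y1 t. sw t (\<lambda>y2 y3. ?W (y1 \<cdot> k1) (y2 \<cdot> k2) (y3 \<cdot> k3)))))"
      unfolding mul_test_def by (rule sw_m3) simp_all
    also have "\<dots> = sw k (\<lambda>k1 r. sw r (\<lambda>k2 k3. sw l2 (\<lambda>y1 t. sw t (\<lambda>y2 y3. N k1 k2 k3 l1 y1 y2 y3 l3))))"
    proof (intro sw_cong refl)
      fix k1 r k2 k3 y1 t y2 y3 assume [simp]: "k1 \<in> C" "k2 \<in> C" "k3 \<in> C" "y1 \<in> C" "y2 \<in> C" "y3 \<in> C"
      have "?W (y1 \<cdot> k1) (y2 \<cdot> k2) (y3 \<cdot> k3) = sw x (\<lambda>x1 r. sw r (\<lambda>x2 x3. T k1 k2 k3 l1 y1 y2 y3 l3 x1 x2 x3))"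
        by (simp add: conj_conv_apply sw_mult_left T_def al_um S_m assoc mult.assoc)
      then show "?W (y1 \<cdot> k1) (y2 \<cdot> k2) (y3 \<cdot> k3) = N k1 k2 k3 l1 y1 y2 y3 l3"
        by (simp add: N_def coassoc)
    qed
    finally show ?thesis .
  qed
  \<comment> \<open>From here on only the order of summation changes, until the sum over
    \<open>l\<close> is innermost and \<open>sw5_inner\<close> rebrackets it.\<close>
  have "sw l (\<lambda>l1 s. sw s (\<lambda>l2 l3. mul_test h f (l2 \<cdot> k) (conj_conv (al l1) (al l3) g p) \<phi> x)) =
      sw l (\<lambda>l1 s. sw s (\<lambda>l2 l3. sw k (\<lambda>k1 r. sw r (\<lambda>k2 k3. sw l2 (\<lambda>y1 t. sw t (\<lambda>y2 y3. N k1 k2 k3 l1 y1 y2 y3 l3))))))"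
    by (simp add: R)
  also have "\<dots> = sw l (\<lambda>l1 s. sw k (\<lambda>k1 r. sw s (\<lambda>l2 l3. sw r (\<lambda>k2 k3. sw l2 (\<lambda>y1 t. sw t (\<lambda>y2 y3. N k1 k2 k3 l1 y1 y2 y3 l3))))))"
    by (intro sw_cong refl sw_swap)
  also have "\<dots> = sw k (\<lambda>k1 r. sw l (\<lambda>l1 s. sw s (\<lambda>l2 l3. sw r (\<lambda>k2 k3. sw l2 (\<lambda>y1 t. sw t (\<lambda>y2 y3. N k1 k2 k3 l1 y1 y2 y3 l3))))))"
    by (rule sw_swap)
  also have "\<dots> = sw k (\<lambda>k1 r. sw l (\<lambda>l1 s. sw r (\<lambda>k2 k3. sw s (\<lambda>l2 l3. sw l2 (\<lambda>y1 t. sw t (\<lambda>y2 y3. N k1 k2 k3 l1 y1 y2 y3 l3))))))"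
    by (intro sw_cong refl sw_swap)
  also have "\<dots> = sw k (\<lambda>k1 r. sw r (\<lambda>k2 k3. sw l (\<lambda>l1 s. sw s (\<lambda>l2 l3. sw l2 (\<lambda>y1 t. sw t (\<lambda>y2 y3. N k1 k2 k3 l1 y1 y2 y3 l3))))))"
    by (intro sw_cong refl sw_swap)
  also have "\<dots> = sw k (\<lambda>k1 r. sw r (\<lambda>k2 k3. sw5 l (N k1 k2 k3)))"
    by (simp add: sw5_inner)
  finally show ?thesis by (simp add: L)
qed

text \<open>\<open>al\<close> is an automorphism of the untwisted structure commuting with
  \<open>S\<close>, so twisting all factors amounts to twisting the test. This is multiplicativity
  of \<open>dtwist\<close>.\<close>

lemma mul_test_al:
  assumes f: "f \<in> C'" and g: "g \<in> C'" and \<phi>: "functional H \<phi>"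
    and [simp]: "h \<in> C" "k \<in> C" "x \<in> C"
  shows "mul_test (al h) (Hd_twist f) (al k) (Hd_twist g) \<phi> x = mul_test h f k g (\<lambda>h. \<phi> (al h)) (ai x)"
proof -
  note [simp] = linH functional_Hd[OF f] functional_Hd[OF g] linear_map_comp[OF _ \<phi>]
  show ?thesis
    unfolding mul_test_def by (simp add: sw_al sw_ai al_um ai_um S_ai)
qed

section \<open>Unit and counit against the untwisted product\<close>

lemma unt_Hd_apply: "x \<in> C \<Longrightarrow> unt Hd x = counit H x"
  by (simp add: dual_hom_def)

lemma mul_test_unt_left:
  assumes g: "g \<in> C'" and \<phi>: "functional H \<phi>" and [simp]: "h \<in> C" "k \<in> C" "x \<in> C"
  shows "mul_test h (unt Hd) k g \<phi> x = \<phi> (k \<cdot> h) * g x"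
proof -
  note [simp] = linH functional_Hd[OF g] linear_map_comp[OF _ \<phi>]
  have 2: "sw x (\<lambda>p q. counit H p * g q) = g x" using g by (intro counit_left) (simp_all add: Hd_functional)
  have 3: "sw x (\<lambda>p q. counit H a * (counit H p * counit H b) * g q) = counit H a * counit H b * g x" for a b
  proof -
    have "sw x (\<lambda>p q. counit H a * (counit H p * counit H b) * g q) = counit H a * counit H b * sw x (\<lambda>p q. counit H p * g q)"
      unfolding sw_mult_left by (simp add: mult_ac)
    then show ?thesis by (simp only: 2)
  qed
  have 4: "sw r (\<lambda>k2 k3. counit H k3 * (counit H k1 * (\<phi> (k2 \<cdot> h) * g x))) = counit H k1 * (\<phi> (r \<cdot> h) * g x)" if "r \<in> C" for r k1
    using that by (intro counit_right) simp_all
  have 5: "sw k (\<lambda>k1 r. counit H k1 * (\<phi> (r \<cdot> h) * g x)) = \<phi> (k \<cdot> h) * g x"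
    by (intro counit_left) simp_all
  have "mul_test h (unt Hd) k g \<phi> x = sw k (\<lambda>k1 r. sw r (\<lambda>k2 k3. counit H k3 * (counit H k1 * (\<phi> (k2 \<cdot> h) * g x))))"
    unfolding mul_test_def by (simp add: unt_Hd_apply 3, simp add: mult_ac)
  then show ?thesis by (simp add: 4 5)
qed

lemma mul_test_unt_right:
  assumes f: "f \<in> C'" and g: "g \<in> C'" and \<phi>: "functional H \<phi>" and [simp]: "h \<in> C" "x \<in> C"
  shows "mul_test h f (unt H) g \<phi> x = \<phi> h * sw x (\<lambda>p q. f p * g q)"
proof -
  note [simp] = linH functional_Hd[OF f] functional_Hd[OF g] linear_map_comp[OF _ \<phi>]
  show ?thesis unfolding mul_test_def by (simp add: sw_u)
qed

text \<open>At the unit the convolution in \<open>x\<close> disappears, and the counit removes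
  \<open>k2\<close>. The remaining legs \<open>k1\<close> and \<open>k3\<close> become adjacent, so
  the antipode axiom applies after \<alpha>.\<close>

lemma mul_test_counit:
  assumes f: "f \<in> C'" and g: "g \<in> C'" and [simp]: "h \<in> C" "k \<in> C"
  shows "mul_test h f k g (counit H) (unt H) = counit H h * f (unt H) * (counit H k * g (unt H))"
proof -
  note [simp] = linH functional_Hd[OF f] functional_Hd[OF g]
  have 1: "sw r (\<lambda>k2 k3. counit H k2 * (c * f (al (S k1) \<cdot> al k3))) = c * f (al (S k1) \<cdot> al r)"
    if [simp]: "r \<in> C" "k1 \<in> C" for r k1 c
    by (intro counit_left) simp_all
  have 2: "sw k (\<lambda>k1 r. c * f (al (S k1) \<cdot> al r)) = counit H k * (c * f (unt H))" for c
    using antipode_left[of "\<lambda>x. c * f (al x)" k] by (simp add: al_um)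
  have "mul_test h f k g (counit H) (unt H) =
      sw k (\<lambda>k1 r. sw r (\<lambda>k2 k3. counit H k2 * (counit H h * g (unt H) * f (al (S k1) \<cdot> al k3))))"
    unfolding mul_test_def by (simp add: sw_u mult_ac)
  also have "\<dots> = sw k (\<lambda>k1 r. counit H h * g (unt H) * f (al (S k1) \<cdot> al r))"
    by (intro sw_cong refl 1)
  also have "\<dots> = counit H k * (counit H h * g (unt H) * f (unt H))" by (rule 2)
  finally show ?thesis by (simp add: mult_ac)
qed

text \<open>The core of the bialgebra axiom. The product of the two factors involves six components
  of \<open>k\<close>; the third and fourth meet as \<open>al k3 \<cdot> S (al k4)\<close> and
  cancel. The four that remain are those of the left side, where the middle one of three is split by
  the coproduct of \<open>H\<close>.\<close>

lemma mul_test_comul: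
  assumes f: "functional H f" and g: "functional H g" and \<phi>: "functional H \<phi>" and \<psi>: "functional H \<psi>"
    and C [simp]: "h \<in> C" "k \<in> C" "x \<in> C" "y \<in> C"
  shows "mul_test h f k g (\<lambda>h. sw h (\<lambda>a b. \<phi> a * \<psi> b)) (x \<cdot> y) =
    sw h (\<lambda>h1 h2. sw k (\<lambda>k' k''. sw k' (\<lambda>k1 r. sw r (\<lambda>k2 k3. sw x (\<lambda>x1 x2.
      sw k'' (\<lambda>k4 s. sw s (\<lambda>k5 k6. sw y (\<lambda>y1 y2. \<phi> (k2 \<cdot> h1) * \<psi> (k5 \<cdot> h2) *
        (f ((S (al k1) \<cdot> (x1 \<cdot> al k3)) \<cdot> (S (al k4) \<cdot> (y1 \<cdot> al k6))) * g (x2 \<cdot> y2))))))))))"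
proof -
  note [simp] = linH linear_map_comp[OF _ f] linear_map_comp[OF _ g] linear_map_comp[OF _ \<phi>] linear_map_comp[OF _ \<psi>]
  define T where "T k1 k2 k3 k4 h1 h2 = sw x (\<lambda>x1 x2. sw y (\<lambda>y1 y2. \<phi> (k2 \<cdot> h1) * \<psi> (k3 \<cdot> h2) *
      (f (S (al k1) \<cdot> (x1 \<cdot> y1 \<cdot> al k4)) * g (x2 \<cdot> y2))))" for k1 k2 k3 k4 h1 h2
  have L: "sw (kk \<cdot> h) (\<lambda>a b. \<phi> a * \<psi> b) * sw (x \<cdot> y) (\<lambda>p q. f (S (al k1) \<cdot> (p \<cdot> al k4)) * g q) =
      sw kk (\<lambda>k2 k3. sw h (\<lambda>h1 h2. T k1 k2 k3 k4 h1 h2))" if [simp]: "kk \<in> C" "k1 \<in> C" "k4 \<in> C" for kk k1 k4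
  proof -
    have "sw (kk \<cdot> h) (\<lambda>a b. \<phi> a * \<psi> b) = sw kk (\<lambda>k2 k3. sw h (\<lambda>h1 h2. \<phi> (k2 \<cdot> h1) * \<psi> (k3 \<cdot> h2)))"
      by (rule sw_m) simp_all
    moreover have "sw (x \<cdot> y) (\<lambda>p q. f (S (al k1) \<cdot> (p \<cdot> al k4)) * g q) =
        sw x (\<lambda>x1 x2. sw y (\<lambda>y1 y2. f (S (al k1) \<cdot> (x1 \<cdot> y1 \<cdot> al k4)) * g (x2 \<cdot> y2)))"
      by (rule sw_m) simp_all
    ultimately show ?thesis unfolding T_def by (simp only: sw_mult_right) (simp only: sw_mult_left)
  qed
  define U where "U k1 k2 k3 k4 k5 k6 h1 h2 = sw x (\<lambda>x1 x2. sw y (\<lambda>y1 y2. \<phi> (k2 \<cdot> h1) * \<psi> (k5 \<cdot> h2) *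
        (f ((S (al k1) \<cdot> (x1 \<cdot> al k3)) \<cdot> (S (al k4) \<cdot> (y1 \<cdot> al k6))) * g (x2 \<cdot> y2))))" for k1 k2 k3 k4 k5 k6 h1 h2
  have collapse: "sw w (\<lambda>k3 k4. sw t (\<lambda>k5 k6. U k1 k2 k3 k4 k5 k6 h1 h2)) =
      counit H w * sw t (\<lambda>k5 k6. T k1 k2 k5 k6 h1 h2)"
    if [simp]: "k1 \<in> C" "k2 \<in> C" "w \<in> C" "t \<in> C" "h1 \<in> C" "h2 \<in> C" for k1 k2 w t h1 h2
  proof -
    have "sw w (\<lambda>k3 k4. sw t (\<lambda>k5 k6. U k1 k2 k3 k4 k5 k6 h1 h2)) =
      sw t (\<lambda>k5 k6. sw w (\<lambda>k3 k4. U k1 k2 k3 k4 k5 k6 h1 h2))" by (rule sw_swap)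
    also have "\<dots> = sw t (\<lambda>k5 k6. counit H w * T k1 k2 k5 k6 h1 h2)"
    proof (intro sw_cong refl)
      fix k5 k6 assume [simp]: "k5 \<in> C" "k6 \<in> C"
      have "sw w (\<lambda>k3 k4. U k1 k2 k3 k4 k5 k6 h1 h2) = sw x (\<lambda>x1 x2. sw y (\<lambda>y1 y2. sw w (\<lambda>k3 k4. \<phi> (k2 \<cdot> h1) * \<psi> (k5 \<cdot> h2) *
        (f ((S (al k1) \<cdot> (x1 \<cdot> al k3)) \<cdot> (S (al k4) \<cdot> (y1 \<cdot> al k6))) * g (x2 \<cdot> y2)))))"
        unfolding U_def by (simp only: sw_swap[where a = w])
      also have "\<dots> = sw x (\<lambda>x1 x2. sw y (\<lambda>y1 y2. counit H w * (\<phi> (k2 \<cdot> h1) * \<psi> (k5 \<cdot> h2) *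
        (f (S (al k1) \<cdot> (x1 \<cdot> y1 \<cdot> al k6)) * g (x2 \<cdot> y2)))))"
      proof (intro sw_cong refl)
        fix x1 x2 y1 y2 assume [simp]: "x1 \<in> C" "x2 \<in> C" "y1 \<in> C" "y2 \<in> C"
        show "sw w (\<lambda>k3 k4. \<phi> (k2 \<cdot> h1) * \<psi> (k5 \<cdot> h2) *
            (f ((S (al k1) \<cdot> (x1 \<cdot> al k3)) \<cdot> (S (al k4) \<cdot> (y1 \<cdot> al k6))) * g (x2 \<cdot> y2))) =
          counit H w * (\<phi> (k2 \<cdot> h1) * \<psi> (k5 \<cdot> h2) * (f (S (al k1) \<cdot> (x1 \<cdot> y1 \<cdot> al k6)) * g (x2 \<cdot> y2)))"
          \<comment> \<open>The antipode axiom is used inside \<open>al z\<close>: as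
            \<open>al\<close> is multiplicative and commutes with \<open>S\<close>, the product of
            \<open>al k3\<close> with \<open>S (al k4)\<close> is \<open>al\<close> of a product to
            which the axiom applies.\<close>
          using antipode_right[of "\<lambda>z. \<phi> (k2 \<cdot> h1) * \<psi> (k5 \<cdot> h2) * (f (S (al k1) \<cdot> (x1 \<cdot> (al z \<cdot> (y1 \<cdot> al k6)))) * g (x2 \<cdot> y2))" w]
          by (simp add: assoc al_um)
      qed
      finally show "sw w (\<lambda>k3 k4. U k1 k2 k3 k4 k5 k6 h1 h2) = counit H w * T k1 k2 k5 k6 h1 h2"
        unfolding T_def by (simp only: sw_mult_left)
    qed
    finally show ?thesis by (simp only: sw_mult_left)
  qed
  have R: "sw k (\<lambda>k' k''. sw k' (\<lambda>k1 r. sw r (\<lambda>k2 k3. sw k'' (\<lambda>k4 s. sw s (\<lambda>k5 k6. U k1 k2 k3 k4 k5 k6 h1 h2))))) =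
      sw k (\<lambda>k1 r. sw r (\<lambda>k2 s. sw s (\<lambda>k3 k4. T k1 k2 k3 k4 h1 h2)))" if [simp]: "h1 \<in> C" "h2 \<in> C" for h1 h2
  proof -
    have "sw k (\<lambda>k' k''. sw k' (\<lambda>k1 r. sw r (\<lambda>k2 k3. sw k'' (\<lambda>k4 s. sw s (\<lambda>k5 k6. U k1 k2 k3 k4 k5 k6 h1 h2))))) =
      sw k (\<lambda>k1 r. sw r (\<lambda>k2 s. sw s (\<lambda>w t. sw w (\<lambda>k3 k4. sw t (\<lambda>k5 k6. U k1 k2 k3 k4 k5 k6 h1 h2)))))"
      by (simp add: coassoc)
    also have "\<dots> = sw k (\<lambda>k1 r. sw r (\<lambda>k2 s. sw s (\<lambda>w t. counit H w * sw t (\<lambda>k5 k6. T k1 k2 k5 k6 h1 h2))))"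
      by (intro sw_cong refl collapse) simp_all
    also have "\<dots> = sw k (\<lambda>k1 r. sw r (\<lambda>k2 s. sw s (\<lambda>k3 k4. T k1 k2 k3 k4 h1 h2)))"
      by (intro sw_cong refl counit_left) simp_all
    finally show ?thesis .
  qed
  have "mul_test h f k g (\<lambda>h. sw h (\<lambda>a b. \<phi> a * \<psi> b)) (x \<cdot> y) =
      sw k (\<lambda>k1 r. sw r (\<lambda>kk k4. sw kk (\<lambda>k2 k3. sw h (\<lambda>h1 h2. T k1 k2 k3 k4 h1 h2))))"
    unfolding mul_test_def by (intro sw_cong refl L)
  also have "\<dots> = sw k (\<lambda>k1 r. sw r (\<lambda>k2 s. sw s (\<lambda>k3 k4. sw h (\<lambda>h1 h2. T k1 k2 k3 k4 h1 h2))))"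
    by (intro sw_cong refl coassoc)
  also have "\<dots> = sw h (\<lambda>h1 h2. sw k (\<lambda>k1 r. sw r (\<lambda>k2 s. sw s (\<lambda>k3 k4. T k1 k2 k3 k4 h1 h2))))"
    by (simp only: sw_swap[where b = h])
  also have "\<dots> = sw h (\<lambda>h1 h2. sw k (\<lambda>k' k''. sw k' (\<lambda>k1 r. sw r (\<lambda>k2 k3. sw k'' (\<lambda>k4 s. sw s (\<lambda>k5 k6.
      U k1 k2 k3 k4 k5 k6 h1 h2))))))"
    by (intro sw_cong refl R[symmetric])
  also have "\<dots> = sw h (\<lambda>h1 h2. sw k (\<lambda>k' k''. sw k' (\<lambda>k1 r. sw r (\<lambda>k2 k3. sw x (\<lambda>x1 x2.
      sw k'' (\<lambda>k4 s. sw s (\<lambda>k5 k6. sw y (\<lambda>y1 y2. \<phi> (k2 \<cdot> h1) * \<psi> (k5 \<cdot> h2) *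
        (f ((S (al k1) \<cdot> (x1 \<cdot> al k3)) \<cdot> (S (al k4) \<cdot> (y1 \<cdot> al k6))) * g (x2 \<cdot> y2))))))))))"
    unfolding U_def by (simp only: sw_swap[where b = x])
  finally show ?thesis .
qed

section \<open>The coproduct of the double\<close>

definition dcomul :: "('k, 'a) double \<Rightarrow> ('k, ('k, 'a) double, ('k, 'a) double) tens" where
  "dcomul = tensor_lift H Hd (tensor D D) (double_comul_pure H)"

definition comul_kernel where
  "comul_kernel h1 h2 f1 f2 = pure_tensor D D (pt h1 f1) (pt h2 f2)"

lemma double_comul_pure_kernel:
  "double_comul_pure H h f = tensor_lift H H (tensor D D)
     (\<lambda>h1 h2. tensor_lift Hd Hd (tensor D D) (comul_kernel h1 h2) (comul Hd f)) (comul H h)"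
  by (simp add: double_comul_pure_def comul_kernel_def[abs_def] Let_def)

lemma comul_kernel_linear:
  assumes [simp]: "h1 \<in> C" "h2 \<in> C" "f1 \<in> C'" "f2 \<in> C'"
  shows "linear_map H (tensor D D) (\<lambda>h. comul_kernel h h2 f1 f2)"
    "linear_map H (tensor D D) (\<lambda>h. comul_kernel h1 h f1 f2)"
    "linear_map Hd (tensor D D) (\<lambda>f. comul_kernel h1 h2 f f2)"
    "linear_map Hd (tensor D D) (\<lambda>f. comul_kernel h1 h2 f1 f)"
  unfolding comul_kernel_def
  by (simp_all add: bilinear_left[OF bilinear_map_pure_tensor[OF is_vspace_tensor is_vspace_tensor]]
      bilinear_right[OF bilinear_map_pure_tensor[OF is_vspace_tensor is_vspace_tensor]]
      pure_left pure_right linear_map_id)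

lemma comul_kernel_bilinear:
  "h1 \<in> C \<Longrightarrow> h2 \<in> C \<Longrightarrow> bilinear_map Hd Hd (tensor D D) (comul_kernel h1 h2)"
  by (simp add: bilinear_map_def comul_kernel_linear)

lemma comul_kernel_lift_bilinear:
  assumes "f \<in> C'"
  shows "bilinear_map H H (tensor D D) (\<lambda>h1 h2. tensor_lift Hd Hd (tensor D D) (comul_kernel h1 h2) (comul Hd f))"
  by (intro bilinear_mapI linear_map_tensor_lift_param[OF is_vspace_tensor H])
    (simp_all add: comul_kernel_bilinear comul_kernel_linear comul_Hd_char assms)

lemma double_comul_pure_bilinear: "bilinear_map H Hd (tensor D D) (double_comul_pure H)"
  unfolding double_comul_pure_kernel
proof (rule bilinear_mapI)
  show "linear_map Hd (tensor D D) (\<lambda>f. tensor_lift H H (tensor D D)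
     (\<lambda>h1 h2. tensor_lift Hd Hd (tensor D D) (comul_kernel h1 h2) (comul Hd f)) (comul H h))" if "h \<in> C" for h
    by (rule linear_map_tensor_lift_param[OF is_vspace_tensor Hd])
      (simp_all add: comul_kernel_lift_bilinear comul_mem that comul_kernel_bilinear
        linear_map_comp[OF comul_Hd_linear tensor_lift_linear[OF is_vspace_tensor]])
  show "linear_map H (tensor D D) (\<lambda>h. tensor_lift H H (tensor D D)
     (\<lambda>h1 h2. tensor_lift Hd Hd (tensor D D) (comul_kernel h1 h2) (comul Hd f)) (comul H h))"
    if "f \<in> C'" for f
    by (rule linear_map_comp[OF comul_linear tensor_lift_linear[OF is_vspace_tensor comul_kernel_lift_bilinear[OF that]]])
qed

lemma dcomul_linear: "linear_map D (tensor D D) dcomul"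
  unfolding dcomul_def by (rule tensor_lift_linear[OF is_vspace_tensor double_comul_pure_bilinear])

lemma dcomul_mem [simp]: "t \<in> vcarrier D \<Longrightarrow> dcomul t \<in> vcarrier (tensor D D)"
  by (rule linear_map_mem[OF dcomul_linear])

lemma dcomul_pure_eval:
  assumes h [simp]: "h \<in> C" and f [simp]: "f \<in> C'" and \<beta>: "bilinear_form D D \<beta>"
  shows "dcomul (pt h f) \<beta> =
    sw (al h) (\<lambda>h1 h2. dual_split f (\<lambda>f1 f2. \<beta> (pt h1 f1) (pt h2 f2)))"
proof -
  have ke: "comul_kernel h1 h2 f1 f2 \<beta> = \<beta> (pt h1 f1) (pt h2 f2)" for h1 h2 f1 f2
    by (simp add: comul_kernel_def pure_tensor_apply[OF \<beta>])
  have "tensor_lift Hd Hd (tensor D D) (comul_kernel h1 h2) (comul Hd f) \<beta> =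
      dual_split f (\<lambda>f1 f2. comul_kernel h1 h2 f1 f2 \<beta>)" if "h1 \<in> C" "h2 \<in> C" for h1 h2
  proof -
    have "bilinear_form Hd Hd (\<lambda>f1 f2. comul_kernel h1 h2 f1 f2 \<beta>)"
      by (rule bilinear_map_comp[OF comul_kernel_bilinear[OF that] linear_map_eval])
    then show ?thesis by (simp add: tensor_lift_eval[OF comul_kernel_bilinear[OF that]] comul_Hd_char)
  qed
  moreover have "dcomul (pt h f) \<beta> =
      sw (al h) (\<lambda>h1 h2. tensor_lift Hd Hd (tensor D D) (comul_kernel h1 h2) (comul Hd f) \<beta>)"
    unfolding dcomul_def
    by (simp add: tensor_lift_pure[OF is_vspace_tensor double_comul_pure_bilinear] double_comul_pure_kernel
      tensor_lift_eval[OF comul_kernel_lift_bilinear] comul_mem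
      comul_sw[OF h bilinear_map_comp[OF comul_kernel_lift_bilinear[OF f] linear_map_eval]])
  ultimately show ?thesis by (simp add: ke)
qed

lemma functional_comul_prod:
  "functional H \<phi> \<Longrightarrow> functional H \<psi> \<Longrightarrow> functional H (\<lambda>h. sw (al h) (\<lambda>p q. \<phi> p * \<psi> q))"
  by (intro functional_sw_arg al_linear)

text \<open>The coproduct of the dual is transpose to multiplication of points, that of
  \<open>H\<close> to the convolution of functionals. The \<open>al\<close> and the
  \<open>ai\<close> say that \<open>dcomul\<close> is the untwisted coproduct after
  \<open>dtwist\<close>.\<close>

lemma dcomul_dtest:
  assumes t: "t \<in> vcarrier D" and \<phi>: "functional H \<phi>" and \<psi>: "functional H \<psi>" and [simp]: "x \<in> C" "y \<in> C"
  shows "dcomul t (\<lambda>a b. dtest \<phi> x a * dtest \<psi> y b) = dtest (\<lambda>h. sw (al h) (\<lambda>p q. \<phi> p * \<psi> q)) (ai (x \<cdot> y)) t"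
proof (rule tensor_linear_eqI[OF is_vspace_ground _ dtest_functional t])
  show "functional D (\<lambda>t. dcomul t (\<lambda>a b. dtest \<phi> x a * dtest \<psi> y b))"
    by (rule linear_map_comp[OF dcomul_linear linear_map_eval])
  fix h f assume [simp]: "h \<in> C" "f \<in> C'"
  have "dcomul (pt h f) (\<lambda>a b. dtest \<phi> x a * dtest \<psi> y b) =
    sw (al h) (\<lambda>h1 h2. dual_split f (\<lambda>f1 f2. \<phi> h1 * \<psi> h2 * (f1 x * f2 y)))"
    by (simp add: dcomul_pure_eval bilinear_form_prod dtest_functional dtest_pure \<phi> \<psi> mult_ac)
  also have "\<dots> = sw (al h) (\<lambda>h1 h2. \<phi> h1 * \<psi> h2) * f (ai (x \<cdot> y))"
    by (simp add: dual_split_prod sw_mult_right)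
  finally show "dcomul (pt h f) (\<lambda>a b. dtest \<phi> x a * dtest \<psi> y b) =
      dtest (\<lambda>h. sw (al h) (\<lambda>p q. \<phi> p * \<psi> q)) (ai (x \<cdot> y)) (pt h f)"
    by (simp add: dtest_pure functional_comul_prod \<phi> \<psi>)
qed

end

section \<open>The Drinfel'd double is a Hom-Hopf algebra\<close>

context framed_hom_hopf begin

section \<open>From scalar identities to the algebra structure\<close>

lemma dtest_cong:
  assumes "t \<in> vcarrier D" "functional H \<phi>" "\<And>h. h \<in> C \<Longrightarrow> \<phi> h = \<phi>' h"
  shows "dtest \<phi> x t = dtest \<phi>' x t"
  unfolding dtest_def
  by (rule tensor_form_cong[OF H Hd bilinear_form_prod[OF assms(2) functional_at] assms(1)]) (simp add: assms(3))

lemma umul_eval: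
  assumes \<theta>: "functional D \<theta>" and [simp]: "h \<in> C" "f \<in> C'" "k \<in> C" "g \<in> C'"
  shows "\<theta> (umul (pt h f) (pt k g)) =
    sw k (\<lambda>k1 r. sw r (\<lambda>k2 k3. \<theta> (pt (k2 \<cdot> h) (conj_conv (al k1) (al k3) f g))))"
  by (simp add: tensor_apply_functional[OF H Hd \<theta>]
      umul_pure_eval bilinear_map_comp[OF bilinear_map_pure_tensor[OF H Hd] \<theta>])

lemma functional_umul_left: "functional D \<theta> \<Longrightarrow> linear_map X D G \<Longrightarrow> s \<in> vcarrier D \<Longrightarrow> functional X (\<lambda>t. \<theta> (umul (G t) s))"
  by (rule linear_map_comp[OF bilinear_left[OF umul_bilinear]])

lemma functional_umul_right: "functional D \<theta> \<Longrightarrow> linear_map X D G \<Longrightarrow> s \<in> vcarrier D \<Longrightarrow> functional X (\<lambda>t. \<theta> (umul s (G t)))"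
  by (rule linear_map_comp[OF bilinear_right[OF umul_bilinear]])

lemma umul_assoc:
  assumes s: "s \<in> vcarrier D" and t: "t \<in> vcarrier D" and r: "r \<in> vcarrier D"
  shows "umul (umul s t) r = umul s (umul t r)"
proof -
  note L = bilinear_left[OF umul_bilinear] and R = bilinear_right[OF umul_bilinear]
  have pure: "umul (umul (pt h f) (pt k g)) (pt l p) =
      umul (pt h f) (umul (pt k g) (pt l p))"
    if [simp]: "h \<in> C" "k \<in> C" "l \<in> C" "f \<in> C'" "g \<in> C'" "p \<in> C'" for h f k g l p
  proof (rule D_eqI)
    fix \<phi> x assume \<phi>: "functional H \<phi>" and [simp]: "x \<in> C"
    have 1: "functional D (\<lambda>s. dtest \<phi> x (umul s (pt l p)))"
      and 2: "functional D (\<lambda>s. dtest \<phi> x (umul (pt h f) s))"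
      by (rule functional_umul_left[OF dtest_functional linear_map_id] functional_umul_right[OF dtest_functional linear_map_id]; simp)+
    have "dtest \<phi> x (umul (umul (pt h f) (pt k g)) (pt l p)) =
      sw k (\<lambda>k1 r. sw r (\<lambda>k2 k3. mul_test (k2 \<cdot> h) (conj_conv (al k1) (al k3) f g) l p \<phi> x))"
      by (simp add: umul_eval[OF 1] dtest_umul \<phi>)
    also have "\<dots> = sw l (\<lambda>l1 s. sw s (\<lambda>l2 l3. mul_test h f (l2 \<cdot> k) (conj_conv (al l1) (al l3) g p) \<phi> x))"
      by (rule mul_test_assoc) (simp_all add: \<phi>)
    also have "\<dots> = dtest \<phi> x (umul (pt h f) (umul (pt k g) (pt l p)))"
      by (simp add: umul_eval[OF 2] dtest_umul \<phi>)
    finally show "dtest \<phi> x (umul (umul (pt h f) (pt k g)) (pt l p)) =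
      dtest \<phi> x (umul (pt h f) (umul (pt k g) (pt l p)))" .
  qed simp_all
  \<comment> \<open>The identity for pure tensors is extended by linearity one factor at a time,
    starting with the last.\<close>
  have 1: "umul (umul (pt h f) (pt k g)) r =
      umul (pt h f) (umul (pt k g) r)"
    if [simp]: "h \<in> C" "k \<in> C" "f \<in> C'" "g \<in> C'" for h f k g
    by (rule tensor_linear_eqI[OF is_vspace_tensor R[OF linear_map_id] R[OF R[OF linear_map_id]] r])
      (simp_all add: pure)
  have 2: "umul (umul (pt h f) t) r = umul (pt h f) (umul t r)"
    if [simp]: "h \<in> C" "f \<in> C'" for h f
    by (rule tensor_linear_eqI[OF is_vspace_tensor L[OF R[OF linear_map_id]] R[OF L[OF linear_map_id]] t])
      (simp_all add: r 1)
  show ?thesis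
    by (rule tensor_linear_eqI[OF is_vspace_tensor L[OF L[OF linear_map_id]] L[OF linear_map_id] s])
      (simp_all add: r t 2)
qed

lemma dtwist_umul:
  assumes s: "s \<in> vcarrier D" and t: "t \<in> vcarrier D"
  shows "dtwist (umul s t) = umul (dtwist s) (dtwist t)"
proof -
  note L = bilinear_left[OF umul_bilinear] and R = bilinear_right[OF umul_bilinear]
  have pure: "dtwist (umul (pt h f) (pt k g)) =
      umul (dtwist (pt h f)) (dtwist (pt k g))"
    if [simp]: "h \<in> C" "k \<in> C" "f \<in> C'" "g \<in> C'" for h f k g
  proof (rule D_eqI)
    fix \<phi> x assume \<phi>: "functional H \<phi>" and [simp]: "x \<in> C"
    have "functional H (\<lambda>h. \<phi> (al h))" by (rule linear_map_comp[OF al_linear \<phi>])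
    then show "dtest \<phi> x (dtwist (umul (pt h f) (pt k g))) =
      dtest \<phi> x (umul (dtwist (pt h f)) (dtwist (pt k g)))"
      by (simp add: dtest_dtwist \<phi> dtest_umul dtwist_pure mul_test_al)
  qed simp_all
  have 1: "dtwist (umul (pt h f) t) = umul (dtwist (pt h f)) (dtwist t)"
    if [simp]: "h \<in> C" "f \<in> C'" for h f
    by (rule tensor_linear_eqI[OF is_vspace_tensor linear_map_comp[OF R[OF linear_map_id] dtwist_linear]
      R[OF dtwist_linear] t]) (simp_all add: pure)
  show ?thesis
    by (rule tensor_linear_eqI[OF is_vspace_tensor linear_map_comp[OF L[OF linear_map_id] dtwist_linear]
      L[OF dtwist_linear] s]) (simp_all add: t 1)
qed

lemma unt_Hd_mem [simp]: "unt Hd \<in> C'"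
proof -
  have "unt Hd = restr H (counit H)" by (simp add: dual_hom_def)
  then show ?thesis by (simp add: restr_mem eps_linear)
qed

definition dunit where "dunit = pt (unt H) (unt Hd)"

lemma dunit_mem [simp]: "dunit \<in> vcarrier D"
  by (simp add: dunit_def)

text \<open>With \<open>g\<close> the dual unit this embeds \<open>H\<close> with reversed product;
  with \<open>h\<close> arbitrary and \<open>k\<close> the unit it factors a pure tensor into its
  two components, which drives the antipode computation.\<close>

lemma umul_unt_left:
  assumes [simp]: "h \<in> C" "k \<in> C" "g \<in> C'"
  shows "umul (pt h (unt Hd)) (pt k g) = pt (k \<cdot> h) g"
  by (rule D_eqI) (simp_all add: dtest_umul mul_test_unt_left dtest_pure)

definition conv where "conv f g = restr H (\<lambda>x. sw x (\<lambda>p q. f p * g q))"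

lemma conv_mem [simp]: "conv f g \<in> C'"
  unfolding conv_def by (intro restr_mem functional_sw_arg linear_map_id)

lemma conv_apply: "x \<in> C \<Longrightarrow> conv f g x = sw x (\<lambda>p q. f p * g q)"
  by (simp add: conv_def)

lemma umul_unt_right:
  assumes [simp]: "h \<in> C" "f \<in> C'" "g \<in> C'"
  shows "umul (pt h f) (pt (unt H) g) = pt h (conv f g)"
  by (rule D_eqI) (simp_all add: dtest_umul mul_test_unt_right dtest_pure conv_apply)

lemma conv_unt [simp]:
  assumes "f \<in> C'"
  shows "conv f (unt Hd) = f" "conv (unt Hd) f = f"
proof -
  note f = Hd_functional[OF assms]
  show "conv f (unt Hd) = f"
    by (rule Hd_eqI) (simp_all add: conv_apply assms unt_Hd_apply counit_right[OF f] mult.commute[of "f _"])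
  show "conv (unt Hd) f = f"
    by (rule Hd_eqI) (simp_all add: conv_apply assms unt_Hd_apply counit_left[OF f])
qed

lemma umul_dunit:
  assumes "t \<in> vcarrier D"
  shows "umul dunit t = t" "umul t dunit = t"
  unfolding dunit_def
  by (rule tensor_linear_eqI[OF is_vspace_tensor bilinear_right[OF umul_bilinear linear_map_id] linear_map_id assms]
      tensor_linear_eqI[OF is_vspace_tensor bilinear_left[OF umul_bilinear linear_map_id] linear_map_id assms];
      simp add: umul_unt_left umul_unt_right)+

lemma dtwist_dunit [simp]: "dtwist dunit = dunit"
proof -
  have "Hd_twist (unt Hd) = unt Hd" by (rule Hd_eqI) (simp_all add: unt_Hd_apply)
  then show ?thesis by (simp add: dunit_def dtwist_pure)
qed

definition dcounit :: "('k, 'a) double \<Rightarrow> 'k" where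
  "dcounit = tensor_lift H Hd ground (\<lambda>h f. counit H h * f (unt H))"

lemma dcounit_linear: "functional D dcounit"
  unfolding dcounit_def by (rule tensor_lift_linear[OF is_vspace_ground bilinear_form_prod[OF eps_linear functional_at]])

lemma dcounit_dtest: "t \<in> vcarrier D \<Longrightarrow> dcounit t = dtest (counit H) (unt H) t"
  unfolding dcounit_def dtest_def by (rule tensor_lift_ground[OF bilinear_form_prod[OF eps_linear functional_at]])

lemma dtest_dmul: "functional H \<phi> \<Longrightarrow> s \<in> vcarrier D \<Longrightarrow> t \<in> vcarrier D \<Longrightarrow> x \<in> C \<Longrightarrow>
    dtest \<phi> x (dmul s t) = dtest (\<lambda>h. \<phi> (al h)) (ai x) (umul s t)"
  by (simp add: dmul_umul dtest_dtwist)

lemma dcounit_dtwist: "t \<in> vcarrier D \<Longrightarrow> dcounit (dtwist t) = dcounit t"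
  by (simp add: dcounit_dtest dtest_dtwist eps_linear) (rule dtest_cong, simp_all add: linear_map_comp[OF al_linear eps_linear])

lemma dcounit_umul:
  assumes s: "s \<in> vcarrier D" and t: "t \<in> vcarrier D"
  shows "dcounit (umul s t) = dcounit s * dcounit t"
proof -
  have pure: "dcounit (umul (pt h f) (pt k g)) = dcounit (pt h f) * dcounit (pt k g)"
    if [simp]: "h \<in> C" "k \<in> C" "f \<in> C'" "g \<in> C'" for h f k g
    by (simp add: dcounit_dtest dtest_umul eps_linear dtest_pure mul_test_counit)
  have 1: "dcounit (umul (pt h f) t) = dcounit (pt h f) * dcounit t"
    if [simp]: "h \<in> C" "f \<in> C'" for h f
    by (rule tensor_linear_eqI[OF is_vspace_ground functional_umul_right[OF dcounit_linear linear_map_id]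
      functional_mult(1)[OF dcounit_linear] t]) (simp_all add: pure)
  show ?thesis
    by (rule tensor_linear_eqI[OF is_vspace_ground functional_umul_left[OF dcounit_linear linear_map_id]
      functional_mult(2)[OF dcounit_linear] s]) (simp_all add: t 1)
qed

lemma dcounit_dunit: "dcounit dunit = 1"
  by (simp add: dcounit_dtest) (simp add: dunit_def dtest_pure eps_linear unt_Hd_apply)

abbreviation Dbl where "Dbl \<equiv> drinfeld_double H S"

lemma Dbl_simps:
  "vcarrier Dbl = vcarrier D" "smult Dbl = fscale" "mul Dbl = dmul" "unt Dbl = dunit" "comul Dbl = dcomul"
  "counit Dbl = dcounit" "twist Dbl = dtwist"
  by (simp_all add: drinfeld_double_def Let_def dmul_def[abs_def] dunit_def dcomul_def dcounit_def dtwist_def)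

lemma Dbl_linear:
  "linear_map Dbl Dbl F = linear_map D D F" "functional Dbl \<theta> = functional D \<theta>"
  "linear_map Dbl (tensor D D) G = linear_map D (tensor D D) G"
  by (rule linear_map_vspace_cong; simp add: Dbl_simps)+

lemma tensor_Dbl: "tensor Dbl Dbl = tensor D D" "pure_tensor Dbl Dbl = pure_tensor D D"
  "tensor Dbl (tensor D D) = tensor D (tensor D D)"
  by (rule tensor_vspace_cong; simp add: Dbl_simps)+

lemma Dbl_vspace: "is_vspace Dbl"
  using is_vspace_tensor[of H Hd] by (simp add: is_vspace_def Dbl_simps)

lemma dmul_bilinear_Dbl: "bilinear_map Dbl Dbl Dbl (mul Dbl)"
  using bilinear_map_vspace_cong[where V = Dbl and V' = D and W = Dbl and W' = D and U = Dbl and U' = D and f = dmul] dmul_bilinear by (simp add: Dbl_simps)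

text \<open>The twisting principle: if \<open>dtwist\<close> is multiplicative for the associative
  unital \<open>umul\<close>, then both sides of Hom-associativity are \<open>dtwist\<close> applied
  twice to one triple product, and multiplying by the unit gives \<open>dtwist\<close>.\<close>

lemma hom_algebra_Dbl: "hom_algebra Dbl"
  unfolding hom_algebra_def Dbl_linear
proof (intro conjI ballI)
  show "bilinear_map Dbl Dbl Dbl (mul Dbl)" by (rule dmul_bilinear_Dbl)
  show "is_vspace Dbl" by (rule Dbl_vspace)
  show "linear_map D D (twist Dbl)" by (simp add: Dbl_simps dtwist_linear)
qed (simp_all add: Dbl_simps dmul_umul dtwist_umul umul_dunit umul_assoc)

section \<open>Coalgebra axioms of the double\<close>

lemma dcomul_dtwist:
  assumes c [simp]: "c \<in> vcarrier D"
  shows "tensor_map Dbl Dbl Dbl Dbl dtwist dtwist (dcomul c) = dcomul (dtwist c)"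
proof (rule tensor_DD_eqI)
  note g = dtwist_linear[folded Dbl_linear]
  show "tensor_map Dbl Dbl Dbl Dbl dtwist dtwist (dcomul c) \<in> vcarrier (tensor D D)"
    using linear_map_mem[OF tensor_map_linear[OF Dbl_vspace Dbl_vspace g g], of "dcomul c"] by (simp add: tensor_Dbl)
  fix \<phi> x \<psi> y assume \<phi>: "functional H \<phi>" and \<psi>: "functional H \<psi>" and [simp]: "x \<in> C" "y \<in> C"
  have \<phi>': "functional H (\<lambda>h. \<phi> (al h))" and \<psi>': "functional H (\<lambda>h. \<psi> (al h))"
    using \<phi> \<psi> al_linear by (auto intro: linear_map_comp)
  have "tensor_map Dbl Dbl Dbl Dbl dtwist dtwist (dcomul c) (\<lambda>a b. dtest \<phi> x a * dtest \<psi> y b) =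
      dcomul c (\<lambda>a b. dtest \<phi> x (dtwist a) * dtest \<psi> y (dtwist b))"
    by (rule tensor_map_eval[OF Dbl_vspace Dbl_vspace g g])
      (simp_all add: tensor_Dbl bilinear_form_prod Dbl_linear dtest_functional)
  also have "\<dots> = dcomul c (\<lambda>a b. dtest (\<lambda>h. \<phi> (al h)) (ai x) a * dtest (\<lambda>h. \<psi> (al h)) (ai y) b)"
    by (rule tensor_form_cong[OF is_vspace_tensor is_vspace_tensor bilinear_form_prod[OF
          linear_map_comp[OF dtwist_linear dtest_functional] linear_map_comp[OF dtwist_linear dtest_functional]]])
      (simp_all add: dtest_dtwist \<phi> \<psi>)
  also have "\<dots> = dtest (\<lambda>h. sw (al h) (\<lambda>p q. \<phi> (al p) * \<psi> (al q))) (ai (ai x \<cdot> ai y)) c"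
    by (simp add: dcomul_dtest \<phi>' \<psi>')
  also have "\<dots> = dtest (\<lambda>h. sw (al (al h)) (\<lambda>p q. \<phi> p * \<psi> q)) (ai (ai (x \<cdot> y))) c"
    unfolding ai_um[OF \<open>x \<in> C\<close> \<open>y \<in> C\<close>]
    by (rule dtest_cong) (simp_all add: functional_comul_prod \<phi>' \<psi>' sw_al bilinear_form_prod \<phi> \<psi>)
  also have "\<dots> = dcomul (dtwist c) (\<lambda>a b. dtest \<phi> x a * dtest \<psi> y b)"
    by (simp add: dcomul_dtest \<phi> \<psi> dtest_dtwist functional_comul_prod)
  finally show "tensor_map Dbl Dbl Dbl Dbl dtwist dtwist (dcomul c) (\<lambda>a b. dtest \<phi> x a * dtest \<psi> y b) =
      dcomul (dtwist c) (\<lambda>a b. dtest \<phi> x a * dtest \<psi> y b)" .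
qed simp_all

lemma dcomul_counit:
  assumes c [simp]: "c \<in> vcarrier D"
  shows "tensor_lift Dbl Dbl Dbl (\<lambda>x y. fscale (dcounit x) y) (dcomul c) = dtwist c"
    and "tensor_lift Dbl Dbl Dbl (\<lambda>x y. fscale (dcounit y) x) (dcomul c) = dtwist c"
proof -
  interpret v: vector_space "smult Dbl" by (rule vspace_vector_space[OF Dbl_vspace])
  have co: "linear_map Dbl ground dcounit" using dcounit_linear by (simp add: Dbl_linear)
  have cm: "dcomul c \<in> vcarrier (tensor Dbl Dbl)" by (simp add: tensor_Dbl)
  have b: "bilinear_map Dbl Dbl Dbl (\<lambda>x y. smult Dbl (dcounit x) y)" "bilinear_map Dbl Dbl Dbl (\<lambda>x y. smult Dbl (dcounit y) x)"
    using co vspace_smult[OF Dbl_vspace]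
    by (auto simp: bilinear_map_def linear_map_def v.scale_right_distrib v.scale_left_distrib mult.commute)
  note b' = b[unfolded Dbl_simps]
  have m: "tensor_lift Dbl Dbl Dbl (\<lambda>x y. fscale (dcounit x) y) (dcomul c) \<in> vcarrier D"
    "tensor_lift Dbl Dbl Dbl (\<lambda>x y. fscale (dcounit y) x) (dcomul c) \<in> vcarrier D"
    using linear_map_mem[OF tensor_lift_linear[OF Dbl_vspace b'(1)] cm]
      linear_map_mem[OF tensor_lift_linear[OF Dbl_vspace b'(2)] cm] by (simp_all add: Dbl_simps)
  have sc: "dtest \<phi> x (fscale r t) = r * dtest \<phi> x t" for \<phi> x r t by (simp add: dtest_def fscale_def)
  show "tensor_lift Dbl Dbl Dbl (\<lambda>x y. fscale (dcounit x) y) (dcomul c) = dtwist c"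
  proof (rule D_eqI[OF m(1)])
    fix \<phi> x assume \<phi>: "functional H \<phi>" and [simp]: "x \<in> C"
    have \<phi>': "functional H (\<lambda>h. \<phi> (al h))" using \<phi> al_linear by (auto intro: linear_map_comp)
    have "dtest \<phi> x (tensor_lift Dbl Dbl Dbl (\<lambda>x y. fscale (dcounit x) y) (dcomul c)) =
        dcomul c (\<lambda>a b. dtest \<phi> x (fscale (dcounit a) b))"
      by (rule tensor_lift_apply[OF Dbl_vspace b'(1) _ cm]) (simp add: Dbl_linear dtest_functional)
    also have "\<dots> = dcomul c (\<lambda>a b. dcounit a * dtest \<phi> x b)" by (simp only: sc)
    also have "\<dots> = dcomul c (\<lambda>a b. dtest (counit H) (unt H) a * dtest \<phi> x b)"
      by (rule tensor_form_cong[OF is_vspace_tensor is_vspace_tensor bilinear_form_prod[OF dcounit_linear dtest_functional]])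
        (simp_all add: dcounit_dtest)
    also have "\<dots> = dtest (\<lambda>h. sw (al h) (\<lambda>p q. counit H p * \<phi> q)) (ai x) c"
      by (simp add: dcomul_dtest eps_linear \<phi>)
    also have "\<dots> = dtest \<phi> x (dtwist c)"
      unfolding dtest_dtwist[OF c \<phi> \<open>x \<in> C\<close>]
      by (rule dtest_cong) (simp_all add: functional_comul_prod eps_linear \<phi> counit_left)
    finally show "dtest \<phi> x (tensor_lift Dbl Dbl Dbl (\<lambda>x y. fscale (dcounit x) y) (dcomul c)) = dtest \<phi> x (dtwist c)" .
  qed simp
  show "tensor_lift Dbl Dbl Dbl (\<lambda>x y. fscale (dcounit y) x) (dcomul c) = dtwist c"
  proof (rule D_eqI[OF m(2)])
    fix \<phi> x assume \<phi>: "functional H \<phi>" and [simp]: "x \<in> C"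
    have "dtest \<phi> x (tensor_lift Dbl Dbl Dbl (\<lambda>x y. fscale (dcounit y) x) (dcomul c)) =
        dcomul c (\<lambda>a b. dtest \<phi> x (fscale (dcounit b) a))"
      by (rule tensor_lift_apply[OF Dbl_vspace b'(2) _ cm]) (simp add: Dbl_linear dtest_functional)
    also have "\<dots> = dcomul c (\<lambda>a b. dtest \<phi> x a * dcounit b)" by (simp only: sc mult.commute)
    also have "\<dots> = dcomul c (\<lambda>a b. dtest \<phi> x a * dtest (counit H) (unt H) b)"
      by (rule tensor_form_cong[OF is_vspace_tensor is_vspace_tensor bilinear_form_prod[OF dtest_functional dcounit_linear]])
        (simp_all add: dcounit_dtest)
    also have "\<dots> = dtest (\<lambda>h. sw (al h) (\<lambda>p q. \<phi> p * counit H q)) (ai x) c"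
      by (simp add: dcomul_dtest eps_linear \<phi>)
    also have "\<dots> = dtest \<phi> x (dtwist c)"
      unfolding dtest_dtwist[OF c \<phi> \<open>x \<in> C\<close>]
      by (rule dtest_cong[OF c functional_comul_prod[OF \<phi> eps_linear]])
        (simp add: counit_right[OF \<phi>] mult.commute[of "\<phi> _"])
    finally show "dtest \<phi> x (tensor_lift Dbl Dbl Dbl (\<lambda>x y. fscale (dcounit y) x) (dcomul c)) = dtest \<phi> x (dtwist c)" .
  qed simp
qed

text \<open>Under \<open>dtest\<close> the statement separates: the part from the dual is
  associativity of \<open>\<cdot>\<close> on the points \<open>x\<close>, \<open>y\<close>,
  \<open>z\<close>, and the part from \<open>H\<close> is coassociativity of
  \<open>sw\<close>.\<close>

lemma dcomul_coassoc:
  assumes c [simp]: "c \<in> vcarrier D"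
  shows "tensor_assoc Dbl Dbl Dbl (tensor_map Dbl Dbl (tensor Dbl Dbl) Dbl dcomul dtwist (dcomul c)) =
    tensor_map Dbl Dbl Dbl (tensor Dbl Dbl) dtwist dcomul (dcomul c)"
proof -
  have dl: "linear_map Dbl (tensor Dbl Dbl) dcomul" and gl: "linear_map Dbl Dbl dtwist"
    using dcomul_linear dtwist_linear by (simp_all add: tensor_Dbl Dbl_linear)
  have cm: "dcomul c \<in> vcarrier (tensor Dbl Dbl)" by (simp add: tensor_Dbl)
  have ttf: "functional Dbl (dtest \<phi> x)" for \<phi> x by (simp add: Dbl_linear dtest_functional)
  have m1: "tensor_assoc Dbl Dbl Dbl (tensor_map Dbl Dbl (tensor Dbl Dbl) Dbl dcomul dtwist (dcomul c)) \<in> vcarrier (tensor D (tensor D D))"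
    using tensor_assoc_mem[OF Dbl_vspace Dbl_vspace Dbl_vspace
      linear_map_mem[OF tensor_map_linear[OF is_vspace_tensor Dbl_vspace dl gl] cm]] by (simp add: tensor_Dbl)
  have m2: "tensor_map Dbl Dbl Dbl (tensor Dbl Dbl) dtwist dcomul (dcomul c) \<in> vcarrier (tensor D (tensor D D))"
    using linear_map_mem[OF tensor_map_linear[OF Dbl_vspace is_vspace_tensor gl dl] cm] by (simp add: tensor_Dbl)
  show ?thesis
  proof (rule tensor_DDD_eqI[OF m1 m2])
    fix \<phi> x \<psi> y \<chi> z
    assume \<phi>: "functional H \<phi>" and \<psi>: "functional H \<psi>" and \<chi>: "functional H \<chi>"
      and [simp]: "x \<in> C" "y \<in> C" "z \<in> C"
    have al: "functional H (\<lambda>h. \<theta> (al h))" if "functional H \<theta>" for \<theta>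
      using that al_linear by (auto intro: linear_map_comp)
    let ?P = "\<lambda>h. sw (al h) (\<lambda>p q. \<phi> p * \<psi> q)" and ?Q = "\<lambda>h. sw (al h) (\<lambda>p q. \<psi> p * \<chi> q)"
    have P: "functional H ?P" and Q: "functional H ?Q" by (simp_all add: functional_comul_prod \<phi> \<psi> \<chi>)
    have "dcomul c (\<lambda>p q. dcomul p (\<lambda>a b. dtest \<phi> x a * dtest \<psi> y b) * dtest \<chi> z (dtwist q)) =
        dcomul c (\<lambda>p q. dtest ?P (ai (x \<cdot> y)) p * dtest (\<lambda>h. \<chi> (al h)) (ai z) q)"
      by (rule tensor_form_cong[OF is_vspace_tensor is_vspace_tensor bilinear_form_prod[OF
            linear_map_comp[OF dcomul_linear linear_map_eval] linear_map_comp[OF dtwist_linear dtest_functional]]])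
        (simp_all add: dcomul_dtest dtest_dtwist \<phi> \<psi> \<chi>)
    also have "\<dots> = dtest (\<lambda>h. sw (al h) (\<lambda>p q. ?P p * \<chi> (al q))) (ai (ai (x \<cdot> y) \<cdot> ai z)) c"
      by (simp add: dcomul_dtest P al \<chi>)
    also have "\<dots> = dtest (\<lambda>h. sw (al h) (\<lambda>p q. \<phi> (al p) * ?Q q)) (ai (ai x \<cdot> ai (y \<cdot> z))) c"
    proof -
      have "ai (ai (x \<cdot> y) \<cdot> ai z) = ai (ai x \<cdot> ai (y \<cdot> z))" by (simp add: ai_um assoc)
      moreover have "sw (al h) (\<lambda>p q. ?P p * \<chi> (al q)) = sw (al h) (\<lambda>p q. \<phi> (al p) * ?Q q)" if [simp]: "h \<in> C" for h
        using coassoc[of "al h" "\<lambda>u v w. \<phi> (al u) * (\<psi> (al v) * \<chi> (al w))"]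
        by (simp add: sw_al bilinear_form_prod \<phi> \<psi> \<chi> al sw_mult_right sw_mult_left mult.assoc)
      ultimately show ?thesis
        by (simp only:) (rule dtest_cong[OF c functional_comul_prod[OF P al[OF \<chi>]]])
    qed
    also have "\<dots> = dcomul c (\<lambda>p q. dtest (\<lambda>h. \<phi> (al h)) (ai x) p * dtest ?Q (ai (y \<cdot> z)) q)"
      by (simp add: dcomul_dtest Q al \<phi>)
    also have "\<dots> = dcomul c (\<lambda>p q. dtest \<phi> x (dtwist p) * dcomul q (\<lambda>a b. dtest \<psi> y a * dtest \<chi> z b))"
      by (rule tensor_form_cong[OF is_vspace_tensor is_vspace_tensor bilinear_form_prod[OF dtest_functional dtest_functional]])
        (simp_all add: dcomul_dtest dtest_dtwist \<phi> \<psi> \<chi>)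
    finally show "tensor_assoc Dbl Dbl Dbl (tensor_map Dbl Dbl (tensor Dbl Dbl) Dbl dcomul dtwist (dcomul c))
        (\<lambda>a r. dtest \<phi> x a * r (\<lambda>b c. dtest \<psi> y b * dtest \<chi> z c)) =
      tensor_map Dbl Dbl Dbl (tensor Dbl Dbl) dtwist dcomul (dcomul c) (\<lambda>a r. dtest \<phi> x a * r (\<lambda>b c. dtest \<psi> y b * dtest \<chi> z c))"
      by (simp only: hom_coassoc_eval[OF Dbl_vspace dl gl cm ttf ttf ttf])
  qed
qed

lemma hom_coalgebra_Dbl: "hom_coalgebra Dbl"
  unfolding hom_coalgebra_def
proof (intro conjI ballI)
  show "linear_map Dbl (tensor Dbl Dbl) (comul Dbl)"
    using dcomul_linear by (simp add: tensor_Dbl Dbl_linear Dbl_simps)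
  show "linear_map Dbl ground (counit Dbl)" using dcounit_linear by (simp add: Dbl_linear Dbl_simps)
  show "linear_map Dbl Dbl (twist Dbl)" using dtwist_linear by (simp add: Dbl_linear Dbl_simps)
  fix c assume "c \<in> vcarrier Dbl"
  then have c: "c \<in> vcarrier D" by (simp add: Dbl_simps)
  show "counit Dbl (twist Dbl c) = counit Dbl c" using c by (simp add: Dbl_simps dcounit_dtwist)
  show "tensor_map Dbl Dbl Dbl Dbl (twist Dbl) (twist Dbl) (comul Dbl c) = comul Dbl (twist Dbl c)"
    using dcomul_dtwist[OF c] by (simp add: Dbl_simps)
  show "tensor_lift Dbl Dbl Dbl (\<lambda>x y. smult Dbl (counit Dbl x) y) (comul Dbl c) = twist Dbl c"
    "tensor_lift Dbl Dbl Dbl (\<lambda>x y. smult Dbl (counit Dbl y) x) (comul Dbl c) = twist Dbl c"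
    using dcomul_counit[OF c] by (simp_all only: Dbl_simps)
  show "tensor_assoc Dbl Dbl Dbl (tensor_map Dbl Dbl (tensor Dbl Dbl) Dbl (comul Dbl) (twist Dbl) (comul Dbl c)) =
      tensor_map Dbl Dbl Dbl (tensor Dbl Dbl) (twist Dbl) (comul Dbl) (comul Dbl c)"
    using dcomul_coassoc[OF c] by (simp only: Dbl_simps)
qed (rule Dbl_vspace)

section \<open>Multiplicativity of the coproduct\<close>

lemma dual_split_cong:
  assumes "f \<in> C'" "\<And>f1 f2. f1 \<in> C' \<Longrightarrow> f2 \<in> C' \<Longrightarrow> \<beta> f1 f2 = \<beta>' f1 f2"
  shows "dual_split f \<beta> = dual_split f \<beta>'"
  unfolding dual_split_def using assms by (intro sum.cong refl) (simp add: dual_split_mem)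

lemma dual_split_sw: "dual_split f (\<lambda>f1 f2. sw a (\<beta> f1 f2)) = sw a (\<lambda>x y. dual_split f (\<lambda>f1 f2. \<beta> f1 f2 x y))"
  unfolding dual_split_def by (rule sw_sum)

lemma mul_test_alt: "mul_test h f k g \<phi> x = sw k (\<lambda>k1 r. sw r (\<lambda>k2 k3. sw x (\<lambda>p q.
    \<phi> (k2 \<cdot> h) * (f (S (al k1) \<cdot> (p \<cdot> al k3)) * g q))))"
  by (simp only: mul_test_def sw_mult_left)

text \<open>The components of \<open>f\<close> and \<open>g\<close> occur only through their values,
  so \<open>dual_split_prod\<close> recombines each pair into one value at a product. The
  \<open>ai\<close> arising there is recorded as \<open>Hd_twist\<close>, in the form that
  \<open>mul_test_comul\<close> expects.\<close>

lemma dual_split_mul_test: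
  assumes f [simp]: "f \<in> C'" and g [simp]: "g \<in> C'"
    and [simp]: "h1 \<in> C" "h2 \<in> C" "k' \<in> C" "k'' \<in> C" "x \<in> C" "y \<in> C"
  shows "dual_split f (\<lambda>f1 f2. dual_split g (\<lambda>g1 g2. mul_test h1 f1 k' g1 \<phi> x * mul_test h2 f2 k'' g2 \<psi> y)) =
    sw k' (\<lambda>k1 r. sw r (\<lambda>k2 k3. sw x (\<lambda>x1 x2. sw k'' (\<lambda>k4 s. sw s (\<lambda>k5 k6. sw y (\<lambda>y1 y2.
      \<phi> (k2 \<cdot> h1) * \<psi> (k5 \<cdot> h2) *
        (Hd_twist f ((S (al k1) \<cdot> (x1 \<cdot> al k3)) \<cdot> (S (al k4) \<cdot> (y1 \<cdot> al k6))) * Hd_twist g (x2 \<cdot> y2))))))))"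
proof -
  have "mul_test h1 f1 k' g1 \<phi> x * mul_test h2 f2 k'' g2 \<psi> y =
    sw k' (\<lambda>k1 r. sw r (\<lambda>k2 k3. sw x (\<lambda>x1 x2. sw k'' (\<lambda>k4 s. sw s (\<lambda>k5 k6. sw y (\<lambda>y1 y2.
      \<phi> (k2 \<cdot> h1) * \<psi> (k5 \<cdot> h2) *
        (f1 (S (al k1) \<cdot> (x1 \<cdot> al k3)) * f2 (S (al k4) \<cdot> (y1 \<cdot> al k6))) * (g1 x2 * g2 y2)))))))" for f1 f2 g1 g2
  proof -
    have "mul_test h1 f1 k' g1 \<phi> x * mul_test h2 f2 k'' g2 \<psi> y =
      sw k' (\<lambda>k1 r. sw r (\<lambda>k2 k3. sw x (\<lambda>x1 x2. sw k'' (\<lambda>k4 s. sw s (\<lambda>k5 k6. sw y (\<lambda>y1 y2.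
        (\<phi> (k2 \<cdot> h1) * (f1 (S (al k1) \<cdot> (x1 \<cdot> al k3)) * g1 x2)) *
          (\<psi> (k5 \<cdot> h2) * (f2 (S (al k4) \<cdot> (y1 \<cdot> al k6)) * g2 y2))))))))"
      unfolding mul_test_alt by (simp only: sw_mult_right) (simp only: sw_mult_left)
    then show ?thesis by (simp add: mult_ac)
  qed
  then have "dual_split f (\<lambda>f1 f2. dual_split g (\<lambda>g1 g2. mul_test h1 f1 k' g1 \<phi> x * mul_test h2 f2 k'' g2 \<psi> y)) =
    sw k' (\<lambda>k1 r. sw r (\<lambda>k2 k3. sw x (\<lambda>x1 x2. sw k'' (\<lambda>k4 s. sw s (\<lambda>k5 k6. sw y (\<lambda>y1 y2.
      dual_split f (\<lambda>f1 f2. dual_split g (\<lambda>g1 g2. \<phi> (k2 \<cdot> h1) * \<psi> (k5 \<cdot> h2) *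
        (f1 (S (al k1) \<cdot> (x1 \<cdot> al k3)) * f2 (S (al k4) \<cdot> (y1 \<cdot> al k6))) * (g1 x2 * g2 y2)))))))))"
    by (simp only: dual_split_sw)
  also have "\<dots> = sw k' (\<lambda>k1 r. sw r (\<lambda>k2 k3. sw x (\<lambda>x1 x2. sw k'' (\<lambda>k4 s. sw s (\<lambda>k5 k6. sw y (\<lambda>y1 y2.
      \<phi> (k2 \<cdot> h1) * \<psi> (k5 \<cdot> h2) *
        (Hd_twist f ((S (al k1) \<cdot> (x1 \<cdot> al k3)) \<cdot> (S (al k4) \<cdot> (y1 \<cdot> al k6))) * Hd_twist g (x2 \<cdot> y2))))))))"
  proof (intro sw_cong refl)
    fix k1 k2 k3 k4 k5 k6 x1 x2 y1 y2
    assume [simp]: "k1 \<in> C" "k2 \<in> C" "k3 \<in> C" "k4 \<in> C" "k5 \<in> C" "k6 \<in> C" "x1 \<in> C" "x2 \<in> C" "y1 \<in> C" "y2 \<in> C"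
    let ?X = "S (al k1) \<cdot> (x1 \<cdot> al k3)" and ?Y = "S (al k4) \<cdot> (y1 \<cdot> al k6)"
    have "dual_split f (\<lambda>f1 f2. dual_split g (\<lambda>g1 g2. \<phi> (k2 \<cdot> h1) * \<psi> (k5 \<cdot> h2) * (f1 ?X * f2 ?Y) * (g1 x2 * g2 y2))) =
        dual_split f (\<lambda>f1 f2. \<phi> (k2 \<cdot> h1) * \<psi> (k5 \<cdot> h2) * g (ai (x2 \<cdot> y2)) * (f1 ?X * f2 ?Y))"
      unfolding dual_split_prod[OF g \<open>x2 \<in> C\<close> \<open>y2 \<in> C\<close>] by (simp only: mult_ac)
    also have "\<dots> = \<phi> (k2 \<cdot> h1) * \<psi> (k5 \<cdot> h2) * g (ai (x2 \<cdot> y2)) * f (ai (?X \<cdot> ?Y))"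
      by (rule dual_split_prod) simp_all
    finally show "dual_split f (\<lambda>f1 f2. dual_split g (\<lambda>g1 g2. \<phi> (k2 \<cdot> h1) * \<psi> (k5 \<cdot> h2) * (f1 ?X * f2 ?Y) * (g1 x2 * g2 y2))) =
      \<phi> (k2 \<cdot> h1) * \<psi> (k5 \<cdot> h2) * (Hd_twist f (?X \<cdot> ?Y) * Hd_twist g (x2 \<cdot> y2))"
      by (simp add: mult_ac)
  qed
  finally show ?thesis .
qed

lemma dcomul_dmul:
  assumes a: "a \<in> vcarrier D" and b: "b \<in> vcarrier D"
  shows "dcomul (dmul a b) = tensor_mul Dbl (dcomul a) (dcomul b)"
proof -
  note tm_linear = tensor_mul_linear[OF Dbl_vspace dmul_bilinear_Dbl, unfolded tensor_Dbl]
  note tm_mem = tensor_mul_mem[OF Dbl_vspace dmul_bilinear_Dbl, unfolded tensor_Dbl]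
  note dl = bilinear_left[OF dmul_bilinear linear_map_id] and dr = bilinear_right[OF dmul_bilinear linear_map_id]
  have pure: "dcomul (dmul (pt h f) (pt k g)) =
      tensor_mul Dbl (dcomul (pt h f)) (dcomul (pt k g))"
    if [simp]: "h \<in> C" "k \<in> C" and f [simp]: "f \<in> C'" and g [simp]: "g \<in> C'" for h k f g
  proof (rule tensor_DD_eqI)
    fix \<phi> x \<psi> y assume \<phi>: "functional H \<phi>" and \<psi>: "functional H \<psi>" and [simp]: "x \<in> C" "y \<in> C"
    let ?\<phi> = "\<lambda>h. \<phi> (al h)" and ?\<psi> = "\<lambda>h. \<psi> (al h)"
    have \<phi>': "functional H ?\<phi>" and \<psi>': "functional H ?\<psi>"
      using \<phi> \<psi> al_linear by (auto intro: linear_map_comp)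
    have ttl: "functional D (\<lambda>a. dtest \<phi> x (dmul a c))" "functional D (\<lambda>a. dtest \<phi> x (dmul c a))"
      if "c \<in> vcarrier D" for \<phi> x c
      by (rule linear_map_comp[OF dl[OF that] dtest_functional] linear_map_comp[OF dr[OF that] dtest_functional])+
    have inner_bil: "bilinear_form D D (\<lambda>c d. dtest \<phi> x (dmul a c) * dtest \<psi> y (dmul b d))"
      if "a \<in> vcarrier D" "b \<in> vcarrier D" for a b
      by (rule bilinear_form_prod) (simp_all add: ttl that)
    have outer_bil: "bilinear_form D D (\<lambda>a b. dcomul (pt k g) (\<lambda>c d. dtest \<phi> x (dmul a c) * dtest \<psi> y (dmul b d)))"
    proof (rule bilinear_mapI)
      fix a assume [simp]: "a \<in> vcarrier D"
      show "functional D (\<lambda>b. dcomul (pt k g) (\<lambda>c d. dtest \<phi> x (dmul a c) * dtest \<psi> y (dmul b d)))"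
        by (rule tensor_form_linear[where V = D and W = D and b = "\<lambda>b c d. dtest \<phi> x (dmul a c) * dtest \<psi> y (dmul b d)", OF is_vspace_tensor])
          (simp_all add: inner_bil functional_mult ttl)
      show "functional D (\<lambda>b. dcomul (pt k g) (\<lambda>c d. dtest \<phi> x (dmul b c) * dtest \<psi> y (dmul a d)))"
        by (rule tensor_form_linear[where V = D and W = D and b = "\<lambda>b c d. dtest \<phi> x (dmul b c) * dtest \<psi> y (dmul a d)", OF is_vspace_tensor])
          (simp_all add: inner_bil functional_mult ttl)
    qed
    have "tensor_mul Dbl (dcomul (pt h f)) (dcomul (pt k g)) (\<lambda>a b. dtest \<phi> x a * dtest \<psi> y b) =
      dcomul (pt h f) (\<lambda>a b. dcomul (pt k g) (\<lambda>c d. dtest \<phi> x (dmul a c) * dtest \<psi> y (dmul b d)))"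
      by (subst tensor_mul_eval[OF Dbl_vspace dmul_bilinear_Dbl])
        (simp_all add: tensor_Dbl bilinear_form_prod Dbl_linear dtest_functional Dbl_simps)
    also have "\<dots> = sw (al h) (\<lambda>h1 h2. dual_split f (\<lambda>f1 f2. dcomul (pt k g)
        (\<lambda>c d. dtest \<phi> x (dmul (pt h1 f1) c) * dtest \<psi> y (dmul (pt h2 f2) d))))"
      by (rule dcomul_pure_eval[OF _ _ outer_bil]) simp_all
    also have "\<dots> = sw (al h) (\<lambda>h1 h2. dual_split f (\<lambda>f1 f2. sw (al k) (\<lambda>k' k''. dual_split g (\<lambda>g1 g2.
        mul_test h1 f1 k' g1 ?\<phi> (ai x) * mul_test h2 f2 k'' g2 ?\<psi> (ai y)))))"
    proof (intro sw_cong refl dual_split_cong[OF f])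
      fix h1 h2 f1 f2
      assume [simp]: "h1 \<in> C" "h2 \<in> C" "f1 \<in> C'" "f2 \<in> C'"
      have "dcomul (pt k g)
          (\<lambda>c d. dtest \<phi> x (dmul (pt h1 f1) c) * dtest \<psi> y (dmul (pt h2 f2) d)) =
        sw (al k) (\<lambda>k' k''. dual_split g (\<lambda>g1 g2.
          dtest \<phi> x (dmul (pt h1 f1) (pt k' g1)) *
          dtest \<psi> y (dmul (pt h2 f2) (pt k'' g2))))"
        by (rule dcomul_pure_eval[OF _ _ inner_bil]) simp_all
      also have "\<dots> = sw (al k) (\<lambda>k' k''. dual_split g (\<lambda>g1 g2.
          mul_test h1 f1 k' g1 ?\<phi> (ai x) * mul_test h2 f2 k'' g2 ?\<psi> (ai y)))"
        by (intro sw_cong refl dual_split_cong[OF g]) (simp add: dtest_dmul \<phi> \<psi> dtest_umul \<phi>' \<psi>')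
      finally show "dcomul (pt k g)
          (\<lambda>c d. dtest \<phi> x (dmul (pt h1 f1) c) * dtest \<psi> y (dmul (pt h2 f2) d)) =
        sw (al k) (\<lambda>k' k''. dual_split g (\<lambda>g1 g2.
          mul_test h1 f1 k' g1 ?\<phi> (ai x) * mul_test h2 f2 k'' g2 ?\<psi> (ai y)))" .
    qed
    \<comment> \<open>\<open>mul_test_comul\<close> read backwards, at twisted arguments because the
      coproduct of the double is taken after \<open>dtwist\<close>. The next step moves the twists
      from the arguments to the test.\<close>
    also have "\<dots> = mul_test (al h) (Hd_twist f) (al k) (Hd_twist g) (\<lambda>h. sw h (\<lambda>a b. ?\<phi> a * ?\<psi> b)) (ai x \<cdot> ai y)"
      by (simp add: dual_split_sw dual_split_mul_test mul_test_comul Hd_functional \<phi>' \<psi>' del: Hd_twist_apply S_al)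
    also have "\<dots> = mul_test h f k g (\<lambda>h. sw (al h) (\<lambda>a b. ?\<phi> a * ?\<psi> b)) (ai (ai x \<cdot> ai y))"
      by (rule mul_test_al) (simp_all add: functional_sw_arg linear_map_id)
    also have "\<dots> = mul_test h f k g (\<lambda>h. sw (al (al h)) (\<lambda>a b. \<phi> a * \<psi> b)) (ai (ai (x \<cdot> y)))"
      unfolding mul_test_def ai_um[OF \<open>x \<in> C\<close> \<open>y \<in> C\<close>]
      by (simp add: sw_al bilinear_form_prod \<phi> \<psi> \<phi>' \<psi>')
    also have "\<dots> = dcomul (dmul (pt h f) (pt k g)) (\<lambda>a b. dtest \<phi> x a * dtest \<psi> y b)"
      by (simp add: dcomul_dtest dmul_mem \<phi> \<psi> dtest_dmul functional_comul_prod dtest_umul functional_sw_arg linear_al linear_map_id)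
    finally show "dcomul (dmul (pt h f) (pt k g)) (\<lambda>a b. dtest \<phi> x a * dtest \<psi> y b) =
      tensor_mul Dbl (dcomul (pt h f)) (dcomul (pt k g)) (\<lambda>a b. dtest \<phi> x a * dtest \<psi> y b)" ..
  qed (simp_all add: dmul_mem tm_mem)
  have 1: "dcomul (dmul (pt h f) b) = tensor_mul Dbl (dcomul (pt h f)) (dcomul b)"
    if [simp]: "h \<in> C" "f \<in> C'" for h f
    by (rule tensor_linear_eqI[OF is_vspace_tensor linear_map_comp[OF dr dcomul_linear]
      linear_map_comp[OF dcomul_linear tm_linear(2)] b]) (simp_all add: pure)
  show ?thesis
    by (rule tensor_linear_eqI[OF is_vspace_tensor linear_map_comp[OF dl dcomul_linear]
      linear_map_comp[OF dcomul_linear tm_linear(1)] a]) (simp_all add: 1 b)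
qed

lemma dcomul_dunit: "dcomul dunit = pure_tensor D D dunit dunit"
proof (rule tensor_DD_eqI)
  fix \<phi> x \<psi> y assume \<phi>: "functional H \<phi>" and \<psi>: "functional H \<psi>" and [simp]: "x \<in> C" "y \<in> C"
  show "dcomul dunit (\<lambda>a b. dtest \<phi> x a * dtest \<psi> y b) = pure_tensor D D dunit dunit (\<lambda>a b. dtest \<phi> x a * dtest \<psi> y b)"
    by (simp add: dcomul_dtest \<phi> \<psi> pure_tensor_apply bilinear_form_prod dtest_functional)
      (simp add: dunit_def dtest_pure functional_comul_prod \<phi> \<psi> sw_u bilinear_form_prod unt_Hd_apply mult_ac)
qed (simp_all add: pure_tensor_mem)

lemma hom_bialgebra_Dbl: "hom_bialgebra Dbl"
  unfolding hom_bialgebra_def tensor_Dbl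
proof (intro conjI ballI)
  show "comul Dbl (unt Dbl) = pure_tensor D D (unt Dbl) (unt Dbl)" by (simp only: Dbl_simps dcomul_dunit)
  show "counit Dbl (unt Dbl) = 1" by (simp only: Dbl_simps dcounit_dunit)
  fix a b assume "a \<in> vcarrier Dbl" "b \<in> vcarrier Dbl"
  then have ab: "a \<in> vcarrier D" "b \<in> vcarrier D" by (simp_all add: Dbl_simps)
  show "comul Dbl (mul Dbl a b) = tensor_mul Dbl (comul Dbl a) (comul Dbl b)"
    by (simp only: Dbl_simps dcomul_dmul[OF ab])
  show "counit Dbl (mul Dbl a b) = counit Dbl a * counit Dbl b"
    by (simp add: Dbl_simps dmul_umul ab dcounit_dtwist dcounit_umul)
qed (rule hom_algebra_Dbl hom_coalgebra_Dbl)+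

text \<open>The antipode sends \<open>h \<otimes> f\<close>, the product of \<open>h \<otimes> \<epsilon>\<close> and \<open>1 \<otimes> f\<close>, to the product of the
  antipodes in reverse order; on \<open>H\<^sup>o\<^sup>p\<close> the antipode is the inverse of \<open>S\<close>.\<close>

definition dual_S where "dual_S f = restr H (\<lambda>x. f (S x))"

definition dantipode :: "('k, 'a) double \<Rightarrow> ('k, 'a) double" where
  "dantipode = tensor_lift H Hd D (\<lambda>h f. umul (pt (unt H) (dual_S f)) (pt (S_inv h) (unt Hd)))"

lemma dual_S_linear: "linear_map Hd Hd dual_S"
  unfolding dual_S_def[abs_def] by (rule linear_restr[OF Hd], auto intro: functional_Hd S_linear functional_at)

lemma dual_S_mem [simp]: "f \<in> C' \<Longrightarrow> dual_S f \<in> C'"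
  by (rule linear_map_mem[OF dual_S_linear])

lemma dual_S_apply [simp]: "x \<in> C \<Longrightarrow> dual_S f x = f (S x)"
  by (simp add: dual_S_def)

lemma dantipode_bilinear: "bilinear_map H Hd D (\<lambda>h f. umul (pt (unt H) (dual_S f)) (pt (S_inv h) (unt Hd)))"
  by (rule bilinear_mapI)
    (simp_all add: bilinear_left[OF umul_bilinear] bilinear_right[OF umul_bilinear] pure_left pure_right dual_S_linear S_inv_linear)

lemma dantipode_linear: "linear_map D D dantipode"
  unfolding dantipode_def by (rule tensor_lift_linear[OF is_vspace_tensor dantipode_bilinear])

lemma dantipode_mem [simp]: "t \<in> vcarrier D \<Longrightarrow> dantipode t \<in> vcarrier D"
  by (rule linear_map_mem[OF dantipode_linear])

lemma dantipode_pure: "h \<in> C \<Longrightarrow> f \<in> C' \<Longrightarrow> dantipode (pt h f) =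
    umul (pt (unt H) (dual_S f)) (pt (S_inv h) (unt Hd))"
  unfolding dantipode_def by (rule tensor_lift_pure[OF is_vspace_tensor dantipode_bilinear])

lemma dantipode_dtwist:
  assumes t: "t \<in> vcarrier D"
  shows "dantipode (dtwist t) = dtwist (dantipode t)"
proof (rule tensor_linear_eqI[OF is_vspace_tensor linear_map_comp[OF dtwist_linear dantipode_linear]
      linear_map_comp[OF dantipode_linear dtwist_linear] t])
  fix h f assume [simp]: "h \<in> C" "f \<in> C'"
  have "S_inv (al h) = al (S_inv h)" using S_inv_S[of "al (S_inv h)"] by simp
  moreover have "Hd_twist (unt Hd) = unt Hd" by (rule Hd_eqI) (simp_all add: unt_Hd_apply)
  moreover have "Hd_twist (dual_S f) = dual_S (Hd_twist f)" by (rule Hd_eqI) (simp_all add: S_ai)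
  ultimately show "dantipode (dtwist (pt h f)) = dtwist (dantipode (pt h f))"
    by (simp add: dtwist_pure dantipode_pure dtwist_umul)
qed

text \<open>Passes from values at points to an arbitrary functional \<open>G\<close> on the dual:
  the values determine the finite sum as a multiple of the dual unit, and \<open>G\<close> commutes
  with that sum.\<close>

lemma dual_split_linear:
  assumes f [simp]: "f \<in> C'" and G: "functional Hd G"
    and b: "\<And>f1 f2. f1 \<in> C' \<Longrightarrow> f2 \<in> C' \<Longrightarrow> b f1 f2 \<in> C'"
    and e: "\<And>x. x \<in> C \<Longrightarrow> dual_split f (\<lambda>f1 f2. b f1 f2 x) = c * counit H x"
  shows "dual_split f (\<lambda>f1 f2. G (b f1 f2)) = c * G (unt Hd)"
proof -
  let ?s = "\<Sum>i\<in>B. b (restr H (crd i)) (restr H (\<lambda>k. f (ai (i \<cdot> k))))"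
  have m: "b (restr H (crd i)) (restr H (\<lambda>k. f (ai (i \<cdot> k)))) \<in> C'" if "i \<in> B" for i
    using that by (intro b dual_split_mem[OF f])
  have "?s = fscale c (unt Hd)"
  proof (rule Hd_eqI)
    show "?s \<in> C'" by (rule vspace_sum[OF Hd m])
    show "fscale c (unt Hd) \<in> C'" using vspace_smult[OF Hd unt_Hd_mem, of c] by simp
    fix x assume "x \<in> C"
    have "?s x = (\<Sum>i\<in>B. b (restr H (crd i)) (restr H (\<lambda>k. f (ai (i \<cdot> k)))) x)"
      using linear_map_sum[OF Hd is_vspace_ground functional_at[of x], of B
        "\<lambda>i. b (restr H (crd i)) (restr H (\<lambda>k. f (ai (i \<cdot> k))))"] m by simp
    then show "?s x = fscale c (unt Hd) x"
      using e[OF \<open>x \<in> C\<close>] \<open>x \<in> C\<close> by (simp add: dual_split_def fscale_def unt_Hd_apply)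
  qed
  moreover have "dual_split f (\<lambda>f1 f2. G (b f1 f2)) = G ?s"
    unfolding dual_split_def by (rule linear_map_sum[OF Hd is_vspace_ground G m, symmetric])
  moreover have "G (fscale c (unt Hd)) = c * G (unt Hd)"
    using linear_map_smult[OF G unt_Hd_mem] by simp
  ultimately show ?thesis by simp
qed

text \<open>Evaluated at \<open>x\<close>, the convolution recombines into \<open>f\<close> at
  \<open>S p \<cdot> q\<close> or \<open>p \<cdot> S q\<close>, up to \<open>ai\<close>. So the
  antipode axioms of \<open>H\<close> give those of the dual.\<close>

lemma dual_antipode:
  assumes f [simp]: "f \<in> C'" and G: "functional Hd G"
  shows "dual_split f (\<lambda>f1 f2. G (conv (dual_S f1) f2)) = f (unt H) * G (unt Hd)"
    and "dual_split f (\<lambda>f1 f2. G (conv f1 (dual_S f2))) = f (unt H) * G (unt Hd)"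
proof -
  note [simp] = linH functional_Hd[OF f]
  have 1: "dual_split f (\<lambda>f1 f2. conv (dual_S f1) f2 x) = f (unt H) * counit H x" if [simp]: "x \<in> C" for x
  proof -
    have "dual_split f (\<lambda>f1 f2. conv (dual_S f1) f2 x) = sw x (\<lambda>p q. f (ai (S p \<cdot> q)))"
      using dual_split_prod[OF f, where c = 1] by (simp add: conv_apply dual_split_sw)
    also have "\<dots> = counit H x * f (ai (unt H))" by (rule antipode_left) simp_all
    finally show ?thesis by simp
  qed
  show "dual_split f (\<lambda>f1 f2. G (conv (dual_S f1) f2)) = f (unt H) * G (unt Hd)"
    by (rule dual_split_linear[OF f G _ 1]) simp
  have 2: "dual_split f (\<lambda>f1 f2. conv f1 (dual_S f2) x) = f (unt H) * counit H x" if [simp]: "x \<in> C" for x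
  proof -
    have "dual_split f (\<lambda>f1 f2. conv f1 (dual_S f2) x) = sw x (\<lambda>p q. f (ai (p \<cdot> S q)))"
      using dual_split_prod[OF f, where c = 1] by (simp add: conv_apply dual_split_sw)
    also have "\<dots> = counit H x * f (ai (unt H))" by (rule antipode_right) simp_all
    finally show ?thesis by simp
  qed
  show "dual_split f (\<lambda>f1 f2. G (conv f1 (dual_S f2))) = f (unt H) * G (unt Hd)"
    by (rule dual_split_linear[OF f G _ 2]) simp
qed

text \<open>Each pure tensor is factored into an \<open>H\<close> part and a dual part. In the
  resulting product of four factors the inner two belong to one of the two embedded algebras and
  cancel there; the unit they leave lets the outer two cancel in the other.\<close>

lemma dantipode_antipode_pure:
  assumes \<theta>: "functional D \<theta>" and [simp]: "h \<in> C" "f \<in> C'"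
  shows "dcomul (pt h f) (\<lambda>a b. \<theta> (umul (dantipode a) b)) = counit H h * f (unt H) * \<theta> dunit"
    and "dcomul (pt h f) (\<lambda>a b. \<theta> (umul a (dantipode b))) = counit H h * f (unt H) * \<theta> dunit"
proof -
  let ?P = "pt"
  have bil: "bilinear_form D D (\<lambda>a b. \<theta> (umul (dantipode a) b))" "bilinear_form D D (\<lambda>a b. \<theta> (umul a (dantipode b)))"
    by (intro bilinear_mapI functional_umul_left[OF \<theta>] functional_umul_right[OF \<theta>] dantipode_linear linear_map_id; simp)+
  have split: "?P h f = umul (?P h (unt Hd)) (?P (unt H) f)" if "h \<in> C" "f \<in> C'" for h f
    using that by (simp add: umul_unt_left)
  have G: "functional Hd (\<lambda>f. \<theta> (?P (unt H) f))"
    by (rule linear_map_comp[OF pure_right[OF linear_map_id] \<theta>]) simp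
  have "dcomul (?P h f) (\<lambda>a b. \<theta> (umul (dantipode a) b)) =
      sw (al h) (\<lambda>h1 h2. dual_split f (\<lambda>f1 f2. \<theta> (umul (dantipode (?P h1 f1)) (?P h2 f2))))"
    by (simp add: dcomul_pure_eval bil)
  \<comment> \<open>The inner factors are the two from \<open>H\<close>, so the sum over
    \<open>h1\<close> and \<open>h2\<close> has to be brought inside.\<close>
  also have "\<dots> = dual_split f (\<lambda>f1 f2. sw (al h) (\<lambda>h1 h2. \<theta> (umul (dantipode (?P h1 f1)) (?P h2 f2))))"
    by (rule dual_split_sw[symmetric])
  also have "\<dots> = dual_split f (\<lambda>f1 f2. counit H h * \<theta> (?P (unt H) (conv (dual_S f1) f2)))"
  proof (rule dual_split_cong, simp)
    fix f1 f2 assume [simp]: "f1 \<in> C'" "f2 \<in> C'"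
    have F: "functional H (\<lambda>z. \<theta> (umul (?P (unt H) (dual_S f1)) (umul (?P z (unt Hd)) (?P (unt H) f2))))"
      by (rule functional_umul_right[OF \<theta>], rule bilinear_left[OF umul_bilinear], rule pure_left[OF linear_map_id]) simp_all
    have "umul (dantipode (?P h1 f1)) (?P h2 f2) = umul (?P (unt H) (dual_S f1)) (umul (?P (h2 \<cdot> S_inv h1) (unt Hd)) (?P (unt H) f2))"
      if [simp]: "h1 \<in> C" "h2 \<in> C" for h1 h2
      by (simp add: split[of h2 f2] dantipode_pure umul_assoc) (simp add: umul_assoc[symmetric] umul_unt_left)
    then have "sw (al h) (\<lambda>h1 h2. \<theta> (umul (dantipode (?P h1 f1)) (?P h2 f2))) =
        sw (al h) (\<lambda>h1 h2. \<theta> (umul (?P (unt H) (dual_S f1)) (umul (?P (h2 \<cdot> S_inv h1) (unt Hd)) (?P (unt H) f2))))"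
      by simp
    also have "\<dots> = counit H h * \<theta> (umul (?P (unt H) (dual_S f1)) (umul (?P (unt H) (unt Hd)) (?P (unt H) f2)))"
      using S_inv_antipode(1)[OF F, of "al h"] by simp
    also have "\<dots> = counit H h * \<theta> (?P (unt H) (conv (dual_S f1) f2))"
      by (simp add: umul_unt_left umul_unt_right)
    finally show "sw (al h) (\<lambda>h1 h2. \<theta> (umul (dantipode (?P h1 f1)) (?P h2 f2))) = counit H h * \<theta> (?P (unt H) (conv (dual_S f1) f2))" .
  qed
  also have "\<dots> = f (unt H) * (counit H h * \<theta> (?P (unt H) (unt Hd)))"
    by (rule dual_antipode(1)[OF _ functional_mult(1)[OF G]]) simp
  finally show "dcomul (?P h f) (\<lambda>a b. \<theta> (umul (dantipode a) b)) = counit H h * f (unt H) * \<theta> dunit"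
    by (simp add: dunit_def mult_ac)
  have "dcomul (?P h f) (\<lambda>a b. \<theta> (umul a (dantipode b))) =
      sw (al h) (\<lambda>h1 h2. dual_split f (\<lambda>f1 f2. \<theta> (umul (?P h1 f1) (dantipode (?P h2 f2)))))"
    by (simp add: dcomul_pure_eval bil)
  \<comment> \<open>With the antipode on the right the inner factors are the two from the dual,
    whose sum is already innermost.\<close>
  also have "\<dots> = sw (al h) (\<lambda>h1 h2. f (unt H) * \<theta> (?P (S_inv h2 \<cdot> h1) (unt Hd)))"
  proof (intro sw_cong refl)
    fix h1 h2 assume [simp]: "h1 \<in> C" "h2 \<in> C"
    let ?G = "\<lambda>c. \<theta> (umul (?P h1 (unt Hd)) (umul (?P (unt H) c) (?P (S_inv h2) (unt Hd))))"
    have G: "functional Hd ?G"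
      by (rule functional_umul_right[OF \<theta>], rule bilinear_left[OF umul_bilinear], rule pure_right[OF linear_map_id]) simp_all
    have "umul (?P h1 f1) (dantipode (?P h2 f2)) = umul (?P h1 (unt Hd)) (umul (?P (unt H) (conv f1 (dual_S f2))) (?P (S_inv h2) (unt Hd)))"
      if [simp]: "f1 \<in> C'" "f2 \<in> C'" for f1 f2
      by (simp add: split[of h1 f1] dantipode_pure umul_assoc umul_unt_right[symmetric])
    then have "dual_split f (\<lambda>f1 f2. \<theta> (umul (?P h1 f1) (dantipode (?P h2 f2)))) = dual_split f (\<lambda>f1 f2. ?G (conv f1 (dual_S f2)))"
      by (intro dual_split_cong) simp_all
    also have "\<dots> = f (unt H) * ?G (unt Hd)" by (rule dual_antipode(2)[OF _ G]) simp
    finally show "dual_split f (\<lambda>f1 f2. \<theta> (umul (?P h1 f1) (dantipode (?P h2 f2)))) = f (unt H) * \<theta> (?P (S_inv h2 \<cdot> h1) (unt Hd))"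
      by (simp add: umul_unt_left)
  qed
  also have "\<dots> = counit H (al h) * (f (unt H) * \<theta> (?P (unt H) (unt Hd)))"
    by (rule S_inv_antipode(2)[OF functional_mult(1)[OF linear_map_comp[OF pure_left[OF linear_map_id] \<theta>]]]) simp_all
  finally show "dcomul (?P h f) (\<lambda>a b. \<theta> (umul a (dantipode b))) = counit H h * f (unt H) * \<theta> dunit"
    by (simp add: dunit_def mult_ac)
qed

text \<open>\<open>dmul\<close> is \<open>umul\<close> followed by \<open>dtwist\<close>. The twist
  is absorbed into the test functional and fixes the unit, so the antipode of the untwisted product
  also serves the twisted one.\<close>

lemma dantipode_antipode:
  assumes t: "t \<in> vcarrier D"
  shows "tensor_lift Dbl Dbl Dbl (\<lambda>a b. dmul (dantipode a) b) (dcomul t) = fscale (dcounit t) dunit"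
    and "tensor_lift Dbl Dbl Dbl (\<lambda>a b. dmul a (dantipode b)) (dcomul t) = fscale (dcounit t) dunit"
proof -
  have bD': "bilinear_map D D D (\<lambda>a b. dmul (dantipode a) b)" "bilinear_map D D D (\<lambda>a b. dmul a (dantipode b))"
    by (rule bilinear_mapI;
        simp add: bilinear_left[OF dmul_bilinear] bilinear_right[OF dmul_bilinear] dantipode_linear linear_map_id)+
  then have b: "bilinear_map Dbl Dbl Dbl (\<lambda>a b. dmul (dantipode a) b)" "bilinear_map Dbl Dbl Dbl (\<lambda>a b. dmul a (dantipode b))"
    unfolding bilinear_map_def Dbl_linear Dbl_simps by simp_all
  have cm: "dcomul t \<in> vcarrier (tensor Dbl Dbl)" using t by (simp add: tensor_Dbl)
  have m: "tensor_lift Dbl Dbl Dbl (\<lambda>a b. dmul (dantipode a) b) (dcomul t) \<in> vcarrier D"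
    "tensor_lift Dbl Dbl Dbl (\<lambda>a b. dmul a (dantipode b)) (dcomul t) \<in> vcarrier D"
    using linear_map_mem[OF tensor_lift_linear[OF Dbl_vspace b(1)] cm]
      linear_map_mem[OF tensor_lift_linear[OF Dbl_vspace b(2)] cm] by (simp_all add: Dbl_simps)
  have r: "fscale (dcounit t) dunit \<in> vcarrier D" using vspace_smult[OF is_vspace_tensor[of H Hd] dunit_mem] by simp
  have sc: "dtest \<phi> x (fscale r t) = r * dtest \<phi> x t" for \<phi> x r t by (simp add: dtest_def fscale_def)
  have ext: "dcomul t (\<lambda>a b. \<theta> (umul (dantipode a) b)) = dcounit t * \<theta> dunit" "dcomul t (\<lambda>a b. \<theta> (umul a (dantipode b))) = dcounit t * \<theta> dunit"
    if \<theta>: "functional D \<theta>" for \<theta>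
    by (rule tensor_linear_eqI[OF is_vspace_ground linear_map_comp[OF dcomul_linear linear_map_eval]
        functional_mult(2)[OF dcounit_linear] t]; simp add: dantipode_antipode_pure[OF \<theta>] dcounit_dtest dtest_pure eps_linear)+
  have g: "functional D (\<lambda>t. dtest \<phi> x (dtwist t))" for \<phi> x by (rule linear_map_comp[OF dtwist_linear dtest_functional])
  have bD: "bilinear_form D D (\<lambda>a b. dtest \<phi> x (dmul (dantipode a) b))" "bilinear_form D D (\<lambda>a b. dtest \<phi> x (dmul a (dantipode b)))" for \<phi> x
    by (rule bilinear_map_comp[OF bD'(1) dtest_functional] bilinear_map_comp[OF bD'(2) dtest_functional])+
  show "tensor_lift Dbl Dbl Dbl (\<lambda>a b. dmul (dantipode a) b) (dcomul t) = fscale (dcounit t) dunit"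
  proof (rule D_eqI[OF m(1) r])
    fix \<phi> x assume "functional H \<phi>" "x \<in> C"
    have "dtest \<phi> x (tensor_lift Dbl Dbl Dbl (\<lambda>a b. dmul (dantipode a) b) (dcomul t)) = dcomul t (\<lambda>a b. dtest \<phi> x (dmul (dantipode a) b))"
      by (rule tensor_lift_apply[OF Dbl_vspace b(1) _ cm]) (simp add: Dbl_linear dtest_functional)
    also have "\<dots> = dcomul t (\<lambda>a b. dtest \<phi> x (dtwist (umul (dantipode a) b)))"
      by (rule tensor_form_cong[OF is_vspace_tensor is_vspace_tensor bD(1)]) (simp_all add: t dmul_umul)
    finally show "dtest \<phi> x (tensor_lift Dbl Dbl Dbl (\<lambda>a b. dmul (dantipode a) b) (dcomul t)) = dtest \<phi> x (fscale (dcounit t) dunit)"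
      by (simp add: ext(1)[OF g] sc)
  qed
  show "tensor_lift Dbl Dbl Dbl (\<lambda>a b. dmul a (dantipode b)) (dcomul t) = fscale (dcounit t) dunit"
  proof (rule D_eqI[OF m(2) r])
    fix \<phi> x assume "functional H \<phi>" "x \<in> C"
    have "dtest \<phi> x (tensor_lift Dbl Dbl Dbl (\<lambda>a b. dmul a (dantipode b)) (dcomul t)) = dcomul t (\<lambda>a b. dtest \<phi> x (dmul a (dantipode b)))"
      by (rule tensor_lift_apply[OF Dbl_vspace b(2) _ cm]) (simp add: Dbl_linear dtest_functional)
    also have "\<dots> = dcomul t (\<lambda>a b. dtest \<phi> x (dtwist (umul a (dantipode b))))"
      by (rule tensor_form_cong[OF is_vspace_tensor is_vspace_tensor bD(2)]) (simp_all add: t dmul_umul)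
    finally show "dtest \<phi> x (tensor_lift Dbl Dbl Dbl (\<lambda>a b. dmul a (dantipode b)) (dcomul t)) = dtest \<phi> x (fscale (dcounit t) dunit)"
      by (simp add: ext(2)[OF g] sc)
  qed
qed

lemma hom_hopf_algebra_Dbl: "hom_hopf_algebra Dbl dantipode"
  unfolding hom_hopf_algebra_def
proof (intro conjI ballI)
  show "linear_map Dbl Dbl dantipode" using dantipode_linear by (simp add: Dbl_linear)
  fix t assume "t \<in> vcarrier Dbl"
  then have t: "t \<in> vcarrier D" by (simp add: Dbl_simps)
  show "dantipode (twist Dbl t) = twist Dbl (dantipode t)" by (simp only: Dbl_simps dantipode_dtwist[OF t])
  show "tensor_lift Dbl Dbl Dbl (\<lambda>h1 h2. mul Dbl (dantipode h1) h2) (comul Dbl t) = smult Dbl (counit Dbl t) (unt Dbl)"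
    "tensor_lift Dbl Dbl Dbl (\<lambda>h1 h2. mul Dbl h1 (dantipode h2)) (comul Dbl t) = smult Dbl (counit Dbl t) (unt Dbl)"
    using dantipode_antipode[OF t] by (simp_all only: Dbl_simps)
qed (rule hom_bialgebra_Dbl)

end

theorem corollary2p16:
  fixes H :: "('k::field, 'a::ab_group_add) hom_struct" and S :: "'a \<Rightarrow> 'a"
  assumes "hom_hopf_algebra H S"
    and "finite_dim H"
    and "bij_betw (twist H) (vcarrier H) (vcarrier H)"
  shows "\<exists>T. hom_hopf_algebra (drinfeld_double H S) T"
proof -
  have "is_vspace H" using assms(1) by (simp add: hom_hopf_algebra_def hom_bialgebra_def hom_algebra_def)
  then obtain B crd where "finite B" "B \<subseteq> vcarrier H" "\<And>x. functional H (crd x)"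
    "\<And>v. v \<in> vcarrier H \<Longrightarrow> v = (\<Sum>x\<in>B. smult H (crd x v) x)"
    by (rule finite_dim_frame[OF _ assms(2)]) blast
  then interpret framed_hom_hopf H S B crd
    using assms by unfold_locales
  show ?thesis using hom_hopf_algebra_Dbl by blast
qed

end
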